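(* Let $T$ be a virtual $2$-string tangle and $K$ a long virtual knot, let $R(T)$ be the right closure of $T$, and let $T+K$ be the sum of $T$ and $K$. For any $a,b\in\{0,1\}$ the following hold. (i) $W_a(T+K;t)=W_a(R(T);t)+W_a(K;t)$. (ii) $F_{ab}(T+K;t)=F_{ab}(R(T);t)+F_{ab}(K;t)+\lambda_b(T)\cdot W_a(K;t)+\lambda_a(T)\cdot W_b(K;t^{-1})$. (iii) $G_{ab}(T+K;t)=G_{ab}(R(T);t)+G_{ab}(K;t)-\lambda_b(T)\cdot W_a(K;t)+V_a(T;t)\cdot W_b(K;t)$. (iv) $H_{ab}(T+K;t)=H_{ab}(R(T);t)+H_{ab}(K;t)+\bigl(U_b(T;t)-\lambda_b(T)\bigr)\cdot W_a(K;t^{-1})+\bigl(U_a(T;t^{-1})-\lambda_a(T)\bigr)\cdot W_b(K;t)$.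
   Context: Long virtual knots. A long virtual knot diagram is an oriented immersed line in $\mathbb{R}^2$ that coincides with the $x$-axis outside a $2$-disk (oriented from $-\infty$ to $\infty$), each of whose double points is either a real crossing (with over/under information) or a virtual crossing. A long virtual knot is an equivalence class of such diagrams under the generalized (real, virtual and mixed) Reidemeister moves performed inside a $2$-disk. Let $\Sigma_g$ be a connected oriented closed surface of genus $g$. A surface realization $(\Sigma_g,D)$ of a diagram $D$ is an oriented closed-curve diagram with a basepoint on $\Sigma_g$, having only real crossings, such that traversing it from the basepoint one meets the same real crossings, in the same order and with the same over/under information and signs, as when traversing $D$ from $-\infty$ to $\infty$. Polynomials. Let $c_1,\dots,c_n$ be the real crossings of a diagram $D$ of $K$, with signs $\varepsilon_i\in\{\pm1\}$. Call $c_i$ of type $0$ if, traversing $D$ from $-\infty$, one passes $c_i$ first over and then under; otherwise of type $1$. Put $I_a(D)=\{i\mid c_i\text{ is of type }a\}$ and $\omega_a(D)=\sum_{i\in I_a(D)}\varepsilon_i$ for $a\in\{0,1\}$. On a surface realization $(\Sigma_g,D)$, orientation-respecting smoothing at $c_i$ yields two cycles; $\alpha_i$ is the one not containing the basepoint and $\beta_i$ the one containing it. A dot denotes the intersection number of cycles on $\Sigma_g$ (with a fixed standard sign convention). The following are invariants of $K$, for $a,b\in\{0,1\}$: $W_a(K;t)=\sum_{i\in I_a(D)}\varepsilon_i(t^{\alpha_i\cdot\beta_i}-1)$; $F_{ab}(K;t)=\sum_{i\in I_a(D),\,j\in I_b(D)}\varepsilon_i\varepsilon_j(t^{\alpha_i\cdot\alpha_j}-1)$;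 $G_{ab}(K;t)=\sum_{i\in I_a(D),\,j\in I_b(D)}\varepsilon_i\varepsilon_j(t^{\alpha_i\cdot\beta_j}-1)-\omega_b(D)\,W_a(K;t)$; $H_{ab}(K;t)=\sum_{i\in I_a(D),\,j\in I_b(D)}\varepsilon_i\varepsilon_j(t^{\beta_i\cdot\beta_j}-1)-\omega_a(D)\,W_b(K;t)-\omega_b(D)\,W_a(K;t^{-1})$. Tangles. A virtual $2$-string tangle diagram $E$ is an oriented virtual tangle diagram in a disk with two strings: $A$, running from the lower left endpoint to the lower right endpoint, and $B$, running from the upper right endpoint to the upper left endpoint. A virtual $2$-string tangle $T$ is an equivalence class of such diagrams under generalized Reidemeister moves fixing the endpoints. The right closure diagram $R(E)$ is the long virtual knot diagram obtained by joining the two right endpoints (so one traverses $A$ and then $B$); the long virtual knot it presents is the right closure $R(T)$. If $D$ is a diagram of a long virtual knot $K$, $E+D$ is the long virtual knot diagram obtained by inserting $D$ in the closing arc of $R(E)$, i.e. joining the end of $A$ to the start of $D$ and the end of $D$ to the start of $B$ (so one traverses $A$, then $D$, then $B$); $T+K$ is the long virtual knot presented by $E+D$. Tangle invariants. Let $c_1,\dots,c_m$ be the real crossings of $E$ with signs $\varepsilon_i$. For $X\in\{A,B\}$, $J_0^X(E)$ (resp. $J_1^X(E)$) is the set of $i$ such that both paths at $c_i$ belong to $X$ and, along $X$, $c_i$ is passed first over then under (resp. first under then over). $J_0'(E)$ (resp. $J_1'(E)$) is the set of $i$ such that the over-path at $c_i$ belongs to $A$ and the under-path to $B$ (resp. over-path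 to $B$, under-path to $A$). Put $J_a(E)=J_a^A(E)\cup J_a^B(E)$. With $\alpha_i,\beta_i$ the cycles at $c_i$ for a surface realization of $R(E)$, define $U_a(T;t)=\sum_{i\in J_a(E)}\varepsilon_i(t^{\alpha_i\cdot\beta_i}-1)$, $V_a(T;t)=\sum_{i\in J_a'(E)}\varepsilon_i t^{\alpha_i\cdot\beta_i}$, and $\lambda_a(T)=V_a(T;1)=\sum_{i\in J_a'(E)}\varepsilon_i$. These are invariants of $T$. *)

theory Defs
  imports
    "HOL-Analysis.Analysis"
    "HOL-Combinatorics.Combinatorics"
    "HOL-Library.Poly_Mapping"
begin

section \<open>Generic curves with crossing information\<close>

text \<open>
  The plane is \<open>complex\<close>.  A diagram is a curve, parametrised by a set \<open>I\<close> of reals, with a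
  relation \<open>over\<close> on parameters: \<open>(s, t) \<in> over D\<close> means that the curve has a real crossing at
  \<open>curve D s = curve D t\<close>, at which the path through time \<open>s\<close> is the over-path and the one
  through time \<open>t\<close> the under-path.  So a pair \<open>(s, t) \<in> over D\<close> is a real crossing; a double
  point with neither \<open>(s, t)\<close> nor \<open>(t, s)\<close> in \<open>over D\<close> is a virtual crossing.
\<close>

record diagram =
  curve :: "real \<Rightarrow> complex"
  over :: "(real \<times> real) set"

definition det2 :: "complex \<Rightarrow> complex \<Rightarrow> real" where
  "det2 u v = Re u * Im v - Im u * Re v"

definition velocity :: "real set \<Rightarrow> diagram \<Rightarrow> real \<Rightarrow> complex" where
  "velocity I D t = vector_derivative (curve D) (at t within I)"

definition double_points :: "real set \<Rightarrow> diagram \<Rightarrow> (real \<times> real) set" where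
  "double_points I D = {(s, t). s \<in> I \<and> t \<in> I \<and> s \<noteq> t \<and> curve D s = curve D t}"

definition C1_immersion_on :: "real set \<Rightarrow> (real \<Rightarrow> complex) \<Rightarrow> bool" where
  "C1_immersion_on I \<gamma> \<longleftrightarrow>
     (\<exists>\<gamma>'. continuous_on I \<gamma>' \<and>
       (\<forall>t\<in>I. (\<gamma> has_vector_derivative \<gamma>' t) (at t within I) \<and> \<gamma>' t \<noteq> 0))"

definition generic_diagram :: "real set \<Rightarrow> diagram \<Rightarrow> bool" where
  "generic_diagram I D \<longleftrightarrow>
     C1_immersion_on I (curve D) \<and>
     finite (double_points I D) \<and>
     (\<forall>s t u. (s, t) \<in> double_points I D \<and> (s, u) \<in> double_points I D \<longrightarrow> t = u) \<and>
     (\<forall>(s, t)\<in>double_points I D. det2 (velocity I D s) (velocity I D t) \<noteq> 0) \<and>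
     over D \<subseteq> double_points I D \<and>
     (\<forall>(s, t)\<in>over D. (t, s) \<notin> over D)"

definition crossing_sign :: "real set \<Rightarrow> diagram \<Rightarrow> real \<times> real \<Rightarrow> int" where
  "crossing_sign I D c =
     (if det2 (velocity I D (fst c)) (velocity I D (snd c)) > 0 then 1 else - 1)"

definition crossing_type :: "real \<times> real \<Rightarrow> nat" where
  "crossing_type c = (if fst c < snd c then 0 else 1)"


section \<open>Planar isotopy and generalized Reidemeister moves\<close>

definition oriented_diffeo :: "(complex \<Rightarrow> complex) \<Rightarrow> bool" where
  "oriented_diffeo \<phi> \<longleftrightarrow> bij \<phi> \<and>
     (\<exists>\<phi>'. (\<forall>z. (\<phi> has_derivative \<phi>' z) (at z) \<and> det2 (\<phi>' z 1) (\<phi>' z \<i>) > 0) \<and>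
           (\<forall>v. continuous_on UNIV (\<lambda>z. \<phi>' z v)))"

definition increasing_reparam :: "real set \<Rightarrow> (real \<Rightarrow> real) \<Rightarrow> bool" where
  "increasing_reparam I \<rho> \<longleftrightarrow> strict_mono_on I \<rho> \<and>
     (\<forall>t\<in>I. \<exists>d>0. (\<rho> has_real_derivative d) (at t within I))"

definition isotopic_via ::
    "real set \<Rightarrow> (complex \<Rightarrow> complex) \<Rightarrow> diagram \<Rightarrow> diagram \<Rightarrow> bool" where
  "isotopic_via I \<phi> D D' \<longleftrightarrow> oriented_diffeo \<phi> \<and>
     (\<exists>\<rho>. increasing_reparam I \<rho> \<and> bij_betw \<rho> I I \<and>
        (\<forall>t\<in>I. curve D' t = \<phi> (curve D (\<rho> t))) \<and>
        over D' = {(s, t). s \<in> I \<and> t \<in> I \<and> (\<rho> s, \<rho> t) \<in> over D})"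

definition box2 :: "complex set" where
  "box2 = {z. \<bar>Re z\<bar> \<le> 1 \<and> \<bar>Im z\<bar> \<le> 1}"

text \<open>
  \<open>local_change I M n m m' \<phi> a b \<rho> D D'\<close>: \<open>D\<close> and \<open>D'\<close> coincide outside the disk \<open>\<phi> ` box2\<close>
  (contained in \<open>M\<close>); inside, \<open>D\<close> is the image under \<open>\<phi>\<close> of the model picture with strands
  \<open>m 0, \<dots>, m (n - 1)\<close> and \<open>D'\<close> that of the model picture with strands \<open>m' 0, \<dots>, m' (n - 1)\<close>.
  Strand \<open>k\<close> is run through during the times \<open>{a k..b k}\<close>; the order of these time intervals and
  the direction in which each strand is traversed (\<open>\<rho> k\<close> may be decreasing) are arbitrary.
\<close>

definition local_change ::
    "real set \<Rightarrow> complex set \<Rightarrow> nat \<Rightarrow> (nat \<Rightarrow> real \<Rightarrow> complex) \<Rightarrow> (nat \<Rightarrow> real \<Rightarrow> complex) \<Rightarrow>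
     (complex \<Rightarrow> complex) \<Rightarrow> (nat \<Rightarrow> real) \<Rightarrow> (nat \<Rightarrow> real) \<Rightarrow> (nat \<Rightarrow> real \<Rightarrow> real) \<Rightarrow>
     diagram \<Rightarrow> diagram \<Rightarrow> bool" where
  "local_change I M n m m' \<phi> a b \<rho> D D' \<longleftrightarrow>
     oriented_diffeo \<phi> \<and> \<phi> ` box2 \<subseteq> M \<and>
     (\<forall>k<n. a k < b k \<and> {a k..b k} \<subseteq> I \<and>
        bij_betw (\<rho> k) {a k..b k} {-1..1} \<and>
        (\<forall>t\<in>{a k..b k}. \<exists>d. d \<noteq> 0 \<and>
           (\<rho> k has_real_derivative d) (at t within {a k..b k})) \<and>
        (\<forall>t\<in>{a k..b k}. curve D t = \<phi> (m k (\<rho> k t)) \<and> curve D' t = \<phi> (m' k (\<rho> k t)))) \<and>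
     (\<forall>k<n. \<forall>l<n. k \<noteq> l \<longrightarrow> {a k..b k} \<inter> {a l..b l} = {}) \<and>
     (\<forall>t \<in> I - (\<Union>k<n. {a k..b k}). curve D' t = curve D t \<and> curve D t \<notin> \<phi> ` box2) \<and>
     (\<forall>s t. s \<notin> (\<Union>k<n. {a k..b k}) \<or> t \<notin> (\<Union>k<n. {a k..b k}) \<longrightarrow>
        ((s, t) \<in> over D' \<longleftrightarrow> (s, t) \<in> over D))"

text \<open>
  The models, all with strands parametrised by \<open>{-1..1}\<close>.  The two sides of each move agree to
  first order at the end points.  \<open>R1_kink\<close> has its only double point at the parameters
  \<open>\<plusminus> 1/2\<close>; in \<open>R2_before\<close> the two strands meet exactly at \<open>\<plusminus> 1/2\<close>; in \<open>R3_before\<close> and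
  \<open>R3_after\<close> strand 2 passes below, respectively above, the common point \<open>0\<close> of strands 0 and 1
  and meets each of them once, at \<open>\<plusminus> 1/2\<close>.
\<close>

definition R1_kink :: "nat \<Rightarrow> real \<Rightarrow> complex" where
  "R1_kink k x = Complex (x - 16 / 9 * x * (1 - x\<^sup>2)\<^sup>2) ((1 - x\<^sup>2)\<^sup>2 / 2)"

definition R1_straight :: "nat \<Rightarrow> real \<Rightarrow> complex" where
  "R1_straight k x = Complex x 0"

definition R2_before :: "nat \<Rightarrow> real \<Rightarrow> complex" where
  "R2_before k x = Complex x (if k = 0 then 0 else 1 / 2 - 8 / 9 * (1 - x\<^sup>2)\<^sup>2)"

definition R2_after :: "nat \<Rightarrow> real \<Rightarrow> complex" where
  "R2_after k x = Complex x (if k = 0 then 0 else 1 / 2)"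

definition R3_before :: "nat \<Rightarrow> real \<Rightarrow> complex" where
  "R3_before k x = Complex x
     (if k = 0 then x / 2 else if k = 1 then - x / 2 else - (4 / 9) * (1 - x\<^sup>2)\<^sup>2)"

definition R3_after :: "nat \<Rightarrow> real \<Rightarrow> complex" where
  "R3_after k x = Complex x
     (if k = 0 then x / 2 else if k = 1 then - x / 2 else 4 / 9 * (1 - x\<^sup>2)\<^sup>2)"

text \<open>The kink may be real (with either crossing information) or virtual.\<close>

definition R1_move :: "real set \<Rightarrow> complex set \<Rightarrow> diagram \<Rightarrow> diagram \<Rightarrow> bool" where
  "R1_move I M D D' \<longleftrightarrow> (\<exists>\<phi> a b \<rho>. local_change I M 1 R1_kink R1_straight \<phi> a b \<rho> D D')"

text \<open>Either both crossings are virtual, or both are real with the same strand on top.\<close>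

definition R2_move :: "real set \<Rightarrow> complex set \<Rightarrow> diagram \<Rightarrow> diagram \<Rightarrow> bool" where
  "R2_move I M D D' \<longleftrightarrow> (\<exists>\<phi> a b \<rho>. local_change I M 2 R2_before R2_after \<phi> a b \<rho> D D' \<and>
     (let X = double_points I D \<inter> {a 0..b 0} \<times> {a 1..b 1} in
        X \<inter> over D = {} \<and> X \<inter> (over D)\<inverse> = {} \<or> X \<subseteq> over D \<or> X \<subseteq> (over D)\<inverse>))"

definition strand_over ::
    "(nat \<Rightarrow> real) \<Rightarrow> (nat \<Rightarrow> real) \<Rightarrow> diagram \<Rightarrow> nat \<Rightarrow> nat \<Rightarrow> bool" where
  "strand_over a b D k l \<longleftrightarrow> (\<exists>s\<in>{a k..b k}. \<exists>t\<in>{a l..b l}. (s, t) \<in> over D)"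

text \<open>
  Two kinds of third moves are allowed: those in which one strand is virtual at both of its
  crossings (the crossing of the other two being arbitrary: the virtual and the mixed move), and
  those with three real crossings in which the strands are a top, a middle and a bottom one.
\<close>

definition R3_move :: "real set \<Rightarrow> complex set \<Rightarrow> diagram \<Rightarrow> diagram \<Rightarrow> bool" where
  "R3_move I M D D' \<longleftrightarrow> (\<exists>\<phi> a b \<rho>. local_change I M 3 R3_before R3_after \<phi> a b \<rho> D D' \<and>
     (\<forall>k<3. \<forall>l<3. k \<noteq> l \<longrightarrow> (strand_over a b D k l \<longleftrightarrow> strand_over a b D' k l)) \<and>
     ((\<exists>k<3. \<forall>l<3. \<not> strand_over a b D k l \<and> \<not> strand_over a b D l k) \<or>
      (\<exists>k l m. {k, l, m} = {0, 1, 2} \<and>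
         strand_over a b D k l \<and> strand_over a b D k m \<and> strand_over a b D l m)))"

definition reidemeister_move :: "real set \<Rightarrow> complex set \<Rightarrow> diagram \<Rightarrow> diagram \<Rightarrow> bool" where
  "reidemeister_move I M D D' \<longleftrightarrow> R1_move I M D D' \<or> R2_move I M D D' \<or> R3_move I M D D'"


section \<open>Long virtual knots\<close>

definition long_diagram :: "diagram \<Rightarrow> bool" where
  "long_diagram D \<longleftrightarrow> generic_diagram UNIV D \<and>
     (\<exists>r. \<forall>t. r \<le> \<bar>t\<bar> \<longrightarrow> curve D t = of_real t)"

definition long_step :: "(diagram \<times> diagram) set" where
  "long_step = {(D, D'). long_diagram D \<and> long_diagram D' \<and>
     ((\<exists>\<phi>. bounded {z. \<phi> z \<noteq> z} \<and> isotopic_via UNIV \<phi> D D') \<or>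
      reidemeister_move UNIV UNIV D D')}"

definition long_equiv :: "(diagram \<times> diagram) set" where
  "long_equiv = (long_step \<union> long_step\<inverse>)\<^sup>*"

definition long_virtual_knots :: "diagram set set" where
  "long_virtual_knots = Collect long_diagram // long_equiv"


section \<open>Virtual 2-string tangles\<close>

text \<open>
  The disk is the closed disk of radius \<open>sqrt 2\<close> about \<open>0\<close>, the end points are \<open>\<plusminus> 1 \<plusminus> \<i>\<close>.  The
  string \<open>A\<close> is parametrised by \<open>{0..1}\<close> and the string \<open>B\<close> by \<open>{2..3}\<close>; hence the order of
  traversal of a closure (first \<open>A\<close>, then \<open>B\<close>) is the order of the parameters.
\<close>

abbreviation str_A :: "real set" where "str_A \<equiv> {0..1}"
abbreviation str_B :: "real set" where "str_B \<equiv> {2..3}"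
abbreviation str_AB :: "real set" where "str_AB \<equiv> str_A \<union> str_B"

definition tangle_disk :: "complex set" where
  "tangle_disk = cball 0 (sqrt 2)"

text \<open>The last condition says that the strings meet the boundary circle transversally.\<close>

definition tangle_diagram :: "diagram \<Rightarrow> bool" where
  "tangle_diagram E \<longleftrightarrow> generic_diagram str_AB E \<and>
     curve E 0 = Complex (-1) (-1) \<and> curve E 1 = Complex 1 (-1) \<and>
     curve E 2 = Complex 1 1 \<and> curve E 3 = Complex (-1) 1 \<and>
     curve E ` (str_AB - {0, 1, 2, 3}) \<subseteq> interior tangle_disk \<and>
     (\<forall>t\<in>{0, 1, 2, 3}. inner (curve E t) (velocity str_AB E t) \<noteq> 0)"

definition tangle_step :: "(diagram \<times> diagram) set" where
  "tangle_step = {(E, E'). tangle_diagram E \<and> tangle_diagram E' \<and>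
     ((\<exists>\<phi>. \<phi> ` tangle_disk = tangle_disk \<and> isotopic_via str_AB \<phi> E E') \<or>
      reidemeister_move str_AB (interior tangle_disk) E E')}"

definition tangle_equiv :: "(diagram \<times> diagram) set" where
  "tangle_equiv = (tangle_step \<union> tangle_step\<inverse>)\<^sup>*"

definition virtual_tangles :: "diagram set set" where
  "virtual_tangles = Collect tangle_diagram // tangle_equiv"

text \<open>
  \<open>right_closure_diagram E X \<sigma>\<close>: the long diagram \<open>X\<close> is obtained from \<open>E\<close> by joining end points.
  It runs through a copy \<open>h ` tangle_disk\<close> of the disk exactly during the times \<open>\<sigma> ` str_AB\<close>,
  along \<open>A\<close> and then \<open>B\<close>, and the rest of \<open>X\<close> (the closing arc and the two ends) lies outside
  this copy and has no double points.  As the end of \<open>B\<close> has to be joined to infinity outside the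
  disk, the closing arc passes the disk on its right side.
\<close>

definition right_closure_diagram :: "diagram \<Rightarrow> diagram \<Rightarrow> (real \<Rightarrow> real) \<Rightarrow> bool" where
  "right_closure_diagram E X \<sigma> \<longleftrightarrow>
     tangle_diagram E \<and> long_diagram X \<and> increasing_reparam str_AB \<sigma> \<and>
     (\<exists>h. oriented_diffeo h \<and>
        (\<forall>t\<in>str_AB. curve X (\<sigma> t) = h (curve E t)) \<and>
        (\<forall>t. t \<in> \<sigma> ` str_AB \<or> curve X t \<notin> h ` tangle_disk)) \<and>
     inj_on (curve X) (- \<sigma> ` str_AB) \<and>
     over X = map_prod \<sigma> \<sigma> ` over E"

text \<open>
  \<open>sum_diagram E D X\<close>: the long diagram \<open>X\<close> is an \<open>E + D\<close>.  Here the part of \<open>D\<close> in the disk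
  \<open>cball 0 r\<close>, outside which \<open>D\<close> is the real axis, is inserted in the closing arc.
\<close>

definition sum_diagram :: "diagram \<Rightarrow> diagram \<Rightarrow> diagram \<Rightarrow> bool" where
  "sum_diagram E D X \<longleftrightarrow>
     tangle_diagram E \<and> long_diagram D \<and> long_diagram X \<and>
     (\<exists>r \<sigma> \<tau> h k. r > 0 \<and>
        (\<forall>t. (r \<le> \<bar>t\<bar> \<longrightarrow> curve D t = of_real t) \<and> (\<bar>t\<bar> < r \<longrightarrow> norm (curve D t) < r)) \<and>
        increasing_reparam str_AB \<sigma> \<and> increasing_reparam {-r..r} \<tau> \<and>
        \<sigma> 1 < \<tau> (- r) \<and> \<tau> r < \<sigma> 2 \<and>
        oriented_diffeo h \<and> oriented_diffeo k \<and> h ` tangle_disk \<inter> k ` cball 0 r = {} \<and>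
        (\<forall>t\<in>str_AB. curve X (\<sigma> t) = h (curve E t)) \<and>
        (\<forall>t\<in>{-r..r}. curve X (\<tau> t) = k (curve D t)) \<and>
        (\<forall>t. t \<in> \<sigma> ` str_AB \<or> t \<in> \<tau> ` {-r..r} \<or>
           curve X t \<notin> h ` tangle_disk \<union> k ` cball 0 r) \<and>
        inj_on (curve X) (- (\<sigma> ` str_AB \<union> \<tau> ` {-r..r})) \<and>
        over X = map_prod \<sigma> \<sigma> ` over E \<union> map_prod \<tau> \<tau> ` over D)"

text \<open>\<open>R = R(T)\<close>, respectively \<open>S = T + K\<close>, as equivalence classes of diagrams.\<close>

definition is_right_closure :: "diagram set \<Rightarrow> diagram set \<Rightarrow> bool" where
  "is_right_closure T R \<longleftrightarrow> R \<in> long_virtual_knots \<and>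
     (\<exists>E\<in>T. \<exists>X\<in>R. \<exists>\<sigma>. right_closure_diagram E X \<sigma>)"

definition is_tangle_sum :: "diagram set \<Rightarrow> diagram set \<Rightarrow> diagram set \<Rightarrow> bool" where
  "is_tangle_sum T K S \<longleftrightarrow> S \<in> long_virtual_knots \<and>
     (\<exists>E\<in>T. \<exists>D\<in>K. \<exists>X\<in>S. sum_diagram E D X)"


section \<open>Curve diagrams on closed oriented surfaces\<close>

text \<open>
  A closed oriented surface is given with a cell structure, that is, as a combinatorial map: a
  finite set of darts (oriented edges), the involution \<open>opp\<close> reversing a dart, and the permutation
  \<open>rot\<close> sending a dart to the counterclockwise next dart with the same initial point.  Edges,
  vertices and faces are the orbits of \<open>opp\<close>, \<open>rot\<close> and \<open>rot \<circ> opp\<close>.  Every closed oriented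
  surface with an embedded graph whose complement consists of open disks arises in this way; the
  genus is arbitrary.

  A based closed-curve diagram is a closed edge path \<open>d\<^sub>0, \<dots>, d\<^sub>n\<^sub>-\<^sub>1\<close> which uses each edge at most
  once and is generic: it visits each vertex at most twice, and crosses itself transversally at a
  vertex visited twice.  The base point is the initial point of \<open>d\<^sub>0\<close>.  Visit \<open>k\<close> is the passage
  from \<open>d\<^sub>k\<^sub>-\<^sub>1\<close> to \<open>d\<^sub>k\<close>.  Other edges and vertices of the cell structure need not lie on the curve.
  All double points are real crossings; \<open>(j, k) \<in> s_over S\<close> means that visit \<open>j\<close> is the over-path
  and visit \<open>k\<close> the under-path.
\<close>

record surface_diagram =
  darts :: "nat set"
  opp :: "nat \<Rightarrow> nat"
  rot :: "nat \<Rightarrow> nat"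
  walk :: "nat list"
  s_over :: "(nat \<times> nat) set"

definition closed_surface :: "surface_diagram \<Rightarrow> bool" where
  "closed_surface S \<longleftrightarrow>
     finite (darts S) \<and> darts S \<noteq> {} \<and>
     opp S permutes darts S \<and> (\<forall>d\<in>darts S. opp S d \<noteq> d \<and> opp S (opp S d) = d) \<and>
     rot S permutes darts S \<and>
     (\<forall>d\<in>darts S. \<forall>e\<in>darts S. (d, e) \<in> {(x, y). y = rot S x \<or> y = opp S x}\<^sup>*)"

definition out_dart :: "surface_diagram \<Rightarrow> nat \<Rightarrow> nat" where
  "out_dart S k = walk S ! k"

definition in_dart :: "surface_diagram \<Rightarrow> nat \<Rightarrow> nat" where
  "in_dart S k = opp S (walk S ! ((k + length (walk S) - 1) mod length (walk S)))"

definition s_double_points :: "surface_diagram \<Rightarrow> (nat \<times> nat) set" where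
  "s_double_points S = {(j, k). j < length (walk S) \<and> k < length (walk S) \<and> j \<noteq> k \<and>
     out_dart S k \<in> orbit (rot S) (out_dart S j)}"

text \<open>
  For darts \<open>p, q, q'\<close> at one vertex: rotating counterclockwise from \<open>p\<close> one meets \<open>q\<close> before \<open>q'\<close>.
\<close>

definition ccw_before :: "surface_diagram \<Rightarrow> nat \<Rightarrow> nat \<Rightarrow> nat \<Rightarrow> bool" where
  "ccw_before S p q q' \<longleftrightarrow> funpow_dist (rot S) p q < funpow_dist (rot S) p q'"

definition closed_curve_diagram :: "surface_diagram \<Rightarrow> bool" where
  "closed_curve_diagram S \<longleftrightarrow>
     closed_surface S \<and> walk S \<noteq> [] \<and> set (walk S) \<subseteq> darts S \<and>
     (\<forall>k<length (walk S). in_dart S k \<in> orbit (rot S) (out_dart S k)) \<and>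
     distinct (walk S @ map (opp S) (walk S)) \<and>
     (\<forall>i j k. (i, j) \<in> s_double_points S \<and> (i, k) \<in> s_double_points S \<longrightarrow> j = k) \<and>
     (\<forall>k. (0, k) \<notin> s_double_points S) \<and>
     (\<forall>(j, k)\<in>s_double_points S.
        ccw_before S (out_dart S j) (out_dart S k) (in_dart S j) \<noteq>
        ccw_before S (out_dart S j) (in_dart S k) (in_dart S j)) \<and>
     s_over S \<subseteq> s_double_points S \<and>
     (\<forall>(j, k)\<in>s_double_points S. (j, k) \<in> s_over S \<longleftrightarrow> (k, j) \<notin> s_over S)"

definition s_sign :: "surface_diagram \<Rightarrow> nat \<times> nat \<Rightarrow> int" where
  "s_sign S c = (if ccw_before S (out_dart S (fst c)) (out_dart S (snd c)) (in_dart S (fst c))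
     then 1 else - 1)"

definition crossing_times :: "diagram \<Rightarrow> real set" where
  "crossing_times D = fst ` over D \<union> snd ` over D"

text \<open>
  \<open>S\<close> is a surface realization of \<open>D\<close>; the passages of \<open>D\<close> through its real crossings correspond,
  in order, to the visits of \<open>S\<close> to its double points via \<open>f\<close>.
\<close>

definition surface_realization :: "diagram \<Rightarrow> surface_diagram \<Rightarrow> (real \<Rightarrow> nat) \<Rightarrow> bool" where
  "surface_realization D S f \<longleftrightarrow>
     closed_curve_diagram S \<and>
     strict_mono_on (crossing_times D) f \<and>
     s_over S = map_prod f f ` over D \<and>
     (\<forall>c\<in>over D. s_sign S (map_prod f f c) = crossing_sign UNIV D c)"

text \<open>
  Cellular 1-chains are functions on darts which are antisymmetric under \<open>opp\<close>.  \<open>path_chain S P\<close>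
  is the chain of the part of the curve consisting of the darts \<open>d\<^sub>k\<close> with \<open>k \<in> P\<close>.
\<close>

definition path_chain :: "surface_diagram \<Rightarrow> nat set \<Rightarrow> nat \<Rightarrow> int" where
  "path_chain S P d = of_bool (d \<in> out_dart S ` P) - of_bool (opp S d \<in> out_dart S ` P)"

text \<open>
  The two cycles obtained by smoothing at the crossing of visits \<open>fst c\<close> and \<open>snd c\<close>; \<open>\<beta>\<close> is the
  one through the base point.
\<close>

definition alpha_range :: "nat \<times> nat \<Rightarrow> nat set" where
  "alpha_range c = {min (fst c) (snd c)..<max (fst c) (snd c)}"

definition alpha_cycle :: "surface_diagram \<Rightarrow> nat \<times> nat \<Rightarrow> nat \<Rightarrow> int" where
  "alpha_cycle S c = path_chain S (alpha_range c)"

definition beta_cycle :: "surface_diagram \<Rightarrow> nat \<times> nat \<Rightarrow> nat \<Rightarrow> int" where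
  "beta_cycle S c = path_chain S ({..<length (walk S)} - alpha_range c)"

text \<open>
  Intersection number of 1-cycles \<open>x\<close>, \<open>y\<close>, with \<open>x \<bullet> y = 1\<close> for cycles crossing once if the
  directions of \<open>x\<close> and \<open>y\<close> at the crossing form a positive basis.

  Push \<open>y\<close> off the edges of the cell structure, to one side of each edge.  The intersections with
  \<open>x\<close> then lie near the vertices, and near a vertex \<open>v\<close> the two cycles are flows in a disk with
  boundary values \<open>x p\<close>, \<open>y p\<close> (outgoing) at the darts \<open>p\<close> of \<open>v\<close>.  The sum below, over all pairs
  of darts at \<open>v\<close> in counterclockwise order, adds up the intersections for the two opposite choices
  of the sides; these have the same total, whence the division by 2.  It does not depend on the
  dart at which the cyclic order is cut open, here \<open>Min v\<close>, as the values of a cycle at the darts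
  of a vertex add up to 0.  The total is congruent to the sum of \<open>x p * y p\<close> over all darts modulo
  2, hence even, so that \<open>div\<close> is exact.
\<close>

definition s_vertices :: "surface_diagram \<Rightarrow> nat set set" where
  "s_vertices S = orbit (rot S) ` darts S"

definition intersection_number ::
    "surface_diagram \<Rightarrow> (nat \<Rightarrow> int) \<Rightarrow> (nat \<Rightarrow> int) \<Rightarrow> int" where
  "intersection_number S x y =
     (\<Sum>v\<in>s_vertices S. \<Sum>j<card v. \<Sum>i<j.
        (let p = (rot S ^^ i) (Min v); q = (rot S ^^ j) (Min v) in x p * y q - x q * y p)) div 2"


section \<open>The polynomial invariants\<close>

text \<open>Laurent polynomials in \<open>t\<close> over the integers, as the group ring of the integers.\<close>

type_synonym laurent = "int \<Rightarrow>\<^sub>0 int"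

definition tpow :: "int \<Rightarrow> laurent" where
  "tpow n = Poly_Mapping.single n 1"

text \<open>Substitution of the inverse of \<open>t\<close> for \<open>t\<close>.\<close>

definition tinv :: "laurent \<Rightarrow> laurent" where
  "tinv p = Poly_Mapping.map_key uminus p"

abbreviation lsign :: "diagram \<Rightarrow> real \<times> real \<Rightarrow> int" where
  "lsign D c \<equiv> crossing_sign UNIV D c"

definition crossings_of_type :: "nat \<Rightarrow> diagram \<Rightarrow> (real \<times> real) set" where
  "crossings_of_type a D = {c \<in> over D. crossing_type c = a}"

definition writhe_of_type :: "nat \<Rightarrow> diagram \<Rightarrow> int" where
  "writhe_of_type a D = (\<Sum>c\<in>crossings_of_type a D. lsign D c)"

definition W_diag :: "nat \<Rightarrow> diagram \<Rightarrow> surface_diagram \<Rightarrow> (real \<Rightarrow> nat) \<Rightarrow> laurent" where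
  "W_diag a D S f = (let \<alpha> = \<lambda>c. alpha_cycle S (map_prod f f c);
                         \<beta> = \<lambda>c. beta_cycle S (map_prod f f c) in
     (\<Sum>c\<in>crossings_of_type a D.
        of_int (lsign D c) * (tpow (intersection_number S (\<alpha> c) (\<beta> c)) - 1)))"

definition F_diag ::
    "nat \<Rightarrow> nat \<Rightarrow> diagram \<Rightarrow> surface_diagram \<Rightarrow> (real \<Rightarrow> nat) \<Rightarrow> laurent" where
  "F_diag a b D S f = (let \<alpha> = \<lambda>c. alpha_cycle S (map_prod f f c) in
     (\<Sum>c\<in>crossings_of_type a D. \<Sum>d\<in>crossings_of_type b D.
        of_int (lsign D c * lsign D d) * (tpow (intersection_number S (\<alpha> c) (\<alpha> d)) - 1)))"

definition G_diag ::
    "nat \<Rightarrow> nat \<Rightarrow> diagram \<Rightarrow> surface_diagram \<Rightarrow> (real \<Rightarrow> nat) \<Rightarrow> laurent" where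
  "G_diag a b D S f = (let \<alpha> = \<lambda>c. alpha_cycle S (map_prod f f c);
                           \<beta> = \<lambda>c. beta_cycle S (map_prod f f c) in
     (\<Sum>c\<in>crossings_of_type a D. \<Sum>d\<in>crossings_of_type b D.
        of_int (lsign D c * lsign D d) * (tpow (intersection_number S (\<alpha> c) (\<beta> d)) - 1))
     - of_int (writhe_of_type b D) * W_diag a D S f)"

definition H_diag ::
    "nat \<Rightarrow> nat \<Rightarrow> diagram \<Rightarrow> surface_diagram \<Rightarrow> (real \<Rightarrow> nat) \<Rightarrow> laurent" where
  "H_diag a b D S f = (let \<beta> = \<lambda>c. beta_cycle S (map_prod f f c) in
     (\<Sum>c\<in>crossings_of_type a D. \<Sum>d\<in>crossings_of_type b D.
        of_int (lsign D c * lsign D d) * (tpow (intersection_number S (\<beta> c) (\<beta> d)) - 1))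
     - of_int (writhe_of_type a D) * W_diag b D S f
     - of_int (writhe_of_type b D) * tinv (W_diag a D S f))"

text \<open>
  The invariants of a long virtual knot \<open>K\<close>: the value computed from any diagram in \<open>K\<close> and any
  surface realization of it.
\<close>

definition knot_value ::
    "(diagram \<Rightarrow> surface_diagram \<Rightarrow> (real \<Rightarrow> nat) \<Rightarrow> laurent) \<Rightarrow> diagram set \<Rightarrow> laurent" where
  "knot_value \<Phi> K = (THE p. \<exists>D\<in>K. \<exists>S f. surface_realization D S f \<and> p = \<Phi> D S f)"

definition W_poly :: "nat \<Rightarrow> diagram set \<Rightarrow> laurent" where
  "W_poly a = knot_value (W_diag a)"

definition F_poly :: "nat \<Rightarrow> nat \<Rightarrow> diagram set \<Rightarrow> laurent" where
  "F_poly a b = knot_value (F_diag a b)"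

definition G_poly :: "nat \<Rightarrow> nat \<Rightarrow> diagram set \<Rightarrow> laurent" where
  "G_poly a b = knot_value (G_diag a b)"

definition H_poly :: "nat \<Rightarrow> nat \<Rightarrow> diagram set \<Rightarrow> laurent" where
  "H_poly a b = knot_value (H_diag a b)"

abbreviation tsign :: "diagram \<Rightarrow> real \<times> real \<Rightarrow> int" where
  "tsign E c \<equiv> crossing_sign str_AB E c"

text \<open>
  Since all parameters of \<open>A\<close> are smaller than those of \<open>B\<close>, the crossings of \<open>A\<close> with \<open>B\<close> at which
  \<open>A\<close> is the over-path are those of \<open>crossing_type\<close> 0.
\<close>

definition J_self :: "nat \<Rightarrow> diagram \<Rightarrow> (real \<times> real) set" where
  "J_self a E = {c \<in> over E. c \<in> str_A \<times> str_A \<union> str_B \<times> str_B \<and> crossing_type c = a}"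

definition J_mixed :: "nat \<Rightarrow> diagram \<Rightarrow> (real \<times> real) set" where
  "J_mixed a E = {c \<in> over E. c \<in> str_A \<times> str_B \<union> str_B \<times> str_A \<and> crossing_type c = a}"

text \<open>
  The exponent at a crossing of \<open>E\<close> is computed at the corresponding crossing of a surface
  realization of a right closure of \<open>E\<close>; \<open>g\<close> takes the parameters of \<open>E\<close> to the visits of \<open>S\<close>.
\<close>

definition tangle_index :: "surface_diagram \<Rightarrow> (real \<Rightarrow> nat) \<Rightarrow> real \<times> real \<Rightarrow> int" where
  "tangle_index S g c = intersection_number S
     (alpha_cycle S (map_prod g g c)) (beta_cycle S (map_prod g g c))"

definition U_diag :: "nat \<Rightarrow> diagram \<Rightarrow> surface_diagram \<Rightarrow> (real \<Rightarrow> nat) \<Rightarrow> laurent" where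
  "U_diag a E S g = (\<Sum>c\<in>J_self a E. of_int (tsign E c) * (tpow (tangle_index S g c) - 1))"

definition V_diag :: "nat \<Rightarrow> diagram \<Rightarrow> surface_diagram \<Rightarrow> (real \<Rightarrow> nat) \<Rightarrow> laurent" where
  "V_diag a E S g = (\<Sum>c\<in>J_mixed a E. of_int (tsign E c) * tpow (tangle_index S g c))"

definition tangle_value ::
    "(diagram \<Rightarrow> surface_diagram \<Rightarrow> (real \<Rightarrow> nat) \<Rightarrow> laurent) \<Rightarrow> diagram set \<Rightarrow> laurent" where
  "tangle_value \<Phi> T = (THE p. \<exists>E\<in>T. \<exists>X \<sigma> S f. right_closure_diagram E X \<sigma> \<and>
     surface_realization X S f \<and> p = \<Phi> E S (f \<circ> \<sigma>))"

definition U_poly :: "nat \<Rightarrow> diagram set \<Rightarrow> laurent" where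
  "U_poly a = tangle_value (U_diag a)"

definition V_poly :: "nat \<Rightarrow> diagram set \<Rightarrow> laurent" where
  "V_poly a = tangle_value (V_diag a)"

definition linking :: "nat \<Rightarrow> diagram set \<Rightarrow> int" where
  "linking a T = (THE n. \<exists>E\<in>T. n = (\<Sum>c\<in>J_mixed a E. tsign E c))"

end

theory Submission
  imports Defs
begin

text \<open>
  All quantities depend only on the chords (over-time, under-time) of the real crossings and their
  signs.  Give the cycle \<open>\<alpha>\<^sub>c\<close> the weight \<open>x\<^sub>c\<close> on times which is 2 inside the arc of \<open>c\<close>, 1 at the two
  ends (where the smoothing turns a corner) and 0 elsewhere.  Counting near each vertex gives
  \<open>4 (\<alpha>\<^sub>c \<bullet> \<alpha>\<^sub>d) = \<Sum>\<^sub>e \<epsilon>\<^sub>e (x\<^sub>c(o\<^sub>e) x\<^sub>d(u\<^sub>e) - x\<^sub>c(u\<^sub>e) x\<^sub>d(o\<^sub>e))\<close>, where \<open>o\<^sub>e\<close> and \<open>u\<^sub>e\<close> are the over- and the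
  under-time of \<open>e\<close>, and \<open>\<beta>\<^sub>c = \<gamma> - \<alpha>\<^sub>c\<close> where the whole curve \<open>\<gamma>\<close> has constant weight 2.  Hence every
  polynomial is a sum over one or two chords of a function of \<open>\<alpha>\<^sub>c \<bullet> \<gamma>\<close>, \<open>\<alpha>\<^sub>d \<bullet> \<gamma>\<close>, \<open>\<alpha>\<^sub>c \<bullet> \<alpha>\<^sub>d\<close>;
  the correction terms in \<open>G\<close> and \<open>H\<close> make this function vanish as soon as one chord is a kink.
  Invariance follows: a kink pairs trivially with everything, the two chords of a second move have
  opposite signs and equal pairings, and a third move preserves all pairings.

  In a diagram of \<open>T + K\<close> the weight of a chord of \<open>K\<close> vanishes at the times of \<open>T\<close>, and the weight of a
  chord \<open>c\<close> of \<open>T\<close> is constant on the times of \<open>K\<close>: it is 2 if \<open>c\<close> joins the two strings, else 0.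
  Therefore \<open>\<alpha>\<^sub>d \<bullet> \<alpha>\<^sub>c\<close>, for \<open>d\<close> in \<open>K\<close>, is \<open>\<alpha>\<^sub>d \<bullet> \<gamma>\<close> in the first case and 0 in the second, all other
  pairings are those of \<open>R(T)\<close> and \<open>K\<close>, and the mixed terms of the double sums factor.
\<close>

section \<open>The pairing of a signed chord diagram\<close>

text \<open>The strands of a move may occur in any order and direction, so invariance is proved once
  for an abstract relation \<open>gauss_step\<close> that records only how signs, labels and
  pairings change; geometry enters through signs and through the positions of chord ends. The
  strings of a tangle must be remembered: \<open>U\<close>, \<open>V\<close> and the linking numbers
  select chords by string, and \<open>V\<close>, whose terms do not vanish at exponent 0, survives a
  kink only because a kink never joins two strings. Hence a chord carries a label made of its type
  and the strings of its two ends. One factor 2 of the 4 comes from the intersection number, which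
  counts both push-offs and halves; the other from weights that add the edges entering and leaving a
  visit instead of averaging them. The invariants are definite descriptions, so a value has to
  exist: every chord diagram is realized on an explicitly built surface whose genus is left open.
  Finally, the diagrams of T behind the sum and behind the closure may differ; they are compared
  through equivalence of labelled chord diagrams.\<close>

definition chord_ends :: "('a \<times> 'a) set \<Rightarrow> 'a set" where
  "chord_ends C = fst ` C \<union> snd ` C"

definition chord_diagram :: "('a \<times> 'a) set \<Rightarrow> bool" where
  "chord_diagram C \<longleftrightarrow> finite C \<and> (\<forall>c\<in>C. fst c \<noteq> snd c) \<and>
     (\<forall>c\<in>C. \<forall>d\<in>C. c \<noteq> d \<longrightarrow> fst c \<noteq> fst d \<and> fst c \<noteq> snd d \<and> snd c \<noteq> fst d \<and> snd c \<noteq> snd d)"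

lemma chord_diagram_disjoint:
  assumes "chord_diagram C" "c \<in> C" "d \<in> C" "c \<noteq> d"
  shows "fst c \<noteq> fst d" "fst c \<noteq> snd d" "snd c \<noteq> fst d" "snd c \<noteq> snd d"
  using assms unfolding chord_diagram_def by simp_all

lemma chord_diagram_distinct_ends: "chord_diagram C \<Longrightarrow> c \<in> C \<Longrightarrow> fst c \<noteq> snd c"
  by (simp add: chord_diagram_def)

lemma chord_diagram_finite: "chord_diagram C \<Longrightarrow> finite C"
  by (simp add: chord_diagram_def)

text \<open>The first summand says that the edge leaving time \<open>t\<close> lies on the arc, the
  second that the edge entering it does. An end of the chord satisfies exactly one of the two: there
  the smoothed cycle turns its corner.\<close>

definition chord_arc :: "'a::linorder \<times> 'a \<Rightarrow> 'a \<Rightarrow> int" where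
  "chord_arc c t = of_bool (min (fst c) (snd c) \<le> t \<and> t < max (fst c) (snd c))
           + of_bool (min (fst c) (snd c) < t \<and> t \<le> max (fst c) (snd c))"

text \<open>Each crossing contributes the determinant of the two weights on its two paths.
  Exchanging over- and under-path together with the sign leaves a summand unchanged.\<close>

definition pairing ::
    "('a \<times> 'a) set \<Rightarrow> ('a \<times> 'a \<Rightarrow> int) \<Rightarrow> ('a \<Rightarrow> int) \<Rightarrow> ('a \<Rightarrow> int) \<Rightarrow> int" where
  "pairing C \<epsilon> x y = (\<Sum>e\<in>C. \<epsilon> e * (x (fst e) * y (snd e) - x (snd e) * y (fst e)))"

text \<open>The weight of the whole curve.\<close>

abbreviation core :: "'a \<Rightarrow> int" where "core \<equiv> (\<lambda>_. 2)"

text \<open>This is \<alpha> \<bullet> \<gamma> for the whole curve \<gamma>. It equals \<alpha>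
  \<bullet> \<beta>, since \<beta> is \<gamma> minus \<alpha> and \<alpha> pairs trivially with
  itself, so it is the exponent in \<open>W\<close>, \<open>U\<close> and \<open>V\<close>.\<close>

definition index :: "('a::linorder \<times> 'a) set \<Rightarrow> ('a \<times> 'a \<Rightarrow> int) \<Rightarrow> 'a \<times> 'a \<Rightarrow> int" where
  "index C \<epsilon> c = pairing C \<epsilon> (chord_arc c) core div 4"

lemma chord_ends_fst: "c \<in> C \<Longrightarrow> fst c \<in> chord_ends C"
  and chord_ends_snd: "c \<in> C \<Longrightarrow> snd c \<in> chord_ends C"
  by (auto simp: chord_ends_def)

lemma chord_ends_insert: "chord_ends (insert c C) = insert (fst c) (insert (snd c) (chord_ends C))"
  by (auto simp: chord_ends_def)

lemma chord_ends_map: "chord_ends (map_prod f f ` C) = f ` chord_ends C"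
  by (force simp: chord_ends_def)

lemma chord_diagram_insert:
  assumes "chord_diagram (insert k C)" "k \<notin> C"
  shows "chord_diagram C" "fst k \<noteq> snd k" "fst k \<notin> chord_ends C" "snd k \<notin> chord_ends C"
proof -
  have "fst c \<noteq> fst k \<and> snd c \<noteq> fst k \<and> fst c \<noteq> snd k \<and> snd c \<noteq> snd k" if "c \<in> C" for c
    using chord_diagram_disjoint[OF assms(1), of c k] assms(2) that by auto
  then show "fst k \<notin> chord_ends C" "snd k \<notin> chord_ends C"
    unfolding chord_ends_def by (metis Un_iff imageE)+
  show "chord_diagram C" "fst k \<noteq> snd k"
    using assms(1) by (auto simp: chord_diagram_def)
qed

lemma chord_arc_commute: "chord_arc (s, t) = chord_arc (t, s)"
  by (rule ext) (simp add: chord_arc_def min.commute max.commute)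

lemma chord_arc_end [simp]:
  "s \<noteq> t \<Longrightarrow> chord_arc (s, t) s = 1" "s \<noteq> t \<Longrightarrow> chord_arc (s, t) t = 1"
  by (auto simp: chord_arc_def min_def max_def)

lemma chord_arc_off:
  "u \<noteq> s \<Longrightarrow> u \<noteq> t \<Longrightarrow> chord_arc (s, t) u = (if (s < u) = (u < t) then 2 else 0)"
  by (auto simp: chord_arc_def min_def max_def)

lemma chord_arc_image:
  assumes "strict_mono_on A f" "fst c \<in> A" "snd c \<in> A" "u \<in> A"
  shows "chord_arc (map_prod f f c) (f u) = chord_arc c u"
proof -
  have lt: "\<And>x y. x \<in> A \<Longrightarrow> y \<in> A \<Longrightarrow> f x < f y \<longleftrightarrow> x < y"
    and le: "\<And>x y. x \<in> A \<Longrightarrow> y \<in> A \<Longrightarrow> f x \<le> f y \<longleftrightarrow> x \<le> y"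
    using strict_mono_on_less[OF assms(1)] strict_mono_on_less_eq[OF assms(1)] by blast+
  show ?thesis using assms
    by (simp add: chord_arc_def min_def max_def lt le)
qed

lemma pairing_cong:
  assumes "C = C'" "\<And>e. e \<in> C \<Longrightarrow> \<epsilon> e = \<epsilon>' e"
    "\<And>t. t \<in> chord_ends C \<Longrightarrow> x t = x' t" "\<And>t. t \<in> chord_ends C \<Longrightarrow> y t = y' t"
  shows "pairing C \<epsilon> x y = pairing C' \<epsilon>' x' y'"
  unfolding pairing_def assms(1)[symmetric]
  by (rule sum.cong) (auto simp: assms chord_ends_fst chord_ends_snd)

lemma pairing_swap: "pairing C \<epsilon> x y = - pairing C \<epsilon> y x"
  unfolding pairing_def sum_negf[symmetric] by (rule sum.cong) (auto simp: algebra_simps)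

lemma pairing_self [simp]: "pairing C \<epsilon> x x = 0"
  using pairing_swap[of C \<epsilon> x x] by simp

lemma pairing_diff_left: "pairing C \<epsilon> (\<lambda>t. x t - x' t) y = pairing C \<epsilon> x y - pairing C \<epsilon> x' y"
  unfolding pairing_def sum_subtractf[symmetric] by (rule sum.cong) (auto simp: algebra_simps)

lemma pairing_diff_right: "pairing C \<epsilon> x (\<lambda>t. y t - y' t) = pairing C \<epsilon> x y - pairing C \<epsilon> x y'"
  unfolding pairing_def sum_subtractf[symmetric] by (rule sum.cong) (auto simp: algebra_simps)

lemma pairing_insert:
  "finite C \<Longrightarrow> e \<notin> C \<Longrightarrow> pairing (insert e C) \<epsilon> x y =
    \<epsilon> e * (x (fst e) * y (snd e) - x (snd e) * y (fst e)) + pairing C \<epsilon> x y"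
  by (simp add: pairing_def)

lemma pairing_Un:
  "finite C \<Longrightarrow> finite D \<Longrightarrow> C \<inter> D = {} \<Longrightarrow> pairing (C \<union> D) \<epsilon> x y = pairing C \<epsilon> x y + pairing D \<epsilon> x y"
  by (simp add: pairing_def sum.union_disjoint)

lemma pairing_image:
  assumes "inj_on (map_prod f f) C"
    and "\<And>e. e \<in> C \<Longrightarrow> \<epsilon>' (map_prod f f e) = \<epsilon> e"
    and "\<And>t. t \<in> chord_ends C \<Longrightarrow> x' (f t) = x t" "\<And>t. t \<in> chord_ends C \<Longrightarrow> y' (f t) = y t"
  shows "pairing (map_prod f f ` C) \<epsilon>' x' y' = pairing C \<epsilon> x y"
  unfolding pairing_def sum.reindex[OF assms(1)]
  by (rule sum.cong) (auto simp: assms chord_ends_fst chord_ends_snd)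

lemma inj_on_map_prod:
  assumes "inj_on f (chord_ends C)"
  shows "inj_on (map_prod f f) C"
proof (rule inj_onI)
  fix c d assume "c \<in> C" "d \<in> C" "map_prod f f c = map_prod f f d"
  then have "fst c = fst d" "snd c = snd d"
    using inj_onD[OF assms, of "fst c" "fst d"] inj_onD[OF assms, of "snd c" "snd d"]
    by (auto simp: chord_ends_fst chord_ends_snd map_prod_def split: prod.splits)
  then show "c = d" by (simp add: prod_eq_iff)
qed

text \<open>Arcs and pairings see only the linear order of the ends. Source and target of
  \<open>f\<close> may have different types: the lemma serves reparametrisations of time as well as
  the passage from times to visits on a surface.\<close>

lemma pairing_chord_arc_image:
  assumes f: "strict_mono_on A f" "chord_ends C \<subseteq> A" and "\<And>e. e \<in> C \<Longrightarrow> \<epsilon>' (map_prod f f e) = \<epsilon> e"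
    and cd: "c \<in> C" "d \<in> C"
  shows "pairing (map_prod f f ` C) \<epsilon>' (chord_arc (map_prod f f c)) (chord_arc (map_prod f f d)) =
           pairing C \<epsilon> (chord_arc c) (chord_arc d)" (is ?thesis1)
    and "pairing (map_prod f f ` C) \<epsilon>' (chord_arc (map_prod f f c)) core = pairing C \<epsilon> (chord_arc c) core" (is ?thesis2)
proof -
  have inj: "inj_on (map_prod f f) C"
    using f by (intro inj_on_map_prod) (meson inj_on_subset strict_mono_on_imp_inj_on)
  have chord_arc: "chord_arc (map_prod f f e) (f t) = chord_arc e t" if "e \<in> C" "t \<in> chord_ends C" for e t
    using f that by (intro chord_arc_image[of A]) (auto simp: chord_ends_fst chord_ends_snd subset_eq)
  show ?thesis1 ?thesis2
    by (rule pairing_image[OF inj]; simp add: assms chord_arc)+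
qed

lemma chord_arc_even:
  assumes "chord_diagram C" "c \<in> C" "e \<in> C" "e \<noteq> c"
  shows "even (chord_arc c (fst e))" "even (chord_arc c (snd e))"
proof -
  note chord_diagram_disjoint[OF assms(1,3,2,4)]
  then show "even (chord_arc c (fst e))" "even (chord_arc c (snd e))"
    by (cases c; simp add: chord_arc_off)+
qed

text \<open>The constant weight supplies one factor 2. The other is the parity of the difference of
  the weights of \<open>c\<close> at the two ends of \<open>e\<close>: both are 1 if
  \<open>e = c\<close>, both are even otherwise.\<close>

lemma four_dvd_pairing_core:
  assumes "chord_diagram C" "c \<in> C"
  shows "4 dvd pairing C \<epsilon> (chord_arc c) core"
  unfolding pairing_def
proof (rule dvd_sum)
  fix e assume e: "e \<in> C"
  have "even (chord_arc c (fst e) - chord_arc c (snd e))"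
  proof (cases "e = c")
    case True
    then show ?thesis using assms(2) assms(1)
      by (cases c) (auto simp: chord_diagram_def)
  next
    case False
    then show ?thesis using chord_arc_even[OF assms e] by simp
  qed
  then obtain m where "chord_arc c (fst e) - chord_arc c (snd e) = 2 * m" by blast
  then have "\<epsilon> e * (chord_arc c (fst e) * 2 - chord_arc c (snd e) * 2) = 4 * (\<epsilon> e * m)"
    by (simp add: left_diff_distrib[symmetric])
  then show "4 dvd \<epsilon> e * (chord_arc c (fst e) * 2 - chord_arc c (snd e) * 2)"
    by (rule dvdI)
qed

lemma pairing_core_eq_index:
  "chord_diagram C \<Longrightarrow> c \<in> C \<Longrightarrow> pairing C \<epsilon> (chord_arc c) core = 4 * index C \<epsilon> c"
  unfolding index_def using four_dvd_pairing_core[of C c \<epsilon>] by (simp only: dvd_mult_div_cancel)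

section \<open>Reidemeister moves on chord diagrams\<close>

type_synonym gauss = "(real \<times> real) set \<times> (real \<times> real \<Rightarrow> int)"

text \<open>
  The type of a chord (\<open>True\<close> for type 0) and the strings, as told apart by \<open>\<kappa>\<close>, of its over- and
  under-path.
\<close>

definition label :: "(real \<Rightarrow> bool) \<Rightarrow> real \<times> real \<Rightarrow> bool \<times> bool \<times> bool" where
  "label \<kappa> c = (fst c < snd c, \<kappa> (fst c), \<kappa> (snd c))"

text \<open>\<open>L\<close> selects chords by type alone for the knot polynomials and by type and
  strings for the tangle invariants. The ring is left general so that an integer linking number and
  its image among Laurent polynomials are both instances.\<close>

definition chord_sum ::
    "(real \<Rightarrow> bool) \<Rightarrow> (bool \<times> bool \<times> bool) set \<Rightarrow> (int \<Rightarrow> 'r::comm_ring_1) \<Rightarrow> gauss \<Rightarrow> 'r" where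
  "chord_sum \<kappa> L \<Psi> G = (\<Sum>c\<in>fst G.
     if label \<kappa> c \<in> L then of_int (snd G c) * \<Psi> (index (fst G) (snd G) c) else 0)"

text \<open>The third argument of \<open>\<Phi>\<close> is the pairing of the two arcs before
  division by 4. Division is left to \<open>\<Phi>\<close>, so that invariance concerns the pairings
  themselves.\<close>

definition chord_sum2 ::
    "(real \<Rightarrow> bool) \<Rightarrow> (bool \<times> bool \<times> bool) set \<Rightarrow> (bool \<times> bool \<times> bool) set \<Rightarrow>
     (int \<Rightarrow> int \<Rightarrow> int \<Rightarrow> 'r::comm_ring_1) \<Rightarrow> gauss \<Rightarrow> 'r" where
  "chord_sum2 \<kappa> L M \<Phi> G = (\<Sum>c\<in>fst G. \<Sum>d\<in>fst G.
     if label \<kappa> c \<in> L \<and> label \<kappa> d \<in> M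
     then of_int (snd G c * snd G d) * \<Phi> (index (fst G) (snd G) c) (index (fst G) (snd G) d)
            (pairing (fst G) (snd G) (chord_arc c) (chord_arc d))
     else 0)"

text \<open>The rules speak of pairings instead of the order of ends, which is what sums over chords
  depend on. \<open>reindex\<close> serves isotopies and third moves; \<open>kink\<close> and
  \<open>bigon\<close> are the first and second move, read from more to fewer crossings, the
  inverses coming from the equivalence closure. In \<open>bigon\<close> the last condition with
  \<open>c = l\<close> says that \<open>k\<close> and \<open>l\<close> pair trivially.\<close>

inductive gauss_step :: "(real \<Rightarrow> bool) \<Rightarrow> gauss \<Rightarrow> gauss \<Rightarrow> bool" for \<kappa> where
  reindex: "gauss_step \<kappa> (C, \<epsilon>) (C', \<epsilon>')"
    if "bij_betw \<pi> C C'"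
      "\<And>c. c \<in> C \<Longrightarrow> \<epsilon>' (\<pi> c) = \<epsilon> c" "\<And>c. c \<in> C \<Longrightarrow> label \<kappa> (\<pi> c) = label \<kappa> c"
      "\<And>c. c \<in> C \<Longrightarrow> pairing C' \<epsilon>' (chord_arc (\<pi> c)) core = pairing C \<epsilon> (chord_arc c) core"
      "\<And>c d. c \<in> C \<Longrightarrow> d \<in> C \<Longrightarrow>
         pairing C' \<epsilon>' (chord_arc (\<pi> c)) (chord_arc (\<pi> d)) = pairing C \<epsilon> (chord_arc c) (chord_arc d)"
| kink: "gauss_step \<kappa> (insert k C, \<epsilon>) (C, \<epsilon>')"
    if "finite C" "k \<notin> C" "\<And>c. c \<in> C \<Longrightarrow> \<epsilon>' c = \<epsilon> c" "\<kappa> (fst k) = \<kappa> (snd k)"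
      "\<And>c. c \<in> C \<Longrightarrow> pairing (insert k C) \<epsilon> (chord_arc c) core = pairing C \<epsilon>' (chord_arc c) core"
      "\<And>c d. c \<in> C \<Longrightarrow> d \<in> C \<Longrightarrow>
         pairing (insert k C) \<epsilon> (chord_arc c) (chord_arc d) = pairing C \<epsilon>' (chord_arc c) (chord_arc d)"
      "pairing (insert k C) \<epsilon> (chord_arc k) core = 0"
      "\<And>c. c \<in> C \<Longrightarrow> pairing (insert k C) \<epsilon> (chord_arc k) (chord_arc c) = 0"
| bigon: "gauss_step \<kappa> (insert k (insert l C), \<epsilon>) (C, \<epsilon>')"
    if "finite C" "k \<notin> C" "l \<notin> C" "k \<noteq> l" "\<And>c. c \<in> C \<Longrightarrow> \<epsilon>' c = \<epsilon> c"
      "label \<kappa> k = label \<kappa> l" "\<epsilon> l = - \<epsilon> k"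
      "\<And>c. c \<in> C \<Longrightarrow> pairing (insert k (insert l C)) \<epsilon> (chord_arc c) core = pairing C \<epsilon>' (chord_arc c) core"
      "\<And>c d. c \<in> C \<Longrightarrow> d \<in> C \<Longrightarrow>
         pairing (insert k (insert l C)) \<epsilon> (chord_arc c) (chord_arc d) = pairing C \<epsilon>' (chord_arc c) (chord_arc d)"
      "pairing (insert k (insert l C)) \<epsilon> (chord_arc k) core = pairing (insert k (insert l C)) \<epsilon> (chord_arc l) core"
      "\<And>c. c \<in> insert k (insert l C) \<Longrightarrow> pairing (insert k (insert l C)) \<epsilon> (chord_arc k) (chord_arc c)
         = pairing (insert k (insert l C)) \<epsilon> (chord_arc l) (chord_arc c)"

text \<open>The disjunction offers two ways to lose the kink: its term vanishes because its index is
  0, or its label is excluded because both its ends lie on one string. The second way is the one for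
  \<open>V\<close> and the linking numbers. The two terms of a bigon cancel.\<close>

lemma chord_sum_step:
  assumes "gauss_step \<kappa> G G'" "\<Psi> 0 = 0 \<or> (\<forall>x y. (x, y, y) \<notin> L)"
  shows "chord_sum \<kappa> L \<Psi> G = chord_sum \<kappa> L \<Psi> G'"
  using assms(1)
proof cases
  case (reindex \<pi> C C' \<epsilon>' \<epsilon>)
  show ?thesis unfolding chord_sum_def reindex(1,2) fst_conv snd_conv
    unfolding sum.reindex_bij_betw[OF reindex(3), symmetric]
    by (rule sum.cong) (simp_all add: reindex(4-) index_def)
next
  case (kink C k \<epsilon>' \<epsilon>)
  have "(if label \<kappa> k \<in> L then of_int (\<epsilon> k) * \<Psi> (index (insert k C) \<epsilon> k) else 0) = 0"
    using assms(2) kink by (auto simp: index_def label_def)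
  then show ?thesis unfolding chord_sum_def kink(1,2) fst_conv snd_conv
    by (simp add: kink(3,4)) (rule sum.cong, simp_all add: kink index_def)
next
  case (bigon C k l \<epsilon>' \<epsilon>)
  show ?thesis unfolding chord_sum_def bigon(1,2) fst_conv snd_conv
    using bigon(3-6)
    by (simp add: bigon(8,9,12) index_def) (intro sum.cong refl, simp add: bigon(7,10) index_def)
qed

text \<open>A kink has index 0 and pairs to 0 with every chord, so all terms containing it are of
  the two forms assumed to vanish.\<close>

lemma chord_sum2_step:
  assumes "gauss_step \<kappa> G G'" "\<And>n. \<Phi> 0 n 0 = 0" "\<And>n. \<Phi> n 0 0 = 0"
  shows "chord_sum2 \<kappa> L M \<Phi> G = chord_sum2 \<kappa> L M \<Phi> G'"
  using assms(1)
proof cases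
  case (reindex \<pi> C C' \<epsilon>' \<epsilon>)
  define h where "h c d = (if label \<kappa> c \<in> L \<and> label \<kappa> d \<in> M
     then of_int (\<epsilon>' c * \<epsilon>' d) * \<Phi> (index C' \<epsilon>' c) (index C' \<epsilon>' d)
            (pairing C' \<epsilon>' (chord_arc c) (chord_arc d)) else 0)" for c d
  have "chord_sum2 \<kappa> L M \<Phi> G' = (\<Sum>c\<in>C'. \<Sum>d\<in>C'. h c d)"
    unfolding chord_sum2_def reindex(2) fst_conv snd_conv h_def ..
  also have "\<dots> = (\<Sum>c\<in>C. \<Sum>d\<in>C. h (\<pi> c) (\<pi> d))"
    by (simp add: sum.reindex_bij_betw[OF reindex(3), symmetric])
  also have "\<dots> = chord_sum2 \<kappa> L M \<Phi> G"
    unfolding chord_sum2_def reindex(1,2) fst_conv snd_conv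
    by (intro sum.cong refl) (simp add: reindex(4-) index_def h_def)
  finally show ?thesis by simp
next
  case (kink C k \<epsilon>' \<epsilon>)
  let ?C = "insert k C"
  define h where "h c d = (if label \<kappa> c \<in> L \<and> label \<kappa> d \<in> M
     then of_int (\<epsilon> c * \<epsilon> d) * \<Phi> (index ?C \<epsilon> c) (index ?C \<epsilon> d)
            (pairing ?C \<epsilon> (chord_arc c) (chord_arc d)) else 0)" for c d
  have ik: "index ?C \<epsilon> k = 0" using kink by (simp add: index_def)
  have "pairing ?C \<epsilon> (chord_arc c) (chord_arc k) = 0" if "c \<in> C" for c
    using kink(10)[OF that] pairing_swap[of ?C \<epsilon> "chord_arc c" "chord_arc k"] by simp
  then have h: "h k k = 0" "\<And>c. c \<in> C \<Longrightarrow> h k c = 0 \<and> h c k = 0"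
    using ik by (simp_all add: h_def assms kink(10))
  have "chord_sum2 \<kappa> L M \<Phi> G = (\<Sum>c\<in>?C. \<Sum>d\<in>?C. h c d)"
    unfolding chord_sum2_def kink(1) fst_conv snd_conv h_def ..
  also have "\<dots> = (\<Sum>c\<in>C. \<Sum>d\<in>C. h c d)"
    using kink(3,4) h by (simp cong: sum.cong)
  also have "\<dots> = chord_sum2 \<kappa> L M \<Phi> G'"
    unfolding chord_sum2_def kink(1,2) fst_conv snd_conv
    by (intro sum.cong refl) (simp add: kink(5-8) index_def h_def)
  finally show ?thesis .
next
  case (bigon C k l \<epsilon>' \<epsilon>)
  let ?C = "insert k (insert l C)"
  define h where "h c d = (if label \<kappa> c \<in> L \<and> label \<kappa> d \<in> M
     then of_int (\<epsilon> c * \<epsilon> d) * \<Phi> (index ?C \<epsilon> c) (index ?C \<epsilon> d)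
            (pairing ?C \<epsilon> (chord_arc c) (chord_arc d)) else 0)" for c d
  have ikl: "index ?C \<epsilon> l = index ?C \<epsilon> k" using bigon(12) by (simp add: index_def)
  have pl: "pairing ?C \<epsilon> (chord_arc l) (chord_arc c) = pairing ?C \<epsilon> (chord_arc k) (chord_arc c)" if "c \<in> ?C" for c
    using bigon(13)[OF that] by simp
  have pr: "pairing ?C \<epsilon> (chord_arc c) (chord_arc l) = pairing ?C \<epsilon> (chord_arc c) (chord_arc k)" if "c \<in> ?C" for c
    using pl[OF that] pairing_swap[of ?C \<epsilon> "chord_arc c"] by metis
  have h: "h l c = - h k c \<and> h c l = - h c k" if "c \<in> ?C" for c
    unfolding h_def ikl bigon(8)[symmetric] bigon(9) pl[OF that] pr[OF that] by simp
  have "chord_sum2 \<kappa> L M \<Phi> G = (\<Sum>c\<in>?C. \<Sum>d\<in>?C. h c d)"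
    unfolding chord_sum2_def bigon(1) fst_conv snd_conv h_def ..
  \<comment> \<open>Replacing \<open>k\<close> by \<open>l\<close> in either argument changes the
    sign of \<open>h\<close>. Hence the columns of \<open>k\<close> and \<open>l\<close> cancel, and
    after interchanging the sums so do the rows.\<close>
  also have "\<dots> = (\<Sum>c\<in>?C. \<Sum>d\<in>C. h c d)"
    using bigon(3-6) h by (intro sum.cong[OF refl]) simp
  also have "\<dots> = (\<Sum>d\<in>C. \<Sum>c\<in>?C. h c d)" by (rule sum.swap)
  also have "\<dots> = (\<Sum>d\<in>C. \<Sum>c\<in>C. h c d)"
    using bigon(3-6) h by (intro sum.cong[OF refl]) simp
  also have "\<dots> = (\<Sum>c\<in>C. \<Sum>d\<in>C. h c d)" by (rule sum.swap)
  also have "\<dots> = chord_sum2 \<kappa> L M \<Phi> G'"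
    unfolding chord_sum2_def bigon(1,2) fst_conv snd_conv
    by (intro sum.cong refl) (simp add: bigon(7,10,11) index_def h_def)
  finally show ?thesis .
qed

abbreviation gauss_equiv :: "(real \<Rightarrow> bool) \<Rightarrow> gauss \<Rightarrow> gauss \<Rightarrow> bool" where
  "gauss_equiv \<kappa> \<equiv> equivclp (gauss_step \<kappa>)"

lemma chord_sum_equiv:
  assumes "gauss_equiv \<kappa> G G'" "\<Psi> 0 = 0 \<or> (\<forall>x y. (x, y, y) \<notin> L)"
  shows "chord_sum \<kappa> L \<Psi> G = chord_sum \<kappa> L \<Psi> G'"
  using assms(1) by (induction rule: equivclp_induct) (auto dest: chord_sum_step[where \<Psi> = \<Psi> and L = L, OF _ assms(2)])

lemma chord_sum2_equiv:
  assumes "gauss_equiv \<kappa> G G'" "\<And>n. \<Phi> 0 n 0 = 0" "\<And>n. \<Phi> n 0 0 = 0"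
  shows "chord_sum2 \<kappa> L M \<Phi> G = chord_sum2 \<kappa> L M \<Phi> G'"
  using assms(1) by (induction rule: equivclp_induct) (auto dest: chord_sum2_step[where \<Phi> = \<Phi> and L = L and M = M] simp: assms(2,3))

section \<open>Steps recognized from the positions of chord ends\<close>

lemma order_iso_step:
  assumes f: "strict_mono_on (chord_ends C) f"
    and "\<And>e. e \<in> C \<Longrightarrow> \<epsilon>' (map_prod f f e) = \<epsilon> e"
    and \<kappa>: "\<And>t. t \<in> chord_ends C \<Longrightarrow> \<kappa> (f t) = \<kappa> t"
  shows "gauss_step \<kappa> (C, \<epsilon>) (map_prod f f ` C, \<epsilon>')"
proof (rule reindex)
  show "bij_betw (map_prod f f) C (map_prod f f ` C)"
    using f by (simp add: bij_betw_def inj_on_map_prod strict_mono_on_imp_inj_on)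
  show "label \<kappa> (map_prod f f c) = label \<kappa> c" if "c \<in> C" for c
    using strict_mono_on_less[OF f] that
    by (simp add: label_def \<kappa> chord_ends_fst chord_ends_snd)
qed (use assms in \<open>auto intro: pairing_chord_arc_image[OF f order_refl]\<close>)

lemma chord_arc_eqI:
  assumes "u \<notin> {fst c, snd c}" "v \<notin> {fst c, snd c}" "fst c < u \<longleftrightarrow> fst c < v" "snd c < u \<longleftrightarrow> snd c < v"
  shows "chord_arc c u = chord_arc c v"
proof -
  have "u < snd c \<longleftrightarrow> v < snd c" using assms by (auto simp: not_less le_less)
  then show ?thesis using assms by (cases c) (auto simp: chord_arc_off)
qed

text \<open>By \<open>adj\<close> no other end separates the ends of \<open>k\<close>. So the arc of
  \<open>k\<close> has weight 0 at all other ends, every other arc has equal weights at both ends of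
  \<open>k\<close>, and every determinant involving \<open>k\<close> vanishes.\<close>

lemma kink_step:
  assumes cd: "chord_diagram (insert k C)" "k \<notin> C" and \<epsilon>: "\<And>c. c \<in> C \<Longrightarrow> \<epsilon>' c = \<epsilon> c"
    and \<kappa>: "\<kappa> (fst k) = \<kappa> (snd k)"
    and adj: "\<And>t. t \<in> chord_ends C \<Longrightarrow> t < fst k \<longleftrightarrow> t < snd k"
  shows "gauss_step \<kappa> (insert k C, \<epsilon>) (C, \<epsilon>')"
proof -
  note ins = chord_diagram_insert[OF cd]
  have fin: "finite C" using ins(1) by (rule chord_diagram_finite)
  note pairing_k = pairing_insert[OF fin cd(2)]
  have arc_k_ends: "chord_arc k (fst k) = 1" "chord_arc k (snd k) = 1"
    using ins(2) by (cases k; simp)+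
  have arc_k: "chord_arc k t = 0" if "t \<in> chord_ends C" for t
  proof -
    have "t \<noteq> fst k" "t \<noteq> snd k" using ins(3,4) that by auto
    then show ?thesis using adj[OF that] by (cases k) (auto simp: chord_arc_off)
  qed
  have arc_c: "chord_arc c (fst k) = chord_arc c (snd k)" if "c \<in> C" for c
    using ins(3,4) that chord_ends_fst[OF that] chord_ends_snd[OF that] by (intro chord_arc_eqI) (auto simp: adj)
  have pairing_C_k: "pairing C \<epsilon>' (chord_arc k) y = 0" for y
    by (subst pairing_cong[where x' = "\<lambda>_. 0" and y' = y and \<epsilon>' = \<epsilon>' and C' = C])
      (simp_all add: arc_k pairing_def)
  have pairing_C: "pairing C \<epsilon> x y = pairing C \<epsilon>' x y" for x y
    by (rule pairing_cong) (simp_all add: \<epsilon>)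
  show ?thesis
    by (rule kink) (use fin cd(2) \<epsilon> \<kappa> in \<open>auto simp: pairing_k arc_k_ends arc_c pairing_C_k pairing_C\<close>)
qed

text \<open>By \<open>adj\<close> any third arc has equal weights at corresponding ends of
  \<open>k\<close> and \<open>l\<close>, so their summands cancel by opposite signs.
  \<open>sep\<close> keeps both over-ends on one side of both under-ends; it forces equal types and
  determines how the two arcs overlap.\<close>

lemma bigon_step:
  assumes cd: "chord_diagram (insert k (insert l C))" "k \<notin> C" "l \<notin> C" "k \<noteq> l"
    and \<epsilon>: "\<And>c. c \<in> C \<Longrightarrow> \<epsilon>' c = \<epsilon> c" "\<epsilon> l = - \<epsilon> k"
    and \<kappa>: "\<kappa> (fst k) = \<kappa> (fst l)" "\<kappa> (snd k) = \<kappa> (snd l)"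
    and adj: "\<And>t. t \<in> chord_ends C \<Longrightarrow> t < fst k \<longleftrightarrow> t < fst l"
      "\<And>t. t \<in> chord_ends C \<Longrightarrow> t < snd k \<longleftrightarrow> t < snd l"
    and sep: "fst k < snd k \<and> fst k < snd l \<and> fst l < snd k \<and> fst l < snd l \<or>
      snd k < fst k \<and> snd k < fst l \<and> snd l < fst k \<and> snd l < fst l"
  shows "gauss_step \<kappa> (insert k (insert l C), \<epsilon>) (C, \<epsilon>')"
proof -
  let ?C = "insert k (insert l C)"
  have k: "k \<notin> insert l C" using cd by auto
  note ins = chord_diagram_insert[OF cd(1) k]
  note ins' = chord_diagram_insert[OF ins(1) cd(3)]
  have fin: "finite C" using ins'(1) by (rule chord_diagram_finite)
  note ends = ins(2,3,4)[unfolded chord_ends_insert] ins'(2-4)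
  have pairing_C: "pairing C \<epsilon> x y = pairing C \<epsilon>' x y" for x y
    by (rule pairing_cong) (simp_all add: \<epsilon>)
  have pairing_kl: "pairing ?C \<epsilon> x y =
      \<epsilon> k * (x (fst k) * y (snd k) - x (snd k) * y (fst k) - (x (fst l) * y (snd l) - x (snd l) * y (fst l)))
      + pairing C \<epsilon>' x y" for x y
    using fin cd(3) k by (simp add: pairing_insert \<epsilon>(2) pairing_C algebra_simps)
  have arc_c: "chord_arc c (fst k) = chord_arc c (fst l)" "chord_arc c (snd k) = chord_arc c (snd l)" if "c \<in> C" for c
    using ends that chord_ends_fst[OF that] chord_ends_snd[OF that] by (auto intro!: chord_arc_eqI simp: adj)
  have arc_kl: "chord_arc k t = chord_arc l t" if "t \<in> chord_ends C" for t
  proof -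
    have "t \<noteq> fst k" "t \<noteq> snd k" "t \<noteq> fst l" "t \<noteq> snd l" using ends that by auto
    then show ?thesis using adj[OF that]
      by (cases k; cases l) (auto simp: chord_arc_off not_less le_less)
  qed
  have pairing_kl_C: "pairing C \<epsilon>' (chord_arc k) y = pairing C \<epsilon>' (chord_arc l) y" for y
    by (rule pairing_cong) (simp_all add: arc_kl)
  have arc_ends: "chord_arc k (fst k) = 1" "chord_arc k (snd k) = 1" "chord_arc l (fst l) = 1" "chord_arc l (snd l) = 1"
    using ends by (cases k; cases l; simp)+
  \<comment> \<open>Of two corresponding ends, exactly one lies inside the arc of the other chord,
    where it has weight 2.\<close>
  have arc_l: "chord_arc l (fst k) = 2 - chord_arc k (fst l)" "chord_arc l (snd k) = 2 - chord_arc k (snd l)"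
    using ends sep by (cases k; cases l; auto simp: chord_arc_off)+
  show ?thesis
  proof (rule bigon)
    fix c assume "c \<in> ?C"
    then consider "c = k" | "c = l" | "c \<in> C" by blast
    then show "pairing ?C \<epsilon> (chord_arc k) (chord_arc c) = pairing ?C \<epsilon> (chord_arc l) (chord_arc c)"
      using pairing_kl_C[of "chord_arc k"]
      by cases (simp_all add: pairing_kl pairing_kl_C arc_ends arc_l arc_c algebra_simps)
  qed (use fin cd \<epsilon> \<kappa> sep in \<open>auto simp: pairing_kl pairing_kl_C arc_ends arc_l arc_c label_def algebra_simps\<close>)
qed

section \<open>Third moves: three chords bounding a triangle\<close>

definition order_sign :: "real \<Rightarrow> real \<Rightarrow> int" where
  "order_sign s t = (if s < t then 1 else - 1)"

text \<open>The three summands of the triangle, each crossing read along the cycle of strands 0, 1,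
  2. Here \<open>w k l\<close> is the sign with strand \<open>k\<close> written first; as a summand
  does not change when both the order and the sign are reversed, it does not matter which strand is
  on top.\<close>

definition triangle_pairing ::
    "(nat \<Rightarrow> nat \<Rightarrow> int) \<Rightarrow> (nat \<Rightarrow> nat \<Rightarrow> real) \<Rightarrow> (real \<Rightarrow> int) \<Rightarrow> (real \<Rightarrow> int) \<Rightarrow> int" where
  "triangle_pairing w T x y =
     w 0 1 * (x (T 0 1) * y (T 1 0) - x (T 1 0) * y (T 0 1)) +
     w 1 2 * (x (T 1 2) * y (T 2 1) - x (T 2 1) * y (T 1 2)) +
     w 2 0 * (x (T 2 0) * y (T 0 2) - x (T 0 2) * y (T 2 0))"

definition cyclic3 :: "(nat \<times> nat \<times> nat) set" where
  "cyclic3 = {(0, 1, 2), (1, 2, 0), (2, 0, 1)}"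

lemma cyclic3_cases:
  assumes "i < 3" "j < 3" "l < 3" "i \<noteq> j" "i \<noteq> l" "j \<noteq> l"
  shows "(i, j, l) \<in> cyclic3 \<or> (i, l, j) \<in> cyclic3"
proof -
  have "i = 0 \<or> i = 1 \<or> i = 2" "j = 0 \<or> j = 1 \<or> j = 2" "l = 0 \<or> l = 1 \<or> l = 2"
    using assms by arith+
  then show ?thesis using assms(4-6) by (elim disjE) (simp_all add: cyclic3_def)
qed

lemma cyclic3_cases2:
  assumes "i < 3" "j < 3" "i \<noteq> j"
  shows "(\<exists>m. (i, j, m) \<in> cyclic3) \<or> (\<exists>m. (j, i, m) \<in> cyclic3)"
proof -
  have "i = 0 \<or> i = 1 \<or> i = 2" "j = 0 \<or> j = 1 \<or> j = 2"
    using assms by arith+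
  then show ?thesis using assms(3) by (elim disjE) (simp_all add: cyclic3_def)
qed

text \<open>
  \<open>T k l\<close> and \<open>T' k l\<close> are the times at which strand \<open>k\<close> meets strand \<open>l\<close> before and after a third
  move; \<open>r\<close> orders the strands in time.  The condition on the signs \<open>w\<close> expresses that the three
  strands bound a triangle in the plane.
\<close>

locale triangle =
  fixes T T' :: "nat \<Rightarrow> nat \<Rightarrow> real" and w :: "nat \<Rightarrow> nat \<Rightarrow> int" and r :: "nat \<Rightarrow> real"
  assumes reversed: "(k, l, m) \<in> cyclic3 \<Longrightarrow> T k l \<noteq> T k m \<and> T' k l \<noteq> T' k m \<and>
      (T k l < T k m \<longleftrightarrow> T' k m < T' k l)"
    and ranks: "k < 3 \<Longrightarrow> l < 3 \<Longrightarrow> r k = r l \<longleftrightarrow> k = l"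
    and separated: "k < 3 \<Longrightarrow> l < 3 \<Longrightarrow> k \<noteq> l \<Longrightarrow> i < 3 \<Longrightarrow> j < 3 \<Longrightarrow> i \<noteq> k \<Longrightarrow> j \<noteq> l \<Longrightarrow>
      (T k i < T l j \<longleftrightarrow> r k < r l) \<and> (T' k i < T' l j \<longleftrightarrow> r k < r l)"
    and signs: "(k, l, m) \<in> cyclic3 \<Longrightarrow>
      w k l = order_sign (T k l) (T k m) * order_sign (T l k) (T l m)"
begin

lemma triangle_pairing_cyclic:
  assumes "(k, l, m) \<in> cyclic3"
  shows "triangle_pairing w T x y =
     w k l * (x (T k l) * y (T l k) - x (T l k) * y (T k l)) +
     w l m * (x (T l m) * y (T m l) - x (T m l) * y (T l m)) +
     w m k * (x (T m k) * y (T k m) - x (T k m) * y (T m k))"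
  using assms by (auto simp: cyclic3_def triangle_pairing_def)

lemma cyclic3_less: "(k, l, m) \<in> cyclic3 \<Longrightarrow> k < 3 \<and> l < 3 \<and> m < 3 \<and> k \<noteq> l \<and> l \<noteq> m \<and> m \<noteq> k"
  by (auto simp: cyclic3_def)

lemma cyclic3_rotate: "(k, l, m) \<in> cyclic3 \<Longrightarrow> (l, m, k) \<in> cyclic3"
  by (auto simp: cyclic3_def)

text \<open>Times on different strands compare as the ranks of the strands. The only further
  information is on which side of its crossing with the other strand of the chord the crossing with
  the third strand lies.\<close>

lemma arc_values:
  assumes klm: "(k, l, m) \<in> cyclic3"
  shows "chord_arc (T k l, T l k) (T k l) = 1" "chord_arc (T k l, T l k) (T l k) = 1"
    "chord_arc (T k l, T l k) (T k m) = (if (T k l < T k m) = (r k < r l) then 2 else 0)"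
    "chord_arc (T k l, T l k) (T l m) = (if (T l k < T l m) = (r k < r l) then 0 else 2)"
    "chord_arc (T k l, T l k) (T m k) = (if (r k < r m) = (r m < r l) then 2 else 0)"
    "chord_arc (T k l, T l k) (T m l) = (if (r k < r m) = (r m < r l) then 2 else 0)"
proof -
  note less = cyclic3_less[OF klm]
  have ne: "T i i' \<noteq> T j j'" if "i \<noteq> j" "i < 3" "j < 3" "i' < 3" "j' < 3" "i' \<noteq> i" "j' \<noteq> j" for i j i' j'
    using separated[of i j i' j'] separated[of j i j' i'] ranks[of i j] that
    by (metis not_less_iff_gr_or_eq)
  have sep: "T i i' < T j j' \<longleftrightarrow> r i < r j" if "i \<noteq> j" "i < 3" "j < 3" "i' < 3" "j' < 3" "i' \<noteq> i" "j' \<noteq> j" for i j i' j'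
    using separated[of i j i' j'] that by blast
  have rev: "T k l \<noteq> T k m" "T l k \<noteq> T l m"
    using reversed[OF klm] reversed[OF cyclic3_rotate[OF klm]] by auto
  show "chord_arc (T k l, T l k) (T k l) = 1" "chord_arc (T k l, T l k) (T l k) = 1"
    using ne[of k l l k] less by (simp_all add: less)
  show "chord_arc (T k l, T l k) (T k m) = (if (T k l < T k m) = (r k < r l) then 2 else 0)"
    using ne[of k l m k] less rev by (subst chord_arc_off) (auto simp: sep)
  show "chord_arc (T k l, T l k) (T l m) = (if (T l k < T l m) = (r k < r l) then 0 else 2)"
    using ne[of l k m l] less rev by (subst chord_arc_off) (auto simp: sep)
  show "chord_arc (T k l, T l k) (T m k) = (if (r k < r m) = (r m < r l) then 2 else 0)"
    using ne[of m k k l] ne[of m l k k] less by (subst chord_arc_off) (auto simp: sep)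
  show "chord_arc (T k l, T l k) (T m l) = (if (r k < r m) = (r m < r l) then 2 else 0)"
    using ne[of m k l l] ne[of m l l k] less by (subst chord_arc_off) (auto simp: sep)
qed

end

text \<open>Before and after are interchangeable: the order of the two crossings is reversed on
  every strand, so both factors in the condition on \<open>w\<close> change sign.\<close>

lemma triangle_flip:
  assumes "triangle T T' w r"
  shows "triangle T' T w r"
proof -
  interpret triangle T T' w r by fact
  show ?thesis
  proof
    fix k l m assume klm: "(k, l, m) \<in> cyclic3"
    note rot = cyclic3_rotate[OF klm]
    show "T' k l \<noteq> T' k m \<and> T k l \<noteq> T k m \<and> (T' k l < T' k m \<longleftrightarrow> T k m < T k l)"
      using reversed[OF klm] by auto
    show "w k l = order_sign (T' k l) (T' k m) * order_sign (T' l k) (T' l m)"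
      using signs[OF klm] reversed[OF klm] reversed[OF rot]
      by (auto simp: order_sign_def)
  qed (use ranks separated in auto)
qed

context triangle begin

text \<open>Among the weights of the chord between \<open>k\<close> and \<open>l\<close>, only those
  at \<open>T k m\<close> and \<open>T l m\<close> change, each between 0 and 2. Both changes are
  multiplied by the same value \<open>Y m\<close>, and the condition on \<open>w\<close> makes them
  cancel. The lemma covers the whole curve as well as arcs of chords outside the triangle.\<close>

lemma triangle_pairing_const:
  assumes klm: "(k, l, m) \<in> cyclic3"
    and y: "\<And>i j. i < 3 \<Longrightarrow> j < 3 \<Longrightarrow> i \<noteq> j \<Longrightarrow> y (T i j) = Y i"
      "\<And>i j. i < 3 \<Longrightarrow> j < 3 \<Longrightarrow> i \<noteq> j \<Longrightarrow> y' (T' i j) = Y i"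
  shows "triangle_pairing w T (chord_arc (T k l, T l k)) y = triangle_pairing w T' (chord_arc (T' k l, T' l k)) y'"
proof -
  interpret flip: triangle T' T w r by (rule triangle_flip) unfold_locales
  note rot = cyclic3_rotate[OF klm]
  note rot' = cyclic3_rotate[OF rot]
  have less: "k < 3" "l < 3" "m < 3" "k \<noteq> l" "l \<noteq> m" "m \<noteq> k" "l \<noteq> k" "m \<noteq> l" "k \<noteq> m"
    using cyclic3_less[OF klm] by auto
  have "T' k l < T' k m \<longleftrightarrow> \<not> T k l < T k m" "T' l k < T' l m \<longleftrightarrow> \<not> T l k < T l m"
    using reversed[OF klm] reversed[OF rot] by auto
  moreover have "order_sign (T k m) (T k l) = - order_sign (T k l) (T k m)"
    "order_sign (T l m) (T l k) = - order_sign (T l k) (T l m)"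
    "order_sign (T m l) (T m k) = - order_sign (T m k) (T m l)"
    using reversed[OF klm] reversed[OF rot] reversed[OF rot'] by (auto simp: order_sign_def)
  ultimately show ?thesis
    unfolding triangle_pairing_cyclic[OF klm] flip.triangle_pairing_cyclic[OF klm]
      signs[OF klm] signs[OF rot] signs[OF rot']
    by (simp add: arc_values[OF klm] flip.arc_values[OF klm] y less)
      (auto simp: order_sign_def)
qed

text \<open>Neither arc is constant along the strands here, so this is a finite check: six orders of
  the strands in time and, for each, eight orders of the crossings along the strands.\<close>

lemma triangle_pairing_arcs:
  assumes klm: "(k, l, m) \<in> cyclic3"
  shows "triangle_pairing w T (chord_arc (T k l, T l k)) (chord_arc (T m k, T k m)) =
    triangle_pairing w T' (chord_arc (T' k l, T' l k)) (chord_arc (T' m k, T' k m))"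
proof -
  interpret flip: triangle T' T w r by (rule triangle_flip) unfold_locales
  note rot = cyclic3_rotate[OF klm]
  note rot' = cyclic3_rotate[OF rot]
  have rev: "T' k l < T' k m \<longleftrightarrow> \<not> T k l < T k m" "T' l k < T' l m \<longleftrightarrow> \<not> T l k < T l m"
    "T' m k < T' m l \<longleftrightarrow> \<not> T m k < T m l"
    "T k m < T k l \<longleftrightarrow> \<not> T k l < T k m" "T l m < T l k \<longleftrightarrow> \<not> T l k < T l m"
    "T m l < T m k \<longleftrightarrow> \<not> T m k < T m l"
    "T' k m < T' k l \<longleftrightarrow> T k l < T k m" "T' l m < T' l k \<longleftrightarrow> T l k < T l m"
    "T' m l < T' m k \<longleftrightarrow> T m k < T m l"
    using reversed[OF klm] reversed[OF rot] reversed[OF rot'] by auto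
  have "r k \<noteq> r l" "r l \<noteq> r m" "r m \<noteq> r k" using cyclic3_less[OF klm] ranks by auto
  then consider "r k < r l" "r l < r m" "r k < r m" | "r k < r m" "r m < r l" "r k < r l"
    | "r l < r k" "r k < r m" "r l < r m" | "r l < r m" "r m < r k" "r l < r k"
    | "r m < r k" "r k < r l" "r m < r l" | "r m < r l" "r l < r k" "r m < r k"
    by linarith
  then show ?thesis
    unfolding triangle_pairing_cyclic[OF klm] flip.triangle_pairing_cyclic[OF klm]
      signs[OF klm] signs[OF rot] signs[OF rot'] order_sign_def
      arc_values[OF klm] flip.arc_values[OF klm] arc_values[OF rot'] flip.arc_values[OF rot'] rev
    by cases (cases "T k l < T k m"; cases "T l k < T l m"; cases "T m k < T m l"; simp)+
qed

end

lemma chord_diagram_subset: "chord_diagram C \<Longrightarrow> C' \<subseteq> C \<Longrightarrow> chord_diagram C'"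
  unfolding chord_diagram_def by (meson finite_subset subsetD)

text \<open>Every pairing splits into the triangle and \<open>C0\<close>. Arcs of chords in
  \<open>C0\<close> are constant along each strand, and arcs of triangle chords keep their weights
  at the ends of \<open>C0\<close>; the lemmas on the triangle deal with the rest.\<close>

lemma triangle_step:
  assumes tri: "triangle T T' w r"
    and cd: "chord_diagram C"
    and C: "C = insert (e 0) (insert (e 1) (insert (e 2) C0))" "e 0 \<notin> C0" "e 1 \<notin> C0" "e 2 \<notin> C0"
    and e: "\<And>k l m. (k, l, m) \<in> cyclic3 \<Longrightarrow> e k = (T k l, T l k) \<and> \<epsilon> (e k) = w k l \<or>
      e k = (T l k, T k l) \<and> \<epsilon> (e k) = - w k l"
    and \<pi>: "\<And>k l. k < 3 \<Longrightarrow> l < 3 \<Longrightarrow> k \<noteq> l \<Longrightarrow> \<pi> (T k l) = T' k l"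
      "\<And>t. t \<in> chord_ends C0 \<Longrightarrow> \<pi> t = t"
      "inj_on \<pi> (chord_ends C)"
    and \<epsilon>: "\<And>c. c \<in> C \<Longrightarrow> \<epsilon>' (map_prod \<pi> \<pi> c) = \<epsilon> c"
    and \<kappa>: "\<And>t. t \<in> chord_ends C \<Longrightarrow> \<kappa> (\<pi> t) = \<kappa> t"
    and adj: "\<And>t k i j. t \<in> chord_ends C0 \<Longrightarrow> k < 3 \<Longrightarrow> i < 3 \<Longrightarrow> j < 3 \<Longrightarrow> i \<noteq> k \<Longrightarrow> j \<noteq> k \<Longrightarrow>
      (t < T k i \<longleftrightarrow> t < T k j) \<and> (t < T k i \<longleftrightarrow> t < T' k j)"
  shows "gauss_step \<kappa> (C, \<epsilon>) (map_prod \<pi> \<pi> ` C, \<epsilon>')"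
proof -
  interpret triangle T T' w r by fact
  let ?C' = "map_prod \<pi> \<pi> ` C"
  have fin: "finite C0" using chord_diagram_finite[OF cd] C by simp
  have cyc: "(0, 1, 2) \<in> cyclic3" "(1, 2, 0) \<in> cyclic3" "(2, 0, 1) \<in> cyclic3"
    by (auto simp: cyclic3_def)
  have T_ne: "T i j \<noteq> T k l" if "(i, j) \<noteq> (k, l)" "i < 3" "j < 3" "k < 3" "l < 3" "i \<noteq> j" "k \<noteq> l" for i j k l
  proof (cases "i = k")
    case True
    then have "(i, j, l) \<in> cyclic3 \<or> (i, l, j) \<in> cyclic3" using that by (intro cyclic3_cases) auto
    then show ?thesis using reversed True by metis
  next
    case False
    then show ?thesis
      using separated[of i k j l] separated[of k i l j] ranks[of i k] that
      by (metis not_less_iff_gr_or_eq)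
  qed
  have e_ne: "e 0 \<noteq> e 1" "e 0 \<noteq> e 2" "e 1 \<noteq> e 2"
    using e[OF cyc(1)] e[OF cyc(2)] e[OF cyc(3)]
      T_ne[of 0 1 1 2] T_ne[of 0 1 2 1] T_ne[of 1 0 2 0] T_ne[of 0 1 0 2] T_ne[of 0 1 2 0] T_ne[of 1 2 2 0] T_ne[of 1 2 0 2]
    by (metis (no_types) fst_conv lessI numeral_2_eq_2 numeral_3_eq_3 one_less_numeral_iff prod.inject
        semiring_norm(77) zero_less_numeral zero_neq_numeral zero_neq_one One_nat_def less_Suc_eq n_not_Suc_n)+
  have pairing_C: "pairing C \<epsilon> x y = triangle_pairing w T x y + pairing C0 \<epsilon> x y" for x y
  proof -
    have "\<epsilon> (e k) * (x (fst (e k)) * y (snd (e k)) - x (snd (e k)) * y (fst (e k))) =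
       w k l * (x (T k l) * y (T l k) - x (T l k) * y (T k l))" if "(k, l, m) \<in> cyclic3" for k l m
      using e[OF that] by (auto simp: algebra_simps)
    from this[OF cyc(1)] this[OF cyc(2)] this[OF cyc(3)] show ?thesis
      using fin C(2-4) e_ne by (simp add: C(1) pairing_insert triangle_pairing_def)
  qed
  have inj: "inj_on (map_prod \<pi> \<pi>) C" using \<pi>(3) by (rule inj_on_map_prod)
  have pairing_C': "pairing ?C' \<epsilon>' x y = triangle_pairing w T' x y + pairing C0 \<epsilon> x y" for x y
  proof -
    have "pairing ?C' \<epsilon>' x y = pairing C \<epsilon> (\<lambda>t. x (\<pi> t)) (\<lambda>t. y (\<pi> t))"
      by (rule pairing_image[OF inj]) (auto simp: \<epsilon>)
    also have "\<dots> = triangle_pairing w T (\<lambda>t. x (\<pi> t)) (\<lambda>t. y (\<pi> t)) + pairing C0 \<epsilon> x y"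
      unfolding pairing_C by (simp, rule pairing_cong) (auto simp: \<pi>)
    finally show ?thesis by (simp add: triangle_pairing_def \<pi>)
  qed
  have e_arc: "chord_arc (e k) = chord_arc (T k l, T l k)"
    "chord_arc (map_prod \<pi> \<pi> (e k)) = chord_arc (T' k l, T' l k)" if "(k, l, m) \<in> cyclic3" for k l m
    using e[OF that] cyclic3_less[OF that] by (auto simp: chord_arc_commute \<pi>)
  have C0_e: "map_prod \<pi> \<pi> c = c" if "c \<in> C0" for c
    using that by (cases c) (auto simp: \<pi>(2) dest: chord_ends_fst chord_ends_snd)
  have C_cases: "c \<in> C0 \<or> (\<exists>(k, l, m) \<in> cyclic3. c = e k)" if "c \<in> C" for c
    using that by (auto simp: C(1) cyclic3_def)
  have T_C: "T i j \<in> chord_ends C \<and> T i j \<notin> chord_ends C0" if ij: "i < 3" "j < 3" "i \<noteq> j" for i j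
  proof -
    obtain k l m where klm: "(k, l, m) \<in> cyclic3" "T i j = T k l \<or> T i j = T l k"
      using cyclic3_cases2[OF ij] by blast
    have "e k \<in> C" "e k \<notin> C0" "insert (e k) C0 \<subseteq> C"
      using klm(1) C by (auto simp: cyclic3_def)
    moreover from this have "fst (e k) \<notin> chord_ends C0" "snd (e k) \<notin> chord_ends C0"
      using chord_diagram_insert[OF chord_diagram_subset[OF cd], of "e k" C0] by auto
    moreover have "T i j = fst (e k) \<or> T i j = snd (e k)"
      using e[OF klm(1)] klm(2) by auto
    ultimately show ?thesis using chord_ends_fst[of "e k" C] chord_ends_snd[of "e k" C] by metis
  qed
  have T'_C0: "T' i j \<notin> chord_ends C0" if ij: "i < 3" "j < 3" "i \<noteq> j" for i j
  proof
    assume t: "T' i j \<in> chord_ends C0"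
    \<comment> \<open>As an end of \<open>C0\<close> the time \<open>T' i j\<close> would be fixed
      by \<open>\<pi>\<close>, which also sends \<open>T i j\<close> there; injectivity would
      identify the two times.\<close>
    then have "\<pi> (T' i j) = \<pi> (T i j)" using \<pi>(1,2) ij by simp
    moreover have "T' i j \<in> chord_ends C" using t by (auto simp: C(1) chord_ends_insert)
    ultimately show False using inj_onD[OF \<pi>(3)] T_C[OF ij] t by metis
  qed
  have arc_C0: "\<exists>Y. \<forall>i<3. \<forall>j<3. i \<noteq> j \<longrightarrow> chord_arc c (T i j) = Y i \<and> chord_arc c (T' i j) = Y i"
    if c: "c \<in> C0" for c
  proof (intro exI allI impI)
    fix i j :: nat assume ij: "i < 3" "j < 3" "i \<noteq> j"
    \<comment> \<open>Any strand other than \<open>i\<close> can serve as reference. A choice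
      depending on \<open>i\<close> alone makes the common weight a function of the strand.\<close>
    define f where "f = (if i = 0 then 1 else 0 :: nat)"
    have f: "f < 3" "i \<noteq> f" by (auto simp: f_def)
    note ends = chord_ends_fst[OF c] chord_ends_snd[OF c]
    have "chord_arc c (T i j) = chord_arc c (T i f)"
      using ends T_C[OF ij] T_C[OF ij(1) f] adj[of _ i j f] ij f by (intro chord_arc_eqI) auto
    moreover have "chord_arc c (T' i j) = chord_arc c (T i f)"
      using ends T'_C0[OF ij] T_C[OF ij(1) f] adj[of _ i f j] ij f by (intro chord_arc_eqI) auto
    ultimately show "chord_arc c (T i j) = chord_arc c (T i (if i = 0 then 1 else 0)) \<and>
        chord_arc c (T' i j) = chord_arc c (T i (if i = 0 then 1 else 0))"
      by (simp add: f_def)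
  qed
  have arc_e: "chord_arc (T k l, T l k) t = chord_arc (T' k l, T' l k) t"
    if klm: "(k, l, m) \<in> cyclic3" and t: "t \<in> chord_ends C0" for k l m t
  proof -
    have kl: "k < 3" "l < 3" "k \<noteq> l" "l \<noteq> k" using cyclic3_less[OF klm] by auto
    then have "t \<noteq> T k l" "t \<noteq> T l k" "t \<noteq> T' k l" "t \<noteq> T' l k"
      using t T_C T'_C0 by blast+
    then show ?thesis using adj[OF t, of k l l] adj[OF t, of l k k] kl
      by (auto simp: chord_arc_off not_less le_less)
  qed
  \<comment> \<open>Weights \<open>y\<close> constant along each strand comprise the whole curve and
    all arcs from \<open>C0\<close>, so afterwards only pairs of triangle chords remain.\<close>
  have const: "pairing ?C' \<epsilon>' (chord_arc (map_prod \<pi> \<pi> c)) y = pairing C \<epsilon> (chord_arc c) y"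
    if "c \<in> C" and Y: "\<forall>i<3. \<forall>j<3. i \<noteq> j \<longrightarrow> y (T i j) = Y i \<and> y (T' i j) = Y i" for c y and Y :: "nat \<Rightarrow> int"
    using C_cases[OF that(1)]
  proof
    assume c: "c \<in> C0"
    from arc_C0[OF c] obtain X where
      X: "\<forall>i<3. \<forall>j<3. i \<noteq> j \<longrightarrow> chord_arc c (T i j) = X i \<and> chord_arc c (T' i j) = X i" by blast
    show ?thesis unfolding pairing_C pairing_C' C0_e[OF c] using X Y
      by (simp add: triangle_pairing_def)
  next
    assume "\<exists>(k, l, m)\<in>cyclic3. c = e k"
    then obtain k l m where klm: "(k, l, m) \<in> cyclic3" and c: "c = e k" by auto
    have "triangle_pairing w T (chord_arc (T k l, T l k)) y = triangle_pairing w T' (chord_arc (T' k l, T' l k)) y"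
      using Y by (intro triangle_pairing_const[OF klm, where Y = Y]) auto
    moreover have "pairing C0 \<epsilon> (chord_arc (T k l, T l k)) y = pairing C0 \<epsilon> (chord_arc (T' k l, T' l k)) y"
      by (rule pairing_cong) (auto simp: arc_e[OF klm])
    ultimately show ?thesis unfolding pairing_C pairing_C' c e_arc[OF klm] by simp
  qed
  define P where "P c d \<longleftrightarrow> pairing ?C' \<epsilon>' (chord_arc (map_prod \<pi> \<pi> c)) (chord_arc (map_prod \<pi> \<pi> d))
      = pairing C \<epsilon> (chord_arc c) (chord_arc d)" for c d
  have P_sym: "P c d \<longleftrightarrow> P d c" for c d
    unfolding P_def using pairing_swap[of ?C' \<epsilon>' "chord_arc (map_prod \<pi> \<pi> c)"] pairing_swap[of C \<epsilon> "chord_arc c"]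
    by simp
  have P_C0: "P c d" if "c \<in> C" "d \<in> C0" for c d
    using arc_C0[OF that(2)] const[OF that(1)] unfolding P_def C0_e[OF that(2)] by blast
  have P_e: "P (e k) (e m)" if klm: "(k, l, m) \<in> cyclic3" for k l m
  proof -
    have mkl: "(m, k, l) \<in> cyclic3" using klm by (auto simp: cyclic3_def)
    have "pairing C0 \<epsilon> (chord_arc (T k l, T l k)) (chord_arc (T m k, T k m)) =
        pairing C0 \<epsilon> (chord_arc (T' k l, T' l k)) (chord_arc (T' m k, T' k m))"
      by (rule pairing_cong) (auto simp: arc_e[OF klm] arc_e[OF mkl])
    then show ?thesis
      unfolding P_def pairing_C pairing_C' e_arc[OF klm] e_arc[OF mkl] triangle_pairing_arcs[OF klm] by simp
  qed
  have P: "P c d" if "c \<in> C" "d \<in> C" for c d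
  proof (cases "c \<in> C0 \<or> d \<in> C0 \<or> c = d")
    case True
    moreover have "P c c" by (simp add: P_def)
    ultimately show ?thesis using P_C0 P_sym that by blast
  next
    case False
    then have "\<exists>(k, l, m)\<in>cyclic3. c = e k \<and> d = e m \<or> d = e k \<and> c = e m"
      using that by (auto simp: C(1) cyclic3_def)
    then show ?thesis using P_e P_sym by blast
  qed
  show ?thesis
  proof (rule reindex)
    show "bij_betw (map_prod \<pi> \<pi>) C ?C'" using inj by (simp add: bij_betw_def)
    show "\<epsilon>' (map_prod \<pi> \<pi> c) = \<epsilon> c" if "c \<in> C" for c using \<epsilon>[OF that] .
    show "pairing ?C' \<epsilon>' (chord_arc (map_prod \<pi> \<pi> c)) core = pairing C \<epsilon> (chord_arc c) core" if "c \<in> C" for c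
      using const[OF that, of core core] by simp
    show "pairing ?C' \<epsilon>' (chord_arc (map_prod \<pi> \<pi> c)) (chord_arc (map_prod \<pi> \<pi> d)) =
        pairing C \<epsilon> (chord_arc c) (chord_arc d)" if "c \<in> C" "d \<in> C" for c d
      using P[OF that] by (simp add: P_def)
    show "label \<kappa> (map_prod \<pi> \<pi> c) = label \<kappa> c" if c: "c \<in> C" for c
    proof -
      have "fst (map_prod \<pi> \<pi> c) < snd (map_prod \<pi> \<pi> c) \<longleftrightarrow> fst c < snd c"
        using C_cases[OF c]
      proof
        assume "\<exists>(k, l, m)\<in>cyclic3. c = e k"
        then obtain k l m where klm: "(k, l, m) \<in> cyclic3" and c: "c = e k" by auto
        have kl: "k < 3" "l < 3" "k \<noteq> l" "l \<noteq> k" using cyclic3_less[OF klm] by auto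
        then show ?thesis using separated[of k l l k] separated[of l k k l] e[OF klm]
          by (auto simp: \<pi> c)
      qed (simp add: C0_e)
      then show ?thesis by (simp add: label_def \<kappa> chord_ends_fst[OF c] chord_ends_snd[OF c])
    qed
  qed
qed

lemma pairing_zero [simp]: "pairing C \<epsilon>' (\<lambda>_. 0) y = 0" "pairing C \<epsilon>' x (\<lambda>_. 0) = 0"
  by (simp_all add: pairing_def)

lemma pairing_const [simp]: "pairing C \<epsilon>' (\<lambda>_. m) (\<lambda>_. n) = 0"
  by (simp add: pairing_def)

section \<open>Inserting the chords of a knot between the two strings\<close>

definition typed :: "bool set \<Rightarrow> (bool \<times> bool \<times> bool) set" where
  "typed A = {l. fst l \<in> A}"

text \<open>The chord diagram of \<open>T + K\<close>: \<open>\<kappa>\<close> says which ends of \<open>E\<close> come after all of \<open>D\<close>.\<close>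

locale chord_insertion =
  fixes E D :: "(real \<times> real) set" and \<epsilon>E \<epsilon>D \<epsilon> :: "real \<times> real \<Rightarrow> int" and \<sigma> \<tau> :: "real \<Rightarrow> real" and \<kappa> :: "real \<Rightarrow> bool"
  assumes E: "chord_diagram E" and D: "chord_diagram D"
    and \<sigma>: "strict_mono_on (chord_ends E) \<sigma>" and \<tau>: "strict_mono_on (chord_ends D) \<tau>"
    and sides: "\<And>s t. s \<in> chord_ends E \<Longrightarrow> t \<in> chord_ends D \<Longrightarrow> (\<sigma> s < \<tau> t \<longleftrightarrow> \<not> \<kappa> s) \<and> (\<tau> t < \<sigma> s \<longleftrightarrow> \<kappa> s)"
    and signs: "\<And>c. c \<in> E \<Longrightarrow> \<epsilon> (map_prod \<sigma> \<sigma> c) = \<epsilon>E c" "\<And>d. d \<in> D \<Longrightarrow> \<epsilon> (map_prod \<tau> \<tau> d) = \<epsilon>D d"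
begin

definition "X = map_prod \<sigma> \<sigma> ` E \<union> map_prod \<tau> \<tau> ` D"

lemma finite_ED: "finite E" "finite D"
  using E D by (auto dest: chord_diagram_finite)

lemma disjoint: "map_prod \<sigma> \<sigma> ` E \<inter> map_prod \<tau> \<tau> ` D = {}"
proof -
  have "map_prod \<sigma> \<sigma> c \<noteq> map_prod \<tau> \<tau> d" if "c \<in> E" "d \<in> D" for c d
  proof
    assume "map_prod \<sigma> \<sigma> c = map_prod \<tau> \<tau> d"
    then have "\<sigma> (fst c) = \<tau> (fst d)" by (metis fst_map_prod)
    then show False using sides[OF chord_ends_fst[OF that(1)] chord_ends_fst[OF that(2)]] by auto
  qed
  then show ?thesis by (metis (no_types, lifting) disjoint_iff imageE)
qed

lemma inj_\<sigma>: "inj_on (map_prod \<sigma> \<sigma>) E" and inj_\<tau>: "inj_on (map_prod \<tau> \<tau>) D"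
  using \<sigma> \<tau> by (auto intro: inj_on_map_prod strict_mono_on_imp_inj_on)

definition separating :: "real \<times> real \<Rightarrow> bool" where
  "separating c \<longleftrightarrow> \<kappa> (fst c) \<noteq> \<kappa> (snd c)"

lemma pairing_X:
  "pairing X \<epsilon> x y = pairing E \<epsilon>E (\<lambda>t. x (\<sigma> t)) (\<lambda>t. y (\<sigma> t)) + pairing D \<epsilon>D (\<lambda>t. x (\<tau> t)) (\<lambda>t. y (\<tau> t))"
proof -
  have "pairing (map_prod \<sigma> \<sigma> ` E) \<epsilon> x y = pairing E \<epsilon>E (\<lambda>t. x (\<sigma> t)) (\<lambda>t. y (\<sigma> t))"
    by (rule pairing_image[OF inj_\<sigma>]) (simp_all add: signs)
  moreover have "pairing (map_prod \<tau> \<tau> ` D) \<epsilon> x y = pairing D \<epsilon>D (\<lambda>t. x (\<tau> t)) (\<lambda>t. y (\<tau> t))"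
    by (rule pairing_image[OF inj_\<tau>]) (simp_all add: signs)
  ultimately show ?thesis unfolding X_def using finite_ED disjoint by (simp add: pairing_Un)
qed

lemma arc_\<sigma>\<sigma>: "c \<in> E \<Longrightarrow> s \<in> chord_ends E \<Longrightarrow> chord_arc (map_prod \<sigma> \<sigma> c) (\<sigma> s) = chord_arc c s"
  and arc_\<tau>\<tau>: "d \<in> D \<Longrightarrow> t \<in> chord_ends D \<Longrightarrow> chord_arc (map_prod \<tau> \<tau> d) (\<tau> t) = chord_arc d t"
  by (auto intro!: chord_arc_image[OF \<sigma>] chord_arc_image[OF \<tau>] chord_ends_fst chord_ends_snd)

lemma arc_\<sigma>\<tau>:
  assumes c: "c \<in> E" and t: "t \<in> chord_ends D"
  shows "chord_arc (map_prod \<sigma> \<sigma> c) (\<tau> t) = (if separating c then 2 else 0)"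
proof -
  have "map_prod \<sigma> \<sigma> c = (\<sigma> (fst c), \<sigma> (snd c))" by (cases c) simp
  moreover have "\<tau> t \<noteq> \<sigma> (fst c)" "\<tau> t \<noteq> \<sigma> (snd c)"
    using sides[OF chord_ends_fst[OF c] t] sides[OF chord_ends_snd[OF c] t] by auto
  ultimately show ?thesis
    using sides[OF chord_ends_fst[OF c] t] sides[OF chord_ends_snd[OF c] t]
    by (auto simp: chord_arc_off separating_def)
qed

lemma arc_\<tau>\<sigma>:
  assumes d: "d \<in> D" and s: "s \<in> chord_ends E"
  shows "chord_arc (map_prod \<tau> \<tau> d) (\<sigma> s) = 0"
proof -
  have "map_prod \<tau> \<tau> d = (\<tau> (fst d), \<tau> (snd d))" by (cases d) simp
  moreover have "\<sigma> s \<noteq> \<tau> (fst d)" "\<sigma> s \<noteq> \<tau> (snd d)"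
    using sides[OF s chord_ends_fst[OF d]] sides[OF s chord_ends_snd[OF d]] by auto
  ultimately show ?thesis
    using sides[OF s chord_ends_fst[OF d]] sides[OF s chord_ends_snd[OF d]]
    by (auto simp: chord_arc_off)
qed

text \<open>On the times of \<open>D\<close> both weights are constant, and two constants pair to 0;
  only the part over \<open>E\<close> remains. The same reason gives
  \<open>pairing_EE\<close>.\<close>

lemma pairing_core_E:
  assumes c: "c \<in> E"
  shows "pairing X \<epsilon> (chord_arc (map_prod \<sigma> \<sigma> c)) core = pairing E \<epsilon>E (chord_arc c) core"
proof -
  have "pairing E \<epsilon>E (\<lambda>t. chord_arc (map_prod \<sigma> \<sigma> c) (\<sigma> t)) core = pairing E \<epsilon>E (chord_arc c) core"
    by (rule pairing_cong) (auto simp: arc_\<sigma>\<sigma> c)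
  moreover have "pairing D \<epsilon>D (\<lambda>t. chord_arc (map_prod \<sigma> \<sigma> c) (\<tau> t)) core =
      pairing D \<epsilon>D (\<lambda>_. if separating c then 2 else 0) core"
    by (rule pairing_cong) (auto simp: arc_\<sigma>\<tau> c)
  ultimately show ?thesis by (simp add: pairing_X)
qed

lemma pairing_core_D:
  assumes d: "d \<in> D"
  shows "pairing X \<epsilon> (chord_arc (map_prod \<tau> \<tau> d)) core = pairing D \<epsilon>D (chord_arc d) core"
proof -
  have "pairing E \<epsilon>E (\<lambda>t. chord_arc (map_prod \<tau> \<tau> d) (\<sigma> t)) core = pairing E \<epsilon>E (\<lambda>_. 0) core"
    by (rule pairing_cong) (auto simp: arc_\<tau>\<sigma> d)
  moreover have "pairing D \<epsilon>D (\<lambda>t. chord_arc (map_prod \<tau> \<tau> d) (\<tau> t)) core = pairing D \<epsilon>D (chord_arc d) core"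
    by (rule pairing_cong) (auto simp: arc_\<tau>\<tau> d)
  ultimately show ?thesis by (simp add: pairing_X)
qed

lemma pairing_EE:
  assumes c: "c \<in> E" "c' \<in> E"
  shows "pairing X \<epsilon> (chord_arc (map_prod \<sigma> \<sigma> c)) (chord_arc (map_prod \<sigma> \<sigma> c')) =
    pairing E \<epsilon>E (chord_arc c) (chord_arc c')"
proof -
  have "pairing E \<epsilon>E (\<lambda>t. chord_arc (map_prod \<sigma> \<sigma> c) (\<sigma> t)) (\<lambda>t. chord_arc (map_prod \<sigma> \<sigma> c') (\<sigma> t)) =
      pairing E \<epsilon>E (chord_arc c) (chord_arc c')"
    by (rule pairing_cong) (auto simp: arc_\<sigma>\<sigma> c)
  moreover have "pairing D \<epsilon>D (\<lambda>t. chord_arc (map_prod \<sigma> \<sigma> c) (\<tau> t)) (\<lambda>t. chord_arc (map_prod \<sigma> \<sigma> c') (\<tau> t)) =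
      pairing D \<epsilon>D (\<lambda>_. if separating c then 2 else 0) (\<lambda>_. if separating c' then 2 else 0)"
    by (rule pairing_cong) (auto simp: arc_\<sigma>\<tau> c)
  ultimately show ?thesis by (simp add: pairing_X)
qed

lemma pairing_DD:
  assumes d: "d \<in> D" "d' \<in> D"
  shows "pairing X \<epsilon> (chord_arc (map_prod \<tau> \<tau> d)) (chord_arc (map_prod \<tau> \<tau> d')) =
    pairing D \<epsilon>D (chord_arc d) (chord_arc d')"
proof -
  have "pairing D \<epsilon>D (\<lambda>t. chord_arc (map_prod \<tau> \<tau> d) (\<tau> t)) (\<lambda>t. chord_arc (map_prod \<tau> \<tau> d') (\<tau> t)) =
      pairing D \<epsilon>D (chord_arc d) (chord_arc d')"
    by (rule pairing_cong) (auto simp: arc_\<tau>\<tau> d)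
  moreover have "pairing E \<epsilon>E (\<lambda>t. chord_arc (map_prod \<tau> \<tau> d) (\<sigma> t)) (\<lambda>t. chord_arc (map_prod \<tau> \<tau> d') (\<sigma> t)) =
      pairing E \<epsilon>E (\<lambda>_. 0) (\<lambda>_. 0)"
    by (rule pairing_cong) (auto simp: arc_\<tau>\<sigma> d)
  ultimately show ?thesis by (simp add: pairing_X)
qed

lemma pairing_DE:
  assumes d: "d \<in> D" and c: "c \<in> E"
  shows "pairing X \<epsilon> (chord_arc (map_prod \<tau> \<tau> d)) (chord_arc (map_prod \<sigma> \<sigma> c)) =
    (if separating c then 4 * index D \<epsilon>D d else 0)"
proof -
  have "pairing D \<epsilon>D (\<lambda>t. chord_arc (map_prod \<tau> \<tau> d) (\<tau> t)) (\<lambda>t. chord_arc (map_prod \<sigma> \<sigma> c) (\<tau> t)) =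
      pairing D \<epsilon>D (chord_arc d) (\<lambda>_. if separating c then 2 else 0)"
    by (rule pairing_cong) (auto simp: arc_\<tau>\<tau> arc_\<sigma>\<tau> c d)
  moreover have "pairing E \<epsilon>E (\<lambda>t. chord_arc (map_prod \<tau> \<tau> d) (\<sigma> t)) (\<lambda>t. chord_arc (map_prod \<sigma> \<sigma> c) (\<sigma> t)) =
      pairing E \<epsilon>E (\<lambda>_. 0) (\<lambda>t. chord_arc (map_prod \<sigma> \<sigma> c) (\<sigma> t))"
    by (rule pairing_cong) (auto simp: arc_\<tau>\<sigma> d)
  ultimately show ?thesis using pairing_core_eq_index[OF D d] by (simp add: pairing_X)
qed

lemma pairing_ED:
  assumes c: "c \<in> E" and d: "d \<in> D"
  shows "pairing X \<epsilon> (chord_arc (map_prod \<sigma> \<sigma> c)) (chord_arc (map_prod \<tau> \<tau> d)) =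
    (if separating c then - (4 * index D \<epsilon>D d) else 0)"
  using pairing_DE[OF d c] pairing_swap[of X \<epsilon> "chord_arc (map_prod \<sigma> \<sigma> c)"] by simp

lemma index_X:
  "c \<in> E \<Longrightarrow> index X \<epsilon> (map_prod \<sigma> \<sigma> c) = index E \<epsilon>E c"
  "d \<in> D \<Longrightarrow> index X \<epsilon> (map_prod \<tau> \<tau> d) = index D \<epsilon>D d"
  by (simp_all add: index_def pairing_core_E pairing_core_D)

lemma sum_X: "(\<Sum>c\<in>X. f c) = (\<Sum>c\<in>E. f (map_prod \<sigma> \<sigma> c)) + (\<Sum>d\<in>D. f (map_prod \<tau> \<tau> d))"
  unfolding X_def using finite_ED disjoint
  by (simp add: sum.union_disjoint sum.reindex inj_\<sigma> inj_\<tau>)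

text \<open>Type labels ignore the strings, hence the two maps that tell strings apart may be chosen
  independently.\<close>

lemma label_typed:
  "c \<in> E \<Longrightarrow> label \<kappa>' (map_prod \<sigma> \<sigma> c) \<in> typed A \<longleftrightarrow> label \<kappa>'' c \<in> typed A"
  "d \<in> D \<Longrightarrow> label \<kappa>' (map_prod \<tau> \<tau> d) \<in> typed A \<longleftrightarrow> label \<kappa>'' d \<in> typed A"
  using strict_mono_on_less[OF \<sigma>] strict_mono_on_less[OF \<tau>]
  by (simp_all add: typed_def label_def chord_ends_fst chord_ends_snd)

end

section \<open>Intersection numbers on a surface\<close>

text \<open>
  \<open>ab\<close>, etc. say which of two darts comes first; the values at the fourth dart \<open>d\<close> are determined by
  conservation.
\<close>

lemma turning_identity:
  fixes xa xb xc ya yb yc :: int and ab ac ad bc bd cd :: bool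
  assumes trans: "(if ab then bc \<or> \<not> ac else bc \<and> \<not> ac) \<noteq> (if ad then \<not> cd \<or> \<not> ac else \<not> cd \<and> \<not> ac)"
    and "ab \<Longrightarrow> bc \<Longrightarrow> ac" "\<not> ab \<Longrightarrow> \<not> bc \<Longrightarrow> \<not> ac" "ab \<Longrightarrow> bd \<Longrightarrow> ad" "\<not> ab \<Longrightarrow> \<not> bd \<Longrightarrow> \<not> ad"
    "ac \<Longrightarrow> cd \<Longrightarrow> ad" "\<not> ac \<Longrightarrow> \<not> cd \<Longrightarrow> \<not> ad" "bc \<Longrightarrow> cd \<Longrightarrow> bd" "\<not> bc \<Longrightarrow> \<not> cd \<Longrightarrow> \<not> bd"
  shows "2 * ((if ab then 1 else - 1) * (xa * yb - xb * ya) + (if ac then 1 else - 1) * (xa * yc - xc * ya)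
      + (if ad then 1 else - 1) * (xa * (- ya - yb - yc) - (- xa - xb - xc) * ya)
      + (if bc then 1 else - 1) * (xb * yc - xc * yb)
      + (if bd then 1 else - 1) * (xb * (- ya - yb - yc) - (- xa - xb - xc) * yb)
      + (if cd then 1 else - 1) * (xc * (- ya - yb - yc) - (- xa - xb - xc) * yc)) =
    (if if ab then bc \<or> \<not> ac else bc \<and> \<not> ac then 1 else - 1) *
      ((xa - xc) * (yb - (- ya - yb - yc)) - (xb - (- xa - xb - xc)) * (ya - yc))"
  using assms
  by (cases ab; cases ac; cases ad; cases bc; cases bd; cases cd; simp) (simp_all add: algebra_simps)

text \<open>The darts \<open>v\<close> of one vertex, cut open at the dart \<open>m\<close> and
  enumerated counterclockwise by \<open>f\<close>. Positions in this enumeration turn cyclic order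
  into comparison of numbers.\<close>

locale rotation =
  fixes f :: "nat \<Rightarrow> nat" and m N :: nat and v :: "nat set"
  assumes bij: "bij_betw (\<lambda>i. (f ^^ i) m) {..<N} v" and period: "(f ^^ N) m = m" and N: "0 < N"
begin

definition pos :: "nat \<Rightarrow> nat" where "pos p = the_inv_into {..<N} (\<lambda>i. (f ^^ i) m) p"

lemma pos: "p \<in> v \<Longrightarrow> (f ^^ pos p) m = p" "p \<in> v \<Longrightarrow> pos p < N"
  using bij f_the_inv_into_f_bij_betw[OF bij] the_inv_into_into[of "\<lambda>i. (f ^^ i) m" "{..<N}" p "{..<N}"]
  by (auto simp: pos_def bij_betw_def)

lemma pos_inj: "p \<in> v \<Longrightarrow> q \<in> v \<Longrightarrow> pos p = pos q \<longleftrightarrow> p = q"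
  using pos(1) by metis

lemma funpow_eq_pos:
  assumes "q \<in> v"
  shows "(f ^^ k) m = q \<longleftrightarrow> k mod N = pos q"
proof -
  have "((f ^^ N) ^^ i) m = m" for i by (induction i) (simp_all add: period)
  then have "(f ^^ (N * i)) m = m" for i using funpow_mult[where f = f] by metis
  then have "(f ^^ (k mod N + N * (k div N))) m = (f ^^ (k mod N)) m"
    by (simp only: funpow_add o_apply)
  then have "(f ^^ k) m = (f ^^ (k mod N)) m" by simp
  moreover have "(f ^^ (k mod N)) m = q \<longleftrightarrow> k mod N = pos q"
    using pos[OF assms] N bij inj_onD[of "\<lambda>i. (f ^^ i) m" "{..<N}" "k mod N" "pos q"]
    by (auto simp: bij_betw_def)
  ultimately show ?thesis by simp
qed

lemma funpow_dist_pos: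
  assumes "p \<in> v" "q \<in> v"
  shows "funpow_dist f p q = (if pos p \<le> pos q then pos q - pos p else pos q + N - pos p)" (is "_ = ?d")
  unfolding funpow_dist_def
proof (rule Least_equality)
  have iter: "(f ^^ k) p = (f ^^ (k + pos p)) m" for k
    using pos(1)[OF assms(1)] by (simp add: funpow_add)
  have less: "pos p < N" "pos q < N" using pos(2) assms by auto
  have "(?d + pos p) mod N = pos q" using less by auto
  then show "(f ^^ ?d) p = q" unfolding iter funpow_eq_pos[OF assms(2)] .
  show "?d \<le> k" if "(f ^^ k) p = q" for k
  proof (rule ccontr)
    assume "\<not> ?d \<le> k"
    moreover from that have "(k + pos p) mod N = pos q" unfolding iter funpow_eq_pos[OF assms(2)] .
    ultimately show False using less by (auto simp: mod_if split: if_splits)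
  qed
qed

definition turning :: "(nat \<Rightarrow> int) \<Rightarrow> (nat \<Rightarrow> int) \<Rightarrow> int" where
  "turning x y = (\<Sum>j<N. \<Sum>i<j. (let p = (f ^^ i) m; q = (f ^^ j) m in x p * y q - x q * y p))"

text \<open>A summand vanishes as soon as one of its two darts carries neither chain, so the order
  on \<open>Z\<close> induced by the cut is all that matters.\<close>

lemma turning_support:
  assumes "finite Z" "Z \<subseteq> v" "\<And>p. p \<in> v - Z \<Longrightarrow> x p = 0 \<and> y p = 0"
  shows "turning x y = (\<Sum>q\<in>Z. \<Sum>p\<in>Z. if pos p < pos q then x p * y q - x q * y p else 0)"
proof -
  let ?g = "\<lambda>i. (f ^^ i) m"
  let ?h = "\<lambda>p q. x p * y q - x q * y p"
  have fin: "finite v" using bij bij_betw_finite by blast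
  have pos_g: "pos (?g i) = i" if "i < N" for i
    using funpow_eq_pos[of "?g i" i] that bij by (auto simp: bij_betw_def)
  have "turning x y = (\<Sum>j<N. \<Sum>i<N. if i < j then ?h (?g i) (?g j) else 0)"
    unfolding turning_def Let_def
  proof (rule sum.cong[OF refl])
    fix j assume "j \<in> {..<N}"
    then have "{..<N} \<inter> {i. i < j} = {..<j}" by auto
    then show "(\<Sum>i<j. ?h (?g i) (?g j)) = (\<Sum>i<N. if i < j then ?h (?g i) (?g j) else 0)"
      by (simp add: sum.If_cases)
  qed
  also have "\<dots> = (\<Sum>j<N. \<Sum>i<N. if pos (?g i) < pos (?g j) then ?h (?g i) (?g j) else 0)"
    by (intro sum.cong refl) (simp add: pos_g)
  also have "\<dots> = (\<Sum>q\<in>v. \<Sum>p\<in>v. if pos p < pos q then ?h p q else 0)"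
    by (simp add: sum.reindex_bij_betw[OF bij, symmetric])
  also have "\<dots> = (\<Sum>q\<in>Z. \<Sum>p\<in>v. if pos p < pos q then ?h p q else 0)"
    by (rule sum.mono_neutral_right[OF fin assms(2)]) (use assms(3) in \<open>simp add: sum.neutral\<close>)
  also have "\<dots> = (\<Sum>q\<in>Z. \<Sum>p\<in>Z. if pos p < pos q then ?h p q else 0)"
    by (intro sum.cong[OF refl] sum.mono_neutral_right[OF fin assms(2)]) (simp add: assms(3))
  finally show ?thesis .
qed

text \<open>Conservation makes the pairs of values at the two darts opposite, hence proportional,
  and their determinant is 0.\<close>

lemma turning_pass:
  assumes "a \<in> v" "c \<in> v" "a \<noteq> c" "x a + x c = 0" "y a + y c = 0"
    and "\<And>p. p \<in> v - {a, c} \<Longrightarrow> x p = 0 \<and> y p = 0"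
  shows "turning x y = 0"
proof -
  have xc: "x c = - x a" "y c = - y a" using assms(4,5) by auto
  have "turning x y = (\<Sum>q\<in>{a, c}. \<Sum>p\<in>{a, c}. if pos p < pos q then x p * y q - x q * y p else 0)"
    using assms by (intro turning_support) auto
  then show ?thesis using assms(3) by (simp add: xc)
qed

text \<open>In use \<open>a\<close> and \<open>b\<close> are the outgoing and \<open>c\<close> and
  \<open>d\<close> the incoming darts of the two visits. Chains are negative on incoming darts, so
  \<open>x a - x c\<close> adds the edges leaving and entering the first visit: it is the weight
  there.\<close>

lemma turning_crossing:
  assumes Z: "{a, b, c, d} \<subseteq> v" "distinct [a, b, c, d]"
    and x: "x a + x b + x c + x d = 0" and y: "y a + y b + y c + y d = 0"
    and supp: "\<And>p. p \<in> v - {a, b, c, d} \<Longrightarrow> x p = 0 \<and> y p = 0"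
    and trans: "(funpow_dist f a b < funpow_dist f a c) \<noteq> (funpow_dist f a d < funpow_dist f a c)"
  shows "2 * turning x y = (if funpow_dist f a b < funpow_dist f a c then 1 else - 1) *
    ((x a - x c) * (y b - y d) - (x b - x d) * (y a - y c))"
proof -
  have xd: "x d = - x a - x b - x c" "y d = - y a - y b - y c" using x y by auto
  have v: "a \<in> v" "b \<in> v" "c \<in> v" "d \<in> v" using Z by auto
  have ne: "pos a \<noteq> pos b" "pos a \<noteq> pos c" "pos a \<noteq> pos d" "pos b \<noteq> pos c" "pos b \<noteq> pos d" "pos c \<noteq> pos d"
    using v Z(2) by (auto simp: pos_inj)
  define s where "s p q = (if pos p < pos q then 1 else - 1 :: int)" for p q
  define h where "h p q = x p * y q - x q * y p" for p q
  have pair: "(if pos p < pos q then h p q else 0) + (if pos q < pos p then h q p else 0) = s p q * h p q"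
    if "pos p \<noteq> pos q" for p q
    using that by (auto simp: s_def h_def)
  have "turning x y = (\<Sum>q\<in>{a, b, c, d}. \<Sum>p\<in>{a, b, c, d}. if pos p < pos q then h p q else 0)"
    unfolding h_def using Z supp by (intro turning_support) auto
  also have "\<dots> = s a b * h a b + s a c * h a c + s a d * h a d + s b c * h b c + s b d * h b d + s c d * h c d"
    using Z(2) unfolding pair[OF ne(1), symmetric] pair[OF ne(2), symmetric] pair[OF ne(3), symmetric]
      pair[OF ne(4), symmetric] pair[OF ne(5), symmetric] pair[OF ne(6), symmetric] by simp
  finally have turning: "turning x y =
    s a b * h a b + s a c * h a c + s a d * h a d + s b c * h b c + s b d * h b d + s c d * h c d" .
  have less: "pos a < N" "pos b < N" "pos c < N" "pos d < N" using v pos(2) by auto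
  have dist: "funpow_dist f a q = (if pos a \<le> pos q then pos q - pos a else pos q + N - pos a)" if "q \<in> v" for q
    using that v by (simp add: funpow_dist_pos)
  \<comment> \<open>Rotating from \<open>a\<close>, darts behind \<open>a\<close> in the enumeration
    are met before those that precede it, for which the rotation wraps around the cut.\<close>
  have lt: "funpow_dist f a p < funpow_dist f a q \<longleftrightarrow>
      (if pos a < pos p then pos p < pos q \<or> pos q < pos a else pos p < pos q \<and> pos q < pos a)"
    if "p \<in> v" "q \<in> v" "pos p \<noteq> pos a" "pos q \<noteq> pos a" for p q
    using that less pos(2)[of p] pos(2)[of q] by (auto simp: dist)
  note lts = lt[OF v(2,3) ne(1,2)[symmetric]] lt[OF v(4,3) ne(3,2)[symmetric]]
  have tr: "pos p < pos q \<Longrightarrow> pos q < pos r \<Longrightarrow> pos p < pos r" "pos p \<noteq> pos r \<Longrightarrow> \<not> pos p < pos q \<Longrightarrow> \<not> pos q < pos r \<Longrightarrow> \<not> pos p < pos r" for p q r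
    by auto
  have tot: "pos q < pos p \<longleftrightarrow> \<not> pos p < pos q" if "pos p \<noteq> pos q" for p q using that by auto
  note tots = tot[OF ne(1)] tot[OF ne(2)] tot[OF ne(3)] tot[OF ne(4)] tot[OF ne(5)] tot[OF ne(6)]
  show ?thesis
    using trans unfolding turning lts h_def s_def xd tots
    by (rule turning_identity) (use tr ne in blast)+
qed

end

section \<open>Cycles on the curve and their weights at visits\<close>

definition pred_visit :: "surface_diagram \<Rightarrow> nat \<Rightarrow> nat" where
  "pred_visit S j = (j + length (walk S) - 1) mod length (walk S)"

text \<open>Counts the edges of \<open>P\<close> that leave or enter visit \<open>j\<close>; for the
  arc of a chord it specializes to \<open>chord_arc\<close>.\<close>

definition visit_weight :: "surface_diagram \<Rightarrow> nat set \<Rightarrow> nat \<Rightarrow> int" where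
  "visit_weight S P j = of_bool (j \<in> P) + of_bool (pred_visit S j \<in> P)"

text \<open>The cycle condition: at each vertex as many edges of \<open>P\<close> leave as enter,
  counted over one visit at a simple point and over both visits at a double point.\<close>

definition closed_path :: "surface_diagram \<Rightarrow> nat set \<Rightarrow> bool" where
  "closed_path S P \<longleftrightarrow> P \<subseteq> {..<length (walk S)} \<and>
     (\<forall>j<length (walk S). (\<forall>k. (j, k) \<notin> s_double_points S) \<longrightarrow> (j \<in> P \<longleftrightarrow> pred_visit S j \<in> P)) \<and>
     (\<forall>(j, k)\<in>s_double_points S. of_bool (j \<in> P) + of_bool (k \<in> P) =
        of_bool (pred_visit S j \<in> P) + (of_bool (pred_visit S k \<in> P) :: int))"

locale closed_curve =
  fixes S assumes S: "closed_curve_diagram S"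
begin

abbreviation "n \<equiv> length (walk S)"

lemma surface:
  "finite (darts S)" "opp S permutes darts S" "rot S permutes darts S"
  "d \<in> darts S \<Longrightarrow> opp S (opp S d) = d"
  using S by (auto simp: closed_curve_diagram_def closed_surface_def)

lemma n_pos: "0 < n"
  using S by (auto simp: closed_curve_diagram_def)

lemma pred_less: "pred_visit S j < n"
  using n_pos by (simp add: pred_visit_def)

lemma in_dart_pred: "in_dart S j = opp S (out_dart S (pred_visit S j))"
  by (simp add: in_dart_def out_dart_def pred_visit_def)

lemma pred_visit_eq: "j < n \<Longrightarrow> pred_visit S j = (if j = 0 then n - 1 else j - 1)"
proof (cases j)
  case (Suc i)
  assume "j < n"
  then have "(j + n - 1) mod n = (i + n) mod n" using Suc by simp
  also have "\<dots> = i" using Suc \<open>j < n\<close> by simp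
  finally show ?thesis using Suc by (simp add: pred_visit_def)
qed (simp add: pred_visit_def)

lemma pred_surj:
  assumes "k < n" shows "\<exists>j<n. pred_visit S j = k"
proof (intro exI conjI)
  show "(k + 1) mod n < n" using n_pos by simp
  show "pred_visit S ((k + 1) mod n) = k"
    using assms n_pos by (cases "k + 1 < n") (auto simp: pred_visit_eq not_less le_Suc_eq)
qed

lemma pred_inj:
  assumes "j < n" "k < n" "pred_visit S j = pred_visit S k" shows "j = k"
  using assms by (simp add: pred_visit_eq split: if_splits)

lemma out_in_darts: "j < n \<Longrightarrow> out_dart S j \<in> darts S" "in_dart S j \<in> darts S"
proof -
  have w: "j < n \<Longrightarrow> out_dart S j \<in> darts S" for j
    using S by (auto simp: closed_curve_diagram_def out_dart_def subset_eq)
  then show "j < n \<Longrightarrow> out_dart S j \<in> darts S" .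
  show "in_dart S j \<in> darts S"
    unfolding in_dart_pred using w[OF pred_less] permutes_in_image[OF surface(2)] by blast
qed

lemma out_inj: "j < n \<Longrightarrow> k < n \<Longrightarrow> out_dart S j = out_dart S k \<longleftrightarrow> j = k"
  using S by (auto simp: closed_curve_diagram_def out_dart_def nth_eq_iff_index_eq)

lemma opp_out: "j < n \<Longrightarrow> k < n \<Longrightarrow> opp S (out_dart S j) \<noteq> out_dart S k"
proof -
  assume jk: "j < n" "k < n"
  have "set (walk S) \<inter> opp S ` set (walk S) = {}"
    using S by (auto simp: closed_curve_diagram_def)
  moreover have "out_dart S j \<in> set (walk S)" "out_dart S k \<in> set (walk S)"
    using jk by (simp_all add: out_dart_def)
  ultimately show ?thesis by (metis IntI empty_iff imageI)
qed

lemma out_neq_in: "j < n \<Longrightarrow> out_dart S j \<noteq> in_dart S k"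
  using opp_out[OF pred_less, of j k] unfolding in_dart_pred by metis

lemma in_inj: "j < n \<Longrightarrow> k < n \<Longrightarrow> in_dart S j = in_dart S k \<longleftrightarrow> j = k"
  unfolding in_dart_pred using permutes_inj[OF surface(2)] out_inj[OF pred_less pred_less] pred_inj
  by (metis injD)

lemma path_chain_out:
  assumes "P \<subseteq> {..<n}" "j < n"
  shows "path_chain S P (out_dart S j) = of_bool (j \<in> P)"
proof -
  have "out_dart S j \<in> out_dart S ` P \<longleftrightarrow> j \<in> P" using assms out_inj by (auto simp: subset_eq)
  moreover have "opp S (out_dart S j) \<notin> out_dart S ` P" using assms opp_out by (auto simp: subset_eq)
  ultimately show ?thesis by (simp add: path_chain_def)
qed

lemma path_chain_in:
  assumes "P \<subseteq> {..<n}" "j < n"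
  shows "path_chain S P (in_dart S j) = - of_bool (pred_visit S j \<in> P)"
proof -
  have "opp S (in_dart S j) = out_dart S (pred_visit S j)"
    using surface(4)[OF out_in_darts(1)[OF pred_less]] by (simp add: in_dart_pred)
  moreover have "out_dart S (pred_visit S j) \<in> out_dart S ` P \<longleftrightarrow> pred_visit S j \<in> P"
    using assms out_inj[OF pred_less] by (auto simp: subset_eq)
  moreover have "in_dart S j \<notin> out_dart S ` P" using assms out_neq_in by (metis imageE lessThan_iff subsetD)
  ultimately show ?thesis by (simp add: path_chain_def)
qed

lemma path_chain_off:
  assumes "P \<subseteq> {..<n}" "d \<in> darts S" "\<And>j. j < n \<Longrightarrow> d \<noteq> out_dart S j \<and> d \<noteq> in_dart S j"
  shows "path_chain S P d = 0"
proof -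
  have "d \<notin> out_dart S ` P" using assms by (auto simp: subset_eq)
  moreover have "opp S d \<notin> out_dart S ` P"
  proof
    assume "opp S d \<in> out_dart S ` P"
    then obtain k where k: "k < n" "opp S d = out_dart S k" using assms(1) by (auto simp: subset_eq)
    obtain j where "j < n" "pred_visit S j = k" using pred_surj[OF k(1)] by blast
    then have "d = in_dart S j" using surface(4)[OF assms(2)] k(2) by (simp add: in_dart_pred)
    then show False using assms(3) \<open>j < n\<close> by blast
  qed
  ultimately show ?thesis by (simp add: path_chain_def)
qed

lemma perm: "permutation (rot S)"
  using surface(1,3) permutation_permutes by blast

lemma vertex_rotation:
  assumes "v \<in> s_vertices S"
  shows "rotation (rot S) (Min v) (card v) v" "v \<subseteq> darts S" "\<And>p. p \<in> v \<Longrightarrow> v = orbit (rot S) p"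
proof -
  obtain d where d: "d \<in> darts S" "v = orbit (rot S) d" using assms by (auto simp: s_vertices_def)
  show sub: "v \<subseteq> darts S" unfolding d(2) by (rule permutes_orbit_subset[OF surface(3) d(1)])
  show orb: "v = orbit (rot S) p" if "p \<in> v" for p
    using orbit_cyclic_eq3[OF cyclic_on_orbit'[OF perm, of d]] that by (simp add: d(2))
  have "v \<noteq> {}" unfolding d(2) by (rule orbit_nonempty)
  then have m: "Min v \<in> v" using sub surface(1) finite_subset Min_in by blast
  define m N where "m = Min v" and "N = funpow_dist1 (rot S) m m"
  have self: "m \<in> orbit (rot S) m" using permutation_self_in_orbit[OF perm] .
  have v: "v = orbit (rot S) m" using orb m by (simp add: m_def)
  have bij: "bij_betw (\<lambda>i. (rot S ^^ i) m) {..<N} v"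
    unfolding bij_betw_def v using inj_on_funpow_dist1[OF self] orbit_conv_funpow_dist1[OF self]
    by (simp add: N_def atLeast0LessThan)
  then have "card v = N" using bij_betw_same_card by fastforce
  moreover have "(rot S ^^ N) m = m" unfolding N_def by (rule funpow_dist1_prop[OF self])
  moreover have "0 < N" by (simp add: N_def)
  ultimately show "rotation (rot S) (Min v) (card v) v" using bij by unfold_locales (simp_all add: m_def)
qed

lemma visit_at:
  assumes "v \<in> s_vertices S" "j < n"
  shows "in_dart S j \<in> v \<longleftrightarrow> out_dart S j \<in> v"
proof -
  have "in_dart S j \<in> orbit (rot S) (out_dart S j)"
    using S assms(2) by (auto simp: closed_curve_diagram_def)
  moreover from this have "out_dart S j \<in> orbit (rot S) (in_dart S j)"
    using orbit_swap permutation_self_in_orbit[OF perm] by metis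
  ultimately show ?thesis using vertex_rotation(3)[OF assms(1)] by metis
qed

lemma double_points:
  "(j, k) \<in> s_double_points S \<longleftrightarrow> j < n \<and> k < n \<and> j \<noteq> k \<and> out_dart S k \<in> orbit (rot S) (out_dart S j)"
  by (simp add: s_double_points_def)

lemma double_points_sym: "(j, k) \<in> s_double_points S \<Longrightarrow> (k, j) \<in> s_double_points S"
  using orbit_swap[of "out_dart S j"] permutation_self_in_orbit[OF perm]
  by (auto simp: double_points)

lemma double_points_unique: "(i, j) \<in> s_double_points S \<Longrightarrow> (i, k) \<in> s_double_points S \<Longrightarrow> j = k"
  using S unfolding closed_curve_diagram_def by blast

definition local_turning :: "nat set \<Rightarrow> nat set \<Rightarrow> nat set \<Rightarrow> int" where
  "local_turning P Q v = rotation.turning (rot S) (Min v) (card v) (path_chain S P) (path_chain S Q)"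

lemma intersection_number_turning:
  "intersection_number S (path_chain S P) (path_chain S Q) = (\<Sum>v\<in>s_vertices S. local_turning P Q v) div 2"
proof -
  have "(\<Sum>j<card v. \<Sum>i<j. (let p = (rot S ^^ i) (Min v); q = (rot S ^^ j) (Min v)
      in path_chain S P p * path_chain S Q q - path_chain S P q * path_chain S Q p)) = local_turning P Q v"
    if "v \<in> s_vertices S" for v
    using rotation.turning_def[OF vertex_rotation(1)[OF that]] by (simp add: local_turning_def)
  then show ?thesis by (simp add: intersection_number_def)
qed

lemma double_point_vertex:
  assumes "(j, k) \<in> s_double_points S"
  shows "orbit (rot S) (out_dart S j) \<in> s_vertices S"
    "{i. i < n \<and> out_dart S i \<in> orbit (rot S) (out_dart S j)} = {j, k}"
proof -
  show "orbit (rot S) (out_dart S j) \<in> s_vertices S"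
    using assms out_in_darts by (auto simp: s_vertices_def double_points)
  have "i = j \<or> i = k" if "i < n" "out_dart S i \<in> orbit (rot S) (out_dart S j)" for i
    using double_points_unique[OF assms, of i] assms that by (auto simp: double_points)
  then show "{i. i < n \<and> out_dart S i \<in> orbit (rot S) (out_dart S j)} = {j, k}"
    using assms permutation_self_in_orbit[OF perm] by (auto simp: double_points)
qed

lemma path_chain_off_vertex:
  assumes "P \<subseteq> {..<n}" "v \<in> s_vertices S" "{i. i < n \<and> out_dart S i \<in> v} = V"
    "p \<in> v - (out_dart S ` V \<union> in_dart S ` V)"
  shows "path_chain S P p = 0"
proof (rule path_chain_off[OF assms(1)])
  show "p \<in> darts S" using vertex_rotation(2)[OF assms(2)] assms(4) by auto
  show "p \<noteq> out_dart S j \<and> p \<noteq> in_dart S j" if "j < n" for j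
    using assms(3,4) visit_at[OF assms(2) that] that by auto
qed

text \<open>Two visits to the same vertex would form a double point. So the curve passes the vertex
  once, where \<open>turning_pass\<close> applies, or misses it and both chains vanish
  there.\<close>

lemma local_turning_simple:
  assumes P: "closed_path S P" and Q: "closed_path S Q" and v: "v \<in> s_vertices S"
    and simple: "\<And>j k. j < n \<Longrightarrow> out_dart S j \<in> v \<Longrightarrow> (j, k) \<notin> s_double_points S"
  shows "local_turning P Q v = 0"
proof -
  interpret rotation "rot S" "Min v" "card v" v by (rule vertex_rotation(1)[OF v])
  have sub: "P \<subseteq> {..<n}" "Q \<subseteq> {..<n}" using P Q by (auto simp: closed_path_def)
  show ?thesis
  proof (cases "\<exists>j<n. out_dart S j \<in> v")
    case True
    then obtain j where j: "j < n" "out_dart S j \<in> v" by blast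
    have "i = j" if "i < n" "out_dart S i \<in> v" for i
      using simple[OF j, of i] that j vertex_rotation(3)[OF v j(2)] by (auto simp: double_points)
    then have V: "{i. i < n \<and> out_dart S i \<in> v} = {j}" using j by blast
    show ?thesis unfolding local_turning_def
    proof (rule turning_pass[where a = "out_dart S j" and c = "in_dart S j"])
      show "in_dart S j \<in> v" using visit_at[OF v j(1)] j by simp
      show "out_dart S j \<noteq> in_dart S j" using out_neq_in j by simp
      have "(j \<in> P \<longleftrightarrow> pred_visit S j \<in> P) \<and> (j \<in> Q \<longleftrightarrow> pred_visit S j \<in> Q)"
        using P Q simple[OF j] j(1) by (auto simp: closed_path_def)
      then show "path_chain S P (out_dart S j) + path_chain S P (in_dart S j) = 0"
        "path_chain S Q (out_dart S j) + path_chain S Q (in_dart S j) = 0"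
        using j sub by (simp_all add: path_chain_out path_chain_in)
      show "path_chain S P p = 0 \<and> path_chain S Q p = 0" if "p \<in> v - {out_dart S j, in_dart S j}" for p
        using path_chain_off_vertex[OF sub(1) v V, of p] path_chain_off_vertex[OF sub(2) v V, of p] that by simp
    qed (use j in simp)
  next
    case False
    then have V: "{i. i < n \<and> out_dart S i \<in> v} = {}" by auto
    have "turning (path_chain S P) (path_chain S Q) = (\<Sum>q\<in>{}. \<Sum>p\<in>{}. if pos p < pos q
        then path_chain S P p * path_chain S Q q - path_chain S P q * path_chain S Q p else 0)"
      by (rule turning_support)
        (use path_chain_off_vertex[OF sub(1) v V] path_chain_off_vertex[OF sub(2) v V] in auto)
    then show ?thesis by (simp add: local_turning_def)
  qed
qed

lemma local_turning_double:
  assumes P: "closed_path S P" and Q: "closed_path S Q" and jk: "(j, k) \<in> s_double_points S"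
  shows "2 * local_turning P Q (orbit (rot S) (out_dart S j)) = s_sign S (j, k) *
    (visit_weight S P j * visit_weight S Q k - visit_weight S P k * visit_weight S Q j)"
proof -
  define v where "v = orbit (rot S) (out_dart S j)"
  note vert = double_point_vertex[OF jk, folded v_def]
  interpret rotation "rot S" "Min v" "card v" v by (rule vertex_rotation(1)[OF vert(1)])
  have sub: "P \<subseteq> {..<n}" "Q \<subseteq> {..<n}" using P Q by (auto simp: closed_path_def)
  have less: "j < n" "k < n" "j \<noteq> k" using jk by (auto simp: double_points)
  have out: "out_dart S j \<in> v" "out_dart S k \<in> v" using vert(2) by auto
  have Z: "{out_dart S j, out_dart S k, in_dart S j, in_dart S k} \<subseteq> v"
    using out visit_at[OF vert(1)] less by simp
  have dist: "distinct [out_dart S j, out_dart S k, in_dart S j, in_dart S k]"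
    using less out_inj in_inj out_neq_in by (auto simp: eq_commute)
  have flow: "path_chain S R (out_dart S j) + path_chain S R (out_dart S k) + path_chain S R (in_dart S j)
      + path_chain S R (in_dart S k) = 0" if "closed_path S R" for R
  proof -
    have "R \<subseteq> {..<n}" "of_bool (j \<in> R) + of_bool (k \<in> R) =
        of_bool (pred_visit S j \<in> R) + (of_bool (pred_visit S k \<in> R) :: int)"
      using that jk unfolding closed_path_def by blast+
    then show ?thesis using less by (simp add: path_chain_out path_chain_in)
  qed
  have trans: "(funpow_dist (rot S) (out_dart S j) (out_dart S k) < funpow_dist (rot S) (out_dart S j) (in_dart S j)) \<noteq>
    (funpow_dist (rot S) (out_dart S j) (in_dart S k) < funpow_dist (rot S) (out_dart S j) (in_dart S j))"
    using S jk unfolding closed_curve_diagram_def ccw_before_def by blast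
  have supp: "path_chain S P p = 0 \<and> path_chain S Q p = 0"
    if "p \<in> v - {out_dart S j, out_dart S k, in_dart S j, in_dart S k}" for p
    using path_chain_off_vertex[OF sub(1) vert, of p] path_chain_off_vertex[OF sub(2) vert, of p] that by simp
  show ?thesis
    using turning_crossing[OF Z dist flow[OF P] flow[OF Q] supp trans] less sub
    by (simp add: local_turning_def v_def[symmetric] s_sign_def ccw_before_def visit_weight_def path_chain_out path_chain_in)
qed

text \<open>Only vertices with a double point contribute, and \<open>s_over\<close> contains exactly
  one ordered pair for each. The definition of the intersection number halves the sum over vertices,
  and twice a vertex contribution is a summand of the pairing: hence the 4.\<close>

theorem intersection_number_pairing:
  assumes P: "closed_path S P" and Q: "closed_path S Q"
  shows "intersection_number S (path_chain S P) (path_chain S Q) =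
    pairing (s_over S) (s_sign S) (visit_weight S P) (visit_weight S Q) div 4"
proof -
  let ?v = "\<lambda>c. orbit (rot S) (out_dart S (fst c))"
  have over: "s_over S \<subseteq> s_double_points S"
    "\<And>j k. (j, k) \<in> s_double_points S \<Longrightarrow> (j, k) \<in> s_over S \<longleftrightarrow> (k, j) \<notin> s_over S"
    using S unfolding closed_curve_diagram_def by blast+
  have fin: "finite (s_vertices S)" using surface(1) by (simp add: s_vertices_def)
  \<comment> \<open>A vertex determines its unordered pair of visits, and only one ordering of it is
    in \<open>s_over\<close>.\<close>
  have inj: "inj_on ?v (s_over S)"
  proof (rule inj_onI)
    fix c d assume cd: "c \<in> s_over S" "d \<in> s_over S" "?v c = ?v d"
    obtain j k j' k' where c: "c = (j, k)" and d: "d = (j', k')" by (cases c; cases d)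
    have "{j, k} = {j', k'}"
      using double_point_vertex(2)[of j k] double_point_vertex(2)[of j' k'] cd over(1)
      by (auto simp: c d)
    then have "d = (j, k) \<or> d = (k, j)" by (auto simp: d doubleton_eq_iff)
    then show "c = d" using cd(1,2) over by (auto simp: c)
  qed
  have "(\<Sum>v\<in>s_vertices S. local_turning P Q v) = (\<Sum>v\<in>?v ` s_over S. local_turning P Q v)"
  proof (rule sum.mono_neutral_right[OF fin])
    show "?v ` s_over S \<subseteq> s_vertices S" using double_point_vertex(1) over(1) by fastforce
    show "\<forall>v\<in>s_vertices S - ?v ` s_over S. local_turning P Q v = 0"
    proof
      fix v assume v: "v \<in> s_vertices S - ?v ` s_over S"
      have "(j, k) \<notin> s_double_points S" if j: "j < n" "out_dart S j \<in> v" for j k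
      proof
        assume jk: "(j, k) \<in> s_double_points S"
        have vj: "v = orbit (rot S) (out_dart S j)" using vertex_rotation(3) v j(2) by blast
        moreover have "out_dart S k \<in> v" using jk by (simp add: double_points vj)
        ultimately have "v = ?v (j, k)" "v = ?v (k, j)" using vertex_rotation(3) v by (auto simp del: vj)
        then show False using over(2)[OF jk] v by blast
      qed
      then show "local_turning P Q v = 0" using local_turning_simple[OF P Q] v by blast
    qed
  qed
  also have "\<dots> = (\<Sum>c\<in>s_over S. local_turning P Q (?v c))" by (simp add: sum.reindex[OF inj])
  finally have "2 * (\<Sum>v\<in>s_vertices S. local_turning P Q v) = (\<Sum>c\<in>s_over S. 2 * local_turning P Q (?v c))"
    by (simp add: sum_distrib_left)
  also have "\<dots> = pairing (s_over S) (s_sign S) (visit_weight S P) (visit_weight S Q)"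
    unfolding pairing_def
  proof (rule sum.cong[OF refl])
    fix c assume "c \<in> s_over S"
    then show "2 * local_turning P Q (?v c) = s_sign S c * (visit_weight S P (fst c) * visit_weight S Q (snd c)
        - visit_weight S P (snd c) * visit_weight S Q (fst c))"
      using local_turning_double[OF P Q, of "fst c" "snd c"] over(1) by auto
  qed
  \<comment> \<open>For every integer s the quotients of s by 2 and of 2 s by 4 have the same
    floor.\<close>
  finally show ?thesis unfolding intersection_number_turning by linarith
qed

lemma over_double: "c \<in> s_over S \<Longrightarrow> (fst c, snd c) \<in> s_double_points S"
  using S unfolding closed_curve_diagram_def by auto

lemma not_base: "(j, k) \<in> s_double_points S \<Longrightarrow> 0 < j"
  using S unfolding closed_curve_diagram_def by (metis gr0I)

lemma over_less: "c \<in> s_over S \<Longrightarrow> fst c < n \<and> snd c < n \<and> fst c \<noteq> snd c \<and> 0 < fst c \<and> 0 < snd c"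
proof -
  assume "c \<in> s_over S"
  then have dp: "(fst c, snd c) \<in> s_double_points S" by (rule over_double)
  show ?thesis
    using dp[unfolded double_points] not_base[OF dp] not_base[OF double_points_sym[OF dp]] by blast
qed

text \<open>The half-open range is shifted by one. At \<open>j = 0\<close> both sides are false: the
  edge entering the base point is the last one, which lies in no arc because every visit of the
  crossing is less than \<open>n\<close>.\<close>

lemma pred_alpha:
  assumes "c \<in> s_over S" "j < n"
  shows "pred_visit S j \<in> alpha_range c \<longleftrightarrow> min (fst c) (snd c) < j \<and> j \<le> max (fst c) (snd c)"
  using over_less[OF assms(1)] assms(2) by (auto simp: pred_visit_eq alpha_range_def)

lemma visit_weight_alpha:
  assumes "c \<in> s_over S" "j < n"
  shows "visit_weight S (alpha_range c) j = chord_arc c j"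
  unfolding visit_weight_def pred_alpha[OF assms] chord_arc_def by (simp add: alpha_range_def)

lemma alpha_range_end:
  assumes "c \<in> s_over S" "j < n" "j \<noteq> fst c" "j \<noteq> snd c"
  shows "pred_visit S j \<in> alpha_range c \<longleftrightarrow> j \<in> alpha_range c"
  unfolding pred_alpha[OF assms(1,2)] using assms(3,4) by (auto simp: alpha_range_def)

text \<open>At its own crossing the arc leaves along the earlier visit and enters along the later
  one. At any other visit the entering and the leaving edge are both on the arc or both off
  it.\<close>

lemma closed_path_alpha:
  assumes c: "c \<in> s_over S"
  shows "closed_path S (alpha_range c)"
  unfolding closed_path_def
proof (intro conjI allI impI ballI)
  note less = over_less[OF c]
  note dp = over_double[OF c] double_points_sym[OF over_double[OF c]]
  show "alpha_range c \<subseteq> {..<n}" using less by (auto simp: alpha_range_def)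
  show "j \<in> alpha_range c \<longleftrightarrow> pred_visit S j \<in> alpha_range c" if "j < n" "\<forall>k. (j, k) \<notin> s_double_points S" for j
    using alpha_range_end[OF c that(1)] that(2) dp by metis
  fix e assume e: "e \<in> s_double_points S"
  obtain j k where jk: "e = (j, k)" by (cases e)
  have lessjk: "j < n" "k < n" using e by (auto simp: jk double_points)
  have "of_bool (j \<in> alpha_range c) + of_bool (k \<in> alpha_range c) =
      of_bool (pred_visit S j \<in> alpha_range c) + (of_bool (pred_visit S k \<in> alpha_range c) :: int)"
  proof (cases "j \<in> {fst c, snd c} \<or> k \<in> {fst c, snd c}")
    case True
    then have "(j, k) = (fst c, snd c) \<or> (j, k) = (snd c, fst c)"
      using double_points_unique dp e double_points_sym unfolding jk by blast
    then show ?thesis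
      unfolding pred_alpha[OF c lessjk(1)] pred_alpha[OF c lessjk(2)] using less
      by (auto simp: alpha_range_def min_def max_def)
  next
    case False
    then show ?thesis using alpha_range_end[OF c lessjk(1)] alpha_range_end[OF c lessjk(2)] by simp
  qed
  then show "case e of (j, k) \<Rightarrow> of_bool (j \<in> alpha_range c) + of_bool (k \<in> alpha_range c) =
      of_bool (pred_visit S j \<in> alpha_range c) + (of_bool (pred_visit S k \<in> alpha_range c) :: int)"
    by (simp add: jk)
qed

lemma visit_weight_complement:
  "j < n \<Longrightarrow> visit_weight S ({..<n} - P) j = 2 - visit_weight S P j"
  using pred_less[of j] by (simp add: visit_weight_def of_bool_def)

lemma closed_path_complement:
  assumes "closed_path S P"
  shows "closed_path S ({..<n} - P)"
  unfolding closed_path_def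
proof (intro conjI allI impI ballI)
  show "j \<in> {..<n} - P \<longleftrightarrow> pred_visit S j \<in> {..<n} - P" if "j < n" "\<forall>k. (j, k) \<notin> s_double_points S" for j
    using assms that pred_less[of j] by (auto simp: closed_path_def)
  fix e assume e: "e \<in> s_double_points S"
  obtain j k where jk: "e = (j, k)" by (cases e)
  have "of_bool (j \<in> P) + of_bool (k \<in> P) =
      of_bool (pred_visit S j \<in> P) + (of_bool (pred_visit S k \<in> P) :: int)"
    using assms e unfolding closed_path_def jk by blast
  then show "case e of (j, k) \<Rightarrow> of_bool (j \<in> {..<n} - P) + of_bool (k \<in> {..<n} - P) =
      of_bool (pred_visit S j \<in> {..<n} - P) + (of_bool (pred_visit S k \<in> {..<n} - P) :: int)"
    using e pred_less[of j] pred_less[of k] by (simp add: jk double_points of_bool_def split: if_splits)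
qed auto

lemma chord_ends_over: "t \<in> chord_ends (s_over S) \<Longrightarrow> t < n"
  using over_less by (auto simp: chord_ends_def)

text \<open>In terms of weights \<beta> is the constant 2 minus \<alpha>, so everything follows by
  bilinearity; the constant pairs to 0 with itself, and the sign of the remaining mixed term comes
  from antisymmetry.\<close>

lemma intersection_number_cycles:
  assumes c: "c \<in> s_over S" and d: "d \<in> s_over S"
  shows "intersection_number S (alpha_cycle S c) (alpha_cycle S d) =
      pairing (s_over S) (s_sign S) (chord_arc c) (chord_arc d) div 4"
    "intersection_number S (alpha_cycle S c) (beta_cycle S d) =
      (pairing (s_over S) (s_sign S) (chord_arc c) core
        - pairing (s_over S) (s_sign S) (chord_arc c) (chord_arc d)) div 4"
    "intersection_number S (beta_cycle S c) (beta_cycle S d) =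
      (pairing (s_over S) (s_sign S) (chord_arc d) core - pairing (s_over S) (s_sign S) (chord_arc c) core
        + pairing (s_over S) (s_sign S) (chord_arc c) (chord_arc d)) div 4"
proof -
  let ?P = "pairing (s_over S) (s_sign S)"
  note \<alpha> = closed_path_alpha[OF c] closed_path_alpha[OF d]
  note \<beta> = closed_path_complement[OF \<alpha>(1)] closed_path_complement[OF \<alpha>(2)]
  note weights = visit_weight_alpha[OF c] visit_weight_alpha[OF d] visit_weight_complement chord_ends_over
  have "?P (visit_weight S (alpha_range c)) (visit_weight S (alpha_range d)) = ?P (chord_arc c) (chord_arc d)"
    by (rule pairing_cong) (simp_all add: weights)
  then show "intersection_number S (alpha_cycle S c) (alpha_cycle S d) = ?P (chord_arc c) (chord_arc d) div 4"
    unfolding alpha_cycle_def intersection_number_pairing[OF \<alpha>] by simp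
  have "?P (visit_weight S (alpha_range c)) (visit_weight S ({..<n} - alpha_range d)) =
      ?P (chord_arc c) (\<lambda>t. core t - chord_arc d t)"
    by (rule pairing_cong) (simp_all add: weights)
  then show "intersection_number S (alpha_cycle S c) (beta_cycle S d) =
      (?P (chord_arc c) core - ?P (chord_arc c) (chord_arc d)) div 4"
    unfolding alpha_cycle_def beta_cycle_def intersection_number_pairing[OF \<alpha>(1) \<beta>(2)] pairing_diff_right by simp
  have "?P (visit_weight S ({..<n} - alpha_range c)) (visit_weight S ({..<n} - alpha_range d)) =
      ?P (\<lambda>t. core t - chord_arc c t) (\<lambda>t. core t - chord_arc d t)"
    by (rule pairing_cong) (simp_all add: weights)
  then show "intersection_number S (beta_cycle S c) (beta_cycle S d) =
      (?P (chord_arc d) core - ?P (chord_arc c) core + ?P (chord_arc c) (chord_arc d)) div 4"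
    unfolding beta_cycle_def intersection_number_pairing[OF \<beta>] pairing_diff_right pairing_diff_left
    using pairing_swap[of "s_over S" "s_sign S" core "chord_arc d"] by simp
qed

end

section \<open>Realizing a chord diagram on a surface\<close>

text \<open>
  Visit \<open>j\<close> gets the outgoing dart \<open>2 j\<close> and the incoming dart \<open>2 j + 1\<close>; visit 0 is the base point.
  The predicate \<open>sg j\<close> says that the directions of visits \<open>j\<close> and \<open>mate j\<close> form a positive basis.
\<close>

locale visit_pattern =
  fixes n :: nat and mate :: "nat \<Rightarrow> nat" and sg :: "nat \<Rightarrow> bool"
  assumes n: "0 < n" and mate_less: "j < n \<Longrightarrow> mate j < n" and mate_mate: "j < n \<Longrightarrow> mate (mate j) = j"
    and mate_fixed: "j < n \<Longrightarrow> mate j = j \<longleftrightarrow> j = 0"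
    and sg_0: "\<not> sg 0" and sg_mate: "j < n \<Longrightarrow> j \<noteq> 0 \<Longrightarrow> sg (mate j) \<longleftrightarrow> \<not> sg j"
begin

text \<open>For positive \<open>sg j\<close> the counterclockwise order is out of \<open>j\<close>,
  out of \<open>mate j\<close>, into \<open>j\<close>, into \<open>mate j\<close>; otherwise the two
  darts of \<open>mate j\<close> are exchanged. At the base point, its own mate, the convention
  \<open>\<not> sg 0\<close> makes the rotation swap the two darts.\<close>

definition rotate :: "nat \<Rightarrow> nat" where
  "rotate d = (if d < 2 * n then 2 * mate (d div 2) + (if sg (d div 2) then d mod 2 else 1 - d mod 2) else d)"

definition opposite :: "nat \<Rightarrow> nat" where
  "opposite d = (if d < 2 * n
     then if even d then 2 * ((d div 2 + 1) mod n) + 1 else 2 * ((d div 2 + n - 1) mod n) else d)"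

text \<open>Only the graph and its rotations are prescribed. The faces are whatever orbits of the
  rotation composed with the reversal arise, and gluing a disk into each gives the closed
  surface.\<close>

definition pattern :: "(nat \<times> nat) set \<Rightarrow> surface_diagram" where
  "pattern C = \<lparr>darts = {..<2 * n}, opp = opposite, rot = rotate, walk = map (\<lambda>k. 2 * k) [0..<n], s_over = C\<rparr>"

lemma pattern_sel [simp]:
  "darts (pattern C) = {..<2 * n}" "opp (pattern C) = opposite" "rot (pattern C) = rotate"
  "walk (pattern C) = map (\<lambda>k. 2 * k) [0..<n]" "s_over (pattern C) = C"
  by (simp_all add: pattern_def)

lemma dart_cases: "d < 2 * n \<Longrightarrow> (\<exists>j<n. d = 2 * j \<or> d = Suc (2 * j))"
  by presburger

lemma rotate_out: "j < n \<Longrightarrow> rotate (2 * j) = (if sg j then 2 * mate j else Suc (2 * mate j))"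
  and rotate_in: "j < n \<Longrightarrow> rotate (Suc (2 * j)) = (if sg j then Suc (2 * mate j) else 2 * mate j)"
  by (auto simp: rotate_def)

lemma mate_0: "mate 0 = 0"
  using mate_fixed[OF n] by simp

lemma rotate_0: "rotate 0 = 1" "rotate (Suc 0) = 0"
  using rotate_out[OF n] rotate_in[OF n] by (simp_all add: mate_0 sg_0)

lemma rotate2: "j < n \<Longrightarrow> j \<noteq> 0 \<Longrightarrow> rotate (rotate (2 * j)) = Suc (2 * j)"
  "j < n \<Longrightarrow> j \<noteq> 0 \<Longrightarrow> rotate (rotate (Suc (2 * j))) = 2 * j"
  by (simp_all add: rotate_out rotate_in mate_less mate_mate sg_mate)

lemma rotate4: "d < 2 * n \<Longrightarrow> rotate (rotate (rotate (rotate d))) = d"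
proof -
  assume "d < 2 * n"
  then obtain j where j: "j < n" "d = 2 * j \<or> d = Suc (2 * j)" using dart_cases by blast
  then show ?thesis
    by (cases "j = 0") (auto simp: rotate_0 rotate2)
qed

lemma rotate_less: "d < 2 * n \<Longrightarrow> rotate d < 2 * n"
proof -
  assume "d < 2 * n"
  then obtain j where j: "j < n" "d = 2 * j \<or> d = Suc (2 * j)" using dart_cases by blast
  then show ?thesis using mate_less[OF j(1)] by (auto simp: rotate_out rotate_in)
qed

lemma rotate_permutes: "rotate permutes {..<2 * n}"
proof (rule bij_imp_permutes)
  show "bij_betw rotate {..<2 * n} {..<2 * n}"
    by (rule bij_betw_byWitness[where f' = "\<lambda>d. rotate (rotate (rotate d))"])
      (auto simp: rotate4 intro!: rotate_less)
qed (simp add: rotate_def)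

lemma opposite_out: "j < n \<Longrightarrow> opposite (2 * j) = Suc (2 * ((j + 1) mod n))"
  and opposite_in: "j < n \<Longrightarrow> opposite (Suc (2 * j)) = 2 * ((j + n - 1) mod n)"
  by (auto simp: opposite_def)

lemma shift_shift: "j < n \<Longrightarrow> ((j + n - 1) mod n + 1) mod n = j" "j < n \<Longrightarrow> ((j + 1) mod n + n - 1) mod n = j"
proof -
  assume j: "j < n"
  have "((j + n - 1) mod n + 1) mod n = (j + n - 1 + 1) mod n" by (rule mod_add_left_eq)
  then show "((j + n - 1) mod n + 1) mod n = j" using j by simp
  have "((j + 1) mod n + (n - 1)) mod n = (j + 1 + (n - 1)) mod n" by (rule mod_add_left_eq)
  then show "((j + 1) mod n + n - 1) mod n = j" using j by simp
qed

lemma opposite_opposite: "d < 2 * n \<Longrightarrow> opposite (opposite d) = d"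
proof -
  assume "d < 2 * n"
  then obtain j where j: "j < n" "d = 2 * j \<or> d = Suc (2 * j)" using dart_cases by blast
  then show ?thesis
    using shift_shift[OF j(1)] by (auto simp: opposite_out opposite_in n)
qed

lemma opposite_neq: "d < 2 * n \<Longrightarrow> opposite d \<noteq> d"
proof -
  assume "d < 2 * n"
  then obtain j where j: "j < n" "d = 2 * j \<or> d = Suc (2 * j)" using dart_cases by blast
  have "Suc (2 * a) \<noteq> 2 * b" "2 * b \<noteq> Suc (2 * a)" for a b by presburger+
  then show ?thesis using j by (auto simp: opposite_out opposite_in)
qed

lemma opposite_less: "d < 2 * n \<Longrightarrow> opposite d < 2 * n"
proof -
  assume "d < 2 * n"
  then obtain j where j: "j < n" "d = 2 * j \<or> d = Suc (2 * j)" using dart_cases by blast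
  have "(j + 1) mod n < n" "(j + n - 1) mod n < n" using n by simp_all
  then have "Suc (2 * ((j + 1) mod n)) < 2 * n" "2 * ((j + n - 1) mod n) < 2 * n" by linarith+
  then show ?thesis using j opposite_out[OF j(1)] opposite_in[OF j(1)] by auto
qed

lemma opposite_permutes: "opposite permutes {..<2 * n}"
proof (rule bij_imp_permutes)
  show "bij_betw opposite {..<2 * n} {..<2 * n}"
    by (rule bij_betw_byWitness[where f' = opposite]) (auto simp: opposite_opposite intro!: opposite_less)
qed (simp add: opposite_def)

definition step :: "(nat \<times> nat) set" where "step = {(x, y). y = rotate x \<or> y = opposite x}"

lemma step_rotate: "(x, d) \<in> step\<^sup>* \<Longrightarrow> (x, rotate d) \<in> step\<^sup>*" and step_opposite: "(x, d) \<in> step\<^sup>* \<Longrightarrow> (x, opposite d) \<in> step\<^sup>*"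
  by (auto simp: step_def intro: rtrancl_into_rtrancl)

lemma in_to_out: "j < n \<Longrightarrow> (Suc (2 * j), 2 * j) \<in> step\<^sup>*"
proof (cases "j = 0")
  case True
  then show ?thesis using step_rotate[of "Suc 0" "Suc 0"] by (simp add: rotate_0)
next
  case False
  assume "j < n"
  then show ?thesis using step_rotate[OF step_rotate, of "Suc (2 * j)" "Suc (2 * j)"] False by (simp add: rotate2)
qed

lemma out_to_in: "j < n \<Longrightarrow> (2 * j, Suc (2 * j)) \<in> step\<^sup>*"
proof (cases "j = 0")
  case True
  then show ?thesis using step_rotate[of 0 0] by (simp add: rotate_0)
next
  case False
  assume "j < n"
  then show ?thesis using step_rotate[OF step_rotate, of "2 * j" "2 * j"] False by (simp add: rotate2)
qed

lemma next_visit: "j < n \<Longrightarrow> (2 * j, 2 * ((j + 1) mod n)) \<in> step\<^sup>*"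
proof -
  assume j: "j < n"
  have "(2 * j, Suc (2 * ((j + 1) mod n))) \<in> step\<^sup>*"
    using step_opposite[of "2 * j" "2 * j"] j by (simp add: opposite_out)
  also have "(Suc (2 * ((j + 1) mod n)), 2 * ((j + 1) mod n)) \<in> step\<^sup>*" using n by (intro in_to_out) simp
  finally show ?thesis .
qed

text \<open>Following the curve passes all visits, and at a visit rotating reaches the other dart;
  going on past the last visit leads back to the base point.\<close>

lemma connected: "d < 2 * n \<Longrightarrow> (d, 0) \<in> step\<^sup>* \<and> (0, d) \<in> step\<^sup>*"
proof -
  have from0: "(0, 2 * j) \<in> step\<^sup>*" if "j < n" for j
    using that
  proof (induction j)
    case (Suc j)
    then show ?case using next_visit[of j] by (auto intro: rtrancl_trans)
  qed simp
  have to0: "(2 * j, 0) \<in> step\<^sup>*" if "j < n" for j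
    using that
  proof (induction "n - j" arbitrary: j)
    case (Suc i)
    show ?case
    proof (cases "j + 1 = n")
      case True
      then show ?thesis using next_visit[OF Suc.prems] by simp
    next
      case False
      then have "(2 * (j + 1), 0) \<in> step\<^sup>*" using Suc by (intro Suc.hyps(1)) auto
      then show ?thesis using next_visit[OF Suc.prems] False Suc.prems by (auto intro: rtrancl_trans)
    qed
  qed simp
  assume "d < 2 * n"
  then obtain j where j: "j < n" "d = 2 * j \<or> d = Suc (2 * j)" using dart_cases by blast
  then show ?thesis
    using from0[OF j(1)] to0[OF j(1)] in_to_out[OF j(1)] out_to_in[OF j(1)] by (auto intro: rtrancl_trans)
qed

lemma closed_surface_pattern: "closed_surface (pattern C)"
  unfolding closed_surface_def
proof (intro conjI ballI)
  show "(d, e) \<in> {(x, y). y = rot (pattern C) x \<or> y = opp (pattern C) x}\<^sup>*"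
    if "d \<in> darts (pattern C)" "e \<in> darts (pattern C)" for d e
    using connected[of d] connected[of e] that unfolding step_def by (auto intro: rtrancl_trans)
qed (use n opposite_permutes rotate_permutes in \<open>auto simp: opposite_neq opposite_opposite lessThan_empty_iff\<close>)

lemma out_dart_pattern: "j < n \<Longrightarrow> out_dart (pattern C) j = 2 * j"
  by (simp add: out_dart_def)

lemma in_dart_pattern: "j < n \<Longrightarrow> in_dart (pattern C) j = Suc (2 * j)"
proof -
  assume j: "j < n"
  have "(j + n - 1) mod n < n" using n by simp
  then show ?thesis using shift_shift(1)[OF j] by (simp add: in_dart_def opposite_out)
qed

lemma orbit_out:
  assumes "j < n"
  shows "orbit rotate (2 * j) = {2 * j, Suc (2 * j), 2 * mate j, Suc (2 * mate j)}"
proof -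
  have "orbit rotate (2 * j) = {(rotate ^^ i) (2 * j) |i. i < 4}"
    using assms by (intro orbit_altdef_bounded) (simp_all add: eval_nat_numeral rotate4)
  also have "\<dots> = (\<lambda>i. (rotate ^^ i) (2 * j)) ` {i. i < 4}" by (simp only: setcompr_eq_image)
  also have "{i. i < 4} = {0, 1, 2, 3 :: nat}" by auto
  also have "(\<lambda>i. (rotate ^^ i) (2 * j)) ` {0, 1, 2, 3} =
      (\<lambda>i. (rotate ^^ i) (2 * j)) ` {0, 1, Suc 1, Suc (Suc 1)}" by (simp add: eval_nat_numeral)
  also have "\<dots> = {2 * j, rotate (2 * j), rotate (rotate (2 * j)), rotate (rotate (rotate (2 * j)))}"
    by (simp add: eval_nat_numeral)
  also have "\<dots> = {2 * j, Suc (2 * j), 2 * mate j, Suc (2 * mate j)}"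
    using assms by (cases "j = 0") (auto simp: rotate_0 mate_0 rotate_out rotate_in mate_less mate_mate sg_mate)
  finally show ?thesis .
qed

lemma double_points_pattern: "s_double_points (pattern C) = {(j, mate j) |j. 0 < j \<and> j < n}"
proof -
  have "(j, k) \<in> s_double_points (pattern C) \<longleftrightarrow> 0 < j \<and> j < n \<and> k = mate j" for j k
  proof -
    have "2 * k \<noteq> Suc (2 * i)" for i by presburger
    then have "(j, k) \<in> s_double_points (pattern C) \<longleftrightarrow> j < n \<and> k < n \<and> j \<noteq> k \<and> (k = j \<or> k = mate j)"
      by (auto simp: s_double_points_def out_dart_pattern orbit_out)
    then show ?thesis using mate_less[of j] mate_fixed[of j] by (cases "j = 0") (auto simp: mate_0)
  qed
  then show ?thesis by auto
qed

lemma dist_pattern: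
  assumes j: "0 < j" "j < n"
  shows "funpow_dist rotate (2 * j) (2 * mate j) = (if sg j then 1 else 3)"
    "funpow_dist rotate (2 * j) (Suc (2 * j)) = 2"
    "funpow_dist rotate (2 * j) (Suc (2 * mate j)) = (if sg j then 3 else 1)"
proof -
  note less = j(2) mate_less[OF j(2)]
  have ne: "mate j \<noteq> j" "j \<noteq> mate j" using mate_fixed[OF j(2)] j(1) by auto
  have parity: "2 * a \<noteq> Suc (2 * b)" "Suc (2 * b) \<noteq> 2 * a" for a b by presburger+
  have step: "funpow_dist rotate x y = (if x = y then 0 else Suc (funpow_dist rotate (rotate x) y))"
    if "x \<in> orbit rotate (2 * j)" "y \<in> orbit rotate (2 * j)" for x y
  proof -
    have perm: "permutation rotate" using rotate_permutes permutation_permutes by blast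
    have "y \<in> orbit rotate x"
      using orbit_cyclic_eq3[OF cyclic_on_orbit'[OF perm] that(1)] that(2) by simp
    then show ?thesis using funpow_dist_step funpow_dist_0 by metis
  qed
  note steps = step[unfolded orbit_out[OF j(2)]]
  have sg: "sg (mate j) \<longleftrightarrow> \<not> sg j" using sg_mate j by simp
  show "funpow_dist rotate (2 * j) (2 * mate j) = (if sg j then 1 else 3)"
    "funpow_dist rotate (2 * j) (Suc (2 * j)) = 2"
    "funpow_dist rotate (2 * j) (Suc (2 * mate j)) = (if sg j then 3 else 1)"
    by (simp_all add: steps rotate_out rotate_in less sg ne mate_mate parity)
qed

lemma ccw_pattern:
  assumes j: "0 < j" "j < n"
  shows "ccw_before (pattern C) (out_dart (pattern C) j) (out_dart (pattern C) (mate j)) (in_dart (pattern C) j) \<longleftrightarrow> sg j"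
    "ccw_before (pattern C) (out_dart (pattern C) j) (in_dart (pattern C) (mate j)) (in_dart (pattern C) j) \<longleftrightarrow> \<not> sg j"
  using j mate_less[OF j(2)] by (auto simp: ccw_before_def out_dart_pattern in_dart_pattern dist_pattern)

lemma closed_curve_pattern:
  assumes C: "C \<subseteq> {(j, mate j) |j. 0 < j \<and> j < n}" "\<And>j. 0 < j \<Longrightarrow> j < n \<Longrightarrow> (j, mate j) \<in> C \<longleftrightarrow> (mate j, j) \<notin> C"
  shows "closed_curve_diagram (pattern C)"
  unfolding closed_curve_diagram_def
proof (intro conjI)
  show "\<forall>k<length (walk (pattern C)). in_dart (pattern C) k \<in> orbit (rot (pattern C)) (out_dart (pattern C) k)"
    by (simp add: out_dart_pattern in_dart_pattern orbit_out)
  have opp: "map opposite (map (\<lambda>k. 2 * k) [0..<n]) = map (\<lambda>k. Suc (2 * ((k + 1) mod n))) [0..<n]"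
    by (simp add: opposite_out)
  have "inj_on (\<lambda>k. Suc (2 * ((k + 1) mod n))) {0..<n}"
  proof (rule inj_onI)
    fix j k assume "j \<in> {0..<n}" "k \<in> {0..<n}" "Suc (2 * ((j + 1) mod n)) = Suc (2 * ((k + 1) mod n))"
    then show "j = k" using shift_shift(2)[of j] shift_shift(2)[of k] by simp
  qed
  then have "distinct (map (\<lambda>k. Suc (2 * ((k + 1) mod n))) [0..<n])"
    by (simp only: distinct_map distinct_upt set_upt simp_thms)
  moreover have "distinct (map (\<lambda>k. 2 * k) [0..<n])" by (simp add: distinct_map inj_on_def)
  moreover have "\<forall>x\<in>set (map (\<lambda>k. 2 * k) [0..<n]). even x"
    "\<forall>x\<in>set (map (\<lambda>k. Suc (2 * ((k + 1) mod n))) [0..<n]). odd x" by simp_all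
  ultimately show "distinct (walk (pattern C) @ map (opp (pattern C)) (walk (pattern C)))"
    unfolding pattern_sel opp distinct_append by (metis (no_types, lifting) disjoint_iff)
  show "\<forall>i j k. (i, j) \<in> s_double_points (pattern C) \<and> (i, k) \<in> s_double_points (pattern C) \<longrightarrow> j = k"
    "\<forall>k. (0, k) \<notin> s_double_points (pattern C)"
    by (simp_all add: double_points_pattern)
  show "s_over (pattern C) \<subseteq> s_double_points (pattern C)"
    using C(1) by (simp add: double_points_pattern)
  show "\<forall>(j, k)\<in>s_double_points (pattern C). (j, k) \<in> s_over (pattern C) \<longleftrightarrow> (k, j) \<notin> s_over (pattern C)"
    using C(2) by (simp add: double_points_pattern split: prod.splits)
  show "\<forall>(j, k)\<in>s_double_points (pattern C).
      ccw_before (pattern C) (out_dart (pattern C) j) (out_dart (pattern C) k) (in_dart (pattern C) j) \<noteq>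
      ccw_before (pattern C) (out_dart (pattern C) j) (in_dart (pattern C) k) (in_dart (pattern C) j)"
    using ccw_pattern by (auto simp: double_points_pattern)
qed (use n closed_surface_pattern in auto)

lemma s_sign_pattern: "0 < j \<Longrightarrow> j < n \<Longrightarrow> s_sign (pattern C) (j, mate j) = (if sg j then 1 else - 1)"
  by (simp add: s_sign_def ccw_pattern)

end

text \<open>The ends are numbered from 1, so visit 0 is free to be the base point, off all
  crossings. The curve passes the ends in order, and each chord becomes a vertex at which its two
  visits meet.\<close>

lemma realize_chord_diagram:
  fixes C :: "(nat \<times> nat) set"
  assumes C: "chord_diagram C" and ends: "chord_ends C = {1..N}"
    and \<epsilon>: "\<And>c. c \<in> C \<Longrightarrow> \<epsilon> c = 1 \<or> \<epsilon> c = (- 1 :: int)"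
  obtains S where "closed_curve_diagram S" "s_over S = C" "\<And>c. c \<in> C \<Longrightarrow> s_sign S c = \<epsilon> c"
proof -
  define joined where "joined j k \<longleftrightarrow> (j, k) \<in> C \<or> (k, j) \<in> C" for j k
  \<comment> \<open>The default \<open>j\<close> concerns visit 0, which becomes its own
    mate.\<close>
  define mate where "mate j = (if j \<in> chord_ends C then SOME k. joined j k else j)" for j
  \<comment> \<open>On the under-path the basis of directions is read in the opposite order, so the
    sign of the crossing is reversed.\<close>
  define sg where "sg j \<longleftrightarrow> (\<exists>k. (j, k) \<in> C \<and> \<epsilon> (j, k) = 1) \<or> (\<exists>k. (k, j) \<in> C \<and> \<epsilon> (k, j) \<noteq> 1)" for j
  have unique: "k = k'" if "joined j k" "joined j k'" for j k k'
    using that chord_diagram_disjoint[OF C, of "(j, k)" "(j, k')"] chord_diagram_disjoint[OF C, of "(j, k)" "(k', j)"]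
      chord_diagram_disjoint[OF C, of "(k, j)" "(j, k')"] chord_diagram_disjoint[OF C, of "(k, j)" "(k', j)"]
    unfolding joined_def by (auto simp: joined_def)
  have joined: "joined j (mate j)" if "j \<in> chord_ends C" for j
  proof -
    have "\<exists>k. joined j k" using that by (auto simp: chord_ends_def joined_def)
    then show ?thesis using that by (simp add: mate_def someI_ex)
  qed
  have joined_sym: "joined j k \<Longrightarrow> joined k j" for j k by (auto simp: joined_def)
  have joined_ends: "j \<in> chord_ends C \<and> k \<in> chord_ends C \<and> j \<noteq> k" if "joined j k" for j k
    using that chord_diagram_distinct_ends[OF C] unfolding joined_def chord_ends_def by force
  have mateI: "mate j = k" if "joined j k" for j k
    using unique[OF joined that] joined_ends[OF that] by simp
  have not_both: "(k, j) \<notin> C" if "(j, k) \<in> C" for j k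
    using chord_diagram_disjoint[OF C that, of "(k, j)"] chord_diagram_distinct_ends[OF C that] by auto
  have sg_over: "sg j \<longleftrightarrow> \<epsilon> (j, k) = 1" "sg k \<longleftrightarrow> \<epsilon> (j, k) \<noteq> 1" if "(j, k) \<in> C" for j k
  proof -
    have "k' = k" if "(j, k') \<in> C \<or> (k', j) \<in> C" for k'
      using that unique[of j k k'] \<open>(j, k) \<in> C\<close> by (auto simp: joined_def)
    then show "sg j \<longleftrightarrow> \<epsilon> (j, k) = 1" unfolding sg_def using that not_both by blast
    have "j' = j" if "(j', k) \<in> C \<or> (k, j') \<in> C" for j'
      using that unique[of k j j'] \<open>(j, k) \<in> C\<close> by (auto simp: joined_def)
    then show "sg k \<longleftrightarrow> \<epsilon> (j, k) \<noteq> 1" unfolding sg_def using that not_both by blast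
  qed
  interpret visit_pattern "Suc N" mate sg
  proof
    show "mate j < Suc N" "mate (mate j) = j" "mate j = j \<longleftrightarrow> j = 0" if "j < Suc N" for j
    proof -
      have "mate j < Suc N \<and> mate (mate j) = j \<and> (mate j = j \<longleftrightarrow> j = 0)"
      proof (cases "j = 0")
        case True
        then have "mate j = j" by (simp add: mate_def ends)
        then show ?thesis using True by simp
      next
        case False
        then have "joined j (mate j)" using that by (intro joined) (simp add: ends)
        from joined_ends[OF this] mateI[OF joined_sym[OF this]] False
        show ?thesis by (simp add: ends)
      qed
      note * = this
      from * show "mate j < Suc N" by (rule conjunct1)
      from * show "mate (mate j) = j" by (elim conjE)
      from * show "mate j = j \<longleftrightarrow> j = 0" by (elim conjE)
    qed
    show "\<not> sg 0"
    proof -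
      have "0 \<notin> chord_ends C" by (simp add: ends)
      then have "(0, k) \<notin> C \<and> (k, 0) \<notin> C" for k by (force simp: chord_ends_def)
      then show ?thesis by (simp add: sg_def)
    qed
    show "sg (mate j) \<longleftrightarrow> \<not> sg j" if "j < Suc N" "j \<noteq> 0" for j
    proof -
      have "j \<in> chord_ends C" using that by (simp add: ends)
      then show ?thesis using joined[of j] sg_over[of j "mate j"] sg_over[of "mate j" j]
        by (auto simp: joined_def)
    qed
  qed simp
  have C_mate: "0 < j \<and> j < Suc N \<and> k = mate j" if "(j, k) \<in> C" for j k
    using that mateI[of j k] joined_ends[of j k] by (auto simp: joined_def ends)
  show thesis
  proof
    show "closed_curve_diagram (pattern C)"
    proof (rule closed_curve_pattern)
      show "C \<subseteq> {(j, mate j) |j. 0 < j \<and> j < Suc N}" using C_mate by auto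
      show "(j, mate j) \<in> C \<longleftrightarrow> (mate j, j) \<notin> C" if "0 < j" "j < Suc N" for j
        using joined[of j] not_both that by (auto simp: joined_def ends)
    qed
    show "s_sign (pattern C) c = \<epsilon> c" if "c \<in> C" for c
    proof -
      obtain j k where c: "c = (j, k)" by (cases c)
      show ?thesis using s_sign_pattern[of j C] C_mate[of j k] sg_over(1)[of j k] \<epsilon>[OF that] that by (auto simp: c)
    qed
  qed simp
qed

section \<open>From a plane diagram to its surface realizations\<close>

lemma strict_mono_on_rank:
  fixes A :: "'a::linorder set"
  assumes "finite A"
  shows "strict_mono_on A (\<lambda>t. card {u \<in> A. u \<le> t})" "(\<lambda>t. card {u \<in> A. u \<le> t}) ` A = {1..card A}"
proof -
  show mono: "strict_mono_on A (\<lambda>t. card {u \<in> A. u \<le> t})"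
  proof (rule strict_mono_onI)
    fix s t assume "s \<in> A" "t \<in> A" "s < t"
    then show "card {u \<in> A. u \<le> s} < card {u \<in> A. u \<le> t}"
      using assms
    proof (intro psubset_card_mono)
      have "t \<in> {u \<in> A. u \<le> t}" "t \<notin> {u \<in> A. u \<le> s}" "{u \<in> A. u \<le> s} \<subseteq> {u \<in> A. u \<le> t}"
        using \<open>t \<in> A\<close> \<open>s < t\<close> by auto
      then show "{u \<in> A. u \<le> s} \<subset> {u \<in> A. u \<le> t}" by blast
    qed simp
  qed
  have "(\<lambda>t. card {u \<in> A. u \<le> t}) ` A \<subseteq> {1..card A}"
    using assms by (auto simp: Suc_le_eq card_gt_0_iff intro!: card_mono)
  moreover have "card ((\<lambda>t. card {u \<in> A. u \<le> t}) ` A) = card {1..card A}"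
    using card_image[OF strict_mono_on_imp_inj_on[OF mono]] by simp
  ultimately show "(\<lambda>t. card {u \<in> A. u \<le> t}) ` A = {1..card A}"
    by (intro card_subset_eq) auto
qed

lemma chord_diagram_image:
  assumes C: "chord_diagram C" and f: "inj_on f (chord_ends C)"
  shows "chord_diagram (map_prod f f ` C)"
proof -
  have inj: "f s = f t \<longleftrightarrow> s = t" if "s \<in> chord_ends C" "t \<in> chord_ends C" for s t
    using inj_on_eq_iff[OF f that] .
  show ?thesis
    unfolding chord_diagram_def
  proof (intro conjI ballI impI)
    show "finite (map_prod f f ` C)" using chord_diagram_finite[OF C] by simp
    show "fst c \<noteq> snd c" if "c \<in> map_prod f f ` C" for c
      using that chord_diagram_distinct_ends[OF C] inj[OF chord_ends_fst chord_ends_snd] by auto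
    fix c d assume "c \<in> map_prod f f ` C" "d \<in> map_prod f f ` C" and ne: "c \<noteq> d"
    from this(1,2) obtain c' d' where cd: "c' \<in> C" "d' \<in> C" "c = map_prod f f c'" "d = map_prod f f d'"
      by (elim imageE)
    with ne have "c' \<noteq> d'" by auto
    note disj = chord_diagram_disjoint[OF C cd(1,2) this]
    note e = chord_ends_fst[OF cd(1)] chord_ends_snd[OF cd(1)] chord_ends_fst[OF cd(2)] chord_ends_snd[OF cd(2)]
    show "fst c \<noteq> fst d" "fst c \<noteq> snd d" "snd c \<noteq> fst d" "snd c \<noteq> snd d"
      unfolding cd(3,4) using disj by (simp_all add: inj e)
  qed
qed

text \<open>A time has at most one partner at a double point, so chords sharing an end would be
  equal or reversed, and the second is excluded by asymmetry of \<open>over\<close>.\<close>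

lemma generic_chord_diagram:
  assumes "generic_diagram I D"
  shows "chord_diagram (over D)"
  unfolding chord_diagram_def
proof (intro conjI ballI impI)
  have over: "over D \<subseteq> double_points I D" "finite (double_points I D)"
    using assms by (simp_all add: generic_diagram_def)
  have asym: "(t, s) \<notin> over D" if "(s, t) \<in> over D" for s t
    using assms that by (auto simp: generic_diagram_def)
  have unique: "t = u" if "(s, t) \<in> double_points I D" "(s, u) \<in> double_points I D" for s t u
    using assms that unfolding generic_diagram_def by metis
  have sym: "(s, t) \<in> double_points I D \<Longrightarrow> (t, s) \<in> double_points I D" for s t
    by (auto simp: double_points_def)
  show "finite (over D)" using over finite_subset by blast
  show "fst c \<noteq> snd c" if "c \<in> over D" for c using that over(1) by (auto simp: double_points_def)
  fix c d assume c: "c \<in> over D" and d: "d \<in> over D" and ne: "c \<noteq> d"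
  obtain s t s' t' where st: "c = (s, t)" "d = (s', t')" by (cases c; cases d)
  have dp: "(s, t) \<in> double_points I D" "(t, s) \<in> double_points I D"
    "(s', t') \<in> double_points I D" "(t', s') \<in> double_points I D"
    using c d over(1) sym by (auto simp: st)
  have "s \<noteq> s'" using unique[OF dp(1), of t'] dp(3) ne st by auto
  moreover have "s \<noteq> t'" using unique[OF dp(1), of s'] dp(4) asym[of s t] c d st by auto
  moreover have "t \<noteq> s'" using unique[OF dp(2), of t'] dp(3) asym[of s t] c d st by auto
  moreover have "t \<noteq> t'" using unique[OF dp(2), of s'] dp(4) ne st by auto
  ultimately show "fst c \<noteq> fst d" "fst c \<noteq> snd d" "snd c \<noteq> fst d" "snd c \<noteq> snd d"
    unfolding st by simp_all
qed

definition gauss :: "real set \<Rightarrow> diagram \<Rightarrow> gauss" where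
  "gauss I D = (over D, crossing_sign I D)"

text \<open>Supplies the existence half of the definite descriptions defining the invariants. A time
  is sent to its rank among all crossing times, a number starting at 1.\<close>

lemma surface_realization_exists:
  assumes "generic_diagram UNIV D"
  obtains S f where "surface_realization D S f"
proof -
  let ?T = "chord_ends (over D)"
  define f where "f t = card {u \<in> ?T. u \<le> t}" for t
  have C: "chord_diagram (over D)" using generic_chord_diagram[OF assms] .
  have fin: "finite ?T" using chord_diagram_finite[OF C] by (simp add: chord_ends_def)
  have mono: "strict_mono_on ?T f" and img: "f ` ?T = {1..card ?T}"
    using strict_mono_on_rank[OF fin] unfolding f_def by auto
  have inj: "inj_on f ?T" using strict_mono_on_imp_inj_on[OF mono] .
  \<comment> \<open>The signs are carried from times to visits through the inverse of the
    ranking.\<close>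
  define \<epsilon> where "\<epsilon> c = crossing_sign UNIV D (map_prod (the_inv_into ?T f) (the_inv_into ?T f) c)" for c
  have \<epsilon>: "\<epsilon> (map_prod f f c) = crossing_sign UNIV D c" if "c \<in> over D" for c
    using the_inv_into_f_f[OF inj chord_ends_fst[OF that]] the_inv_into_f_f[OF inj chord_ends_snd[OF that]]
    by (cases c) (simp add: \<epsilon>_def)
  obtain S where S: "closed_curve_diagram S" "s_over S = map_prod f f ` over D"
      "\<And>c. c \<in> map_prod f f ` over D \<Longrightarrow> s_sign S c = \<epsilon> c"
  proof (rule realize_chord_diagram)
    show "chord_diagram (map_prod f f ` over D)" by (rule chord_diagram_image[OF C inj])
    show "chord_ends (map_prod f f ` over D) = {1..card ?T}" by (simp add: chord_ends_map img)
    show "\<epsilon> c = 1 \<or> \<epsilon> c = - 1" if "c \<in> map_prod f f ` over D" for c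
      by (simp add: \<epsilon>_def crossing_sign_def)
  qed blast
  have "surface_realization D S f"
    unfolding surface_realization_def using S mono \<epsilon>
    by (auto simp: crossing_times_def chord_ends_def)
  then show thesis by (rule that)
qed

locale realization =
  fixes D S f
  assumes real: "surface_realization D S f" and chord: "chord_diagram (over D)"
begin

abbreviation "csign \<equiv> crossing_sign UNIV D"
abbreviation "visits \<equiv> map_prod f f"

sublocale closed_curve S
  using real by unfold_locales (simp add: surface_realization_def)

lemma over_eq: "s_over S = visits ` over D"
  using real by (simp add: surface_realization_def)

lemma pairing_lift:
  assumes "c \<in> over D" "d \<in> over D"
  shows "pairing (s_over S) (s_sign S) (chord_arc (visits c)) (chord_arc (visits d)) =
      pairing (over D) csign (chord_arc c) (chord_arc d)"
    "pairing (s_over S) (s_sign S) (chord_arc (visits c)) core = 4 * index (over D) csign c"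
proof -
  have mono: "strict_mono_on (chord_ends (over D)) f" and csign: "\<And>c. c \<in> over D \<Longrightarrow> s_sign S (visits c) = csign c"
    using real by (auto simp: surface_realization_def crossing_times_def chord_ends_def)
  show "pairing (s_over S) (s_sign S) (chord_arc (visits c)) (chord_arc (visits d)) =
      pairing (over D) csign (chord_arc c) (chord_arc d)"
    "pairing (s_over S) (s_sign S) (chord_arc (visits c)) core = 4 * index (over D) csign c"
    unfolding over_eq pairing_core_eq_index[OF chord assms(1), symmetric]
    by (rule pairing_chord_arc_image[OF mono order_refl]; use csign assms in simp)+
qed

text \<open>All exponents become functions of chord data of the plane diagram, so they do not depend
  on the surface. The last equation holds because an arc pairs to 0 with itself.\<close>

lemma intersections:
  assumes "c \<in> over D" "d \<in> over D"
  shows "intersection_number S (alpha_cycle S (visits c)) (alpha_cycle S (visits d)) =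
      pairing (over D) csign (chord_arc c) (chord_arc d) div 4"
    "intersection_number S (alpha_cycle S (visits c)) (beta_cycle S (visits d)) =
      (4 * index (over D) csign c - pairing (over D) csign (chord_arc c) (chord_arc d)) div 4"
    "intersection_number S (beta_cycle S (visits c)) (beta_cycle S (visits d)) =
      (4 * index (over D) csign d - 4 * index (over D) csign c + pairing (over D) csign (chord_arc c) (chord_arc d)) div 4"
    "intersection_number S (alpha_cycle S (visits c)) (beta_cycle S (visits c)) = index (over D) csign c"
proof -
  have "visits c \<in> s_over S" "visits d \<in> s_over S" using assms by (simp_all add: over_eq)
  then show "intersection_number S (alpha_cycle S (visits c)) (alpha_cycle S (visits d)) =
      pairing (over D) csign (chord_arc c) (chord_arc d) div 4"
    "intersection_number S (alpha_cycle S (visits c)) (beta_cycle S (visits d)) =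
      (4 * index (over D) csign c - pairing (over D) csign (chord_arc c) (chord_arc d)) div 4"
    "intersection_number S (beta_cycle S (visits c)) (beta_cycle S (visits d)) =
      (4 * index (over D) csign d - 4 * index (over D) csign c + pairing (over D) csign (chord_arc c) (chord_arc d)) div 4"
    "intersection_number S (alpha_cycle S (visits c)) (beta_cycle S (visits c)) = index (over D) csign c"
    using assms by (simp_all add: intersection_number_cycles pairing_lift)
qed

end

section \<open>Crossing signs under diffeomorphisms and reparametrisations\<close>

lemma det2_linear:
  assumes "linear L"
  shows "det2 (L u) (L v) = det2 (L 1) (L \<i>) * det2 u v"
proof -
  interpret linear L by fact
  have L: "L w = Re w *\<^sub>R L 1 + Im w *\<^sub>R L \<i>" for w
  proof -
    have "w = Re w *\<^sub>R 1 + Im w *\<^sub>R \<i>" by (simp add: complex_eq_iff)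
    then have "L w = L (Re w *\<^sub>R 1 + Im w *\<^sub>R \<i>)" by simp
    then show ?thesis by (simp add: add scale)
  qed
  show ?thesis by (subst L[of u], subst L[of v]) (simp add: det2_def algebra_simps)
qed

lemma det2_scaleR: "det2 (c *\<^sub>R u) (d *\<^sub>R v) = c * d * det2 u v"
  by (simp add: det2_def algebra_simps)

lemma oriented_diffeoE:
  assumes "oriented_diffeo \<phi>"
  obtains \<phi>' where "\<And>z. (\<phi> has_derivative \<phi>' z) (at z)"
    "\<And>z u v. \<exists>d>0. det2 (\<phi>' z u) (\<phi>' z v) = d * det2 u v" "inj \<phi>"
proof -
  obtain \<phi>' where \<phi>': "\<And>z. (\<phi> has_derivative \<phi>' z) (at z)" "\<And>z. det2 (\<phi>' z 1) (\<phi>' z \<i>) > 0" "bij \<phi>"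
    using assms unfolding oriented_diffeo_def by blast
  have "\<exists>d>0. det2 (\<phi>' z u) (\<phi>' z v) = d * det2 u v" for z u v
    using \<phi>'(2)[of z] det2_linear[OF has_derivative_linear[OF \<phi>'(1)[of z]], of u v] by blast
  then show thesis using that \<phi>' bij_is_inj by blast
qed

lemma velocity:
  assumes "generic_diagram I D" "t \<in> I"
  shows "(curve D has_vector_derivative velocity I D t) (at t within I)"
proof -
  obtain \<gamma>' where "(curve D has_vector_derivative \<gamma>') (at t within I)"
    using assms unfolding generic_diagram_def C1_immersion_on_def by blast
  then have "curve D differentiable (at t within I)"
    by (auto simp: differentiable_def has_vector_derivative_def)
  then show ?thesis unfolding velocity_def using vector_derivative_works by blast
qed

text \<open>By the chain rule, velocities correspond up to positive factors under the derivative of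
  \<open>h\<close>, whose determinant is positive. With two reparametrisations the lemma serves
  isotopies, where \<open>\<sigma>\<close> is the identity, and inserted pieces, where
  \<open>\<tau>\<close> is.\<close>

lemma crossing_sign_transport:
  assumes X: "generic_diagram I X" and E: "generic_diagram J E"
    and P: "\<And>t. t \<in> P \<Longrightarrow> at t within P \<noteq> bot"
    and \<sigma>: "increasing_reparam P \<sigma>" "\<sigma> ` P \<subseteq> I" and \<tau>: "increasing_reparam P \<tau>" "\<tau> ` P \<subseteq> J"
    and h: "oriented_diffeo h" and eq: "\<And>t. t \<in> P \<Longrightarrow> curve X (\<sigma> t) = h (curve E (\<tau> t))"
    and st: "s \<in> P" "t \<in> P" "curve E (\<tau> s) = curve E (\<tau> t)"
  shows "crossing_sign I X (\<sigma> s, \<sigma> t) = crossing_sign J E (\<tau> s, \<tau> t)"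
proof -
  obtain h' where h': "\<And>z. (h has_derivative h' z) (at z)"
    "\<And>z u v. \<exists>d>0. det2 (h' z u) (h' z v) = d * det2 u v"
    using oriented_diffeoE[OF h] by metis
  have *: "\<exists>c d. c > 0 \<and> d > 0 \<and> c *\<^sub>R velocity I X (\<sigma> u) = h' (curve E (\<tau> u)) (d *\<^sub>R velocity J E (\<tau> u))"
    if u: "u \<in> P" for u
  proof -
    obtain c where c: "c > 0" "(\<sigma> has_real_derivative c) (at u within P)"
      using \<sigma>(1) u unfolding increasing_reparam_def by blast
    obtain d where d: "d > 0" "(\<tau> has_real_derivative d) (at u within P)"
      using \<tau>(1) u unfolding increasing_reparam_def by blast
    have "(curve X has_vector_derivative velocity I X (\<sigma> u)) (at (\<sigma> u) within \<sigma> ` P)"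
      using velocity[OF X] \<sigma>(2) u has_vector_derivative_within_subset by blast
    then have "((curve X \<circ> \<sigma>) has_vector_derivative c *\<^sub>R velocity I X (\<sigma> u)) (at u within P)"
      using vector_diff_chain_within[of \<sigma> c u P "curve X"] c(2)
      by (simp add: has_real_derivative_iff_has_vector_derivative)
    moreover have "(curve E has_vector_derivative velocity J E (\<tau> u)) (at (\<tau> u) within \<tau> ` P)"
      using velocity[OF E] \<tau>(2) u has_vector_derivative_within_subset by blast
    then have "((curve E \<circ> \<tau>) has_vector_derivative d *\<^sub>R velocity J E (\<tau> u)) (at u within P)"
      using vector_diff_chain_within[of \<tau> d u P "curve E"] d(2)
      by (simp add: has_real_derivative_iff_has_vector_derivative)
    then have "((h \<circ> (curve E \<circ> \<tau>)) has_vector_derivative h' (curve E (\<tau> u)) (d *\<^sub>R velocity J E (\<tau> u))) (at u within P)"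
      by (rule vector_derivative_diff_chain_within) (simp add: has_derivative_at_withinI h'(1))
    then have "((curve X \<circ> \<sigma>) has_vector_derivative h' (curve E (\<tau> u)) (d *\<^sub>R velocity J E (\<tau> u))) (at u within P)"
      by (rule has_vector_derivative_transform[OF u, rotated]) (simp add: eq)
    ultimately show ?thesis
      using vector_derivative_unique_within[OF P[OF u]] c(1) d(1) by blast
  qed
  obtain c d where cd: "c > 0" "d > 0" "c *\<^sub>R velocity I X (\<sigma> s) = h' (curve E (\<tau> s)) (d *\<^sub>R velocity J E (\<tau> s))"
    using *[OF st(1)] by blast
  \<comment> \<open>The two paths meet at the same point, so both velocities are transported by one
    and the same linear map.\<close>
  obtain c' d' where cd': "c' > 0" "d' > 0" "c' *\<^sub>R velocity I X (\<sigma> t) = h' (curve E (\<tau> s)) (d' *\<^sub>R velocity J E (\<tau> t))"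
    using *[OF st(2)] unfolding st(3) by blast
  obtain e where e: "e > 0" "det2 (h' (curve E (\<tau> s)) (d *\<^sub>R velocity J E (\<tau> s))) (h' (curve E (\<tau> s)) (d' *\<^sub>R velocity J E (\<tau> t)))
      = e * det2 (d *\<^sub>R velocity J E (\<tau> s)) (d' *\<^sub>R velocity J E (\<tau> t))"
    using h'(2) by blast
  have "c * c' * det2 (velocity I X (\<sigma> s)) (velocity I X (\<sigma> t)) =
      e * (d * d') * det2 (velocity J E (\<tau> s)) (velocity J E (\<tau> t))"
    using e(2) unfolding cd(3)[symmetric] cd'(3)[symmetric] det2_scaleR by simp
  moreover have "c * c' > 0" "e * (d * d') > 0" using cd cd' e by simp_all
  ultimately have "det2 (velocity I X (\<sigma> s)) (velocity I X (\<sigma> t)) > 0 \<longleftrightarrow>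
      det2 (velocity J E (\<tau> s)) (velocity J E (\<tau> t)) > 0"
    by (metis zero_less_mult_pos zero_less_mult_iff)
  then show ?thesis by (simp add: crossing_sign_def)
qed

lemma increasing_reparam_id: "increasing_reparam I (\<lambda>t. t)"
  unfolding increasing_reparam_def
  by (auto intro!: strict_mono_onI exI[of _ 1] DERIV_ident simp del: DERIV_ident)

lemma over_double_points:
  assumes "generic_diagram I D" "c \<in> over D"
  shows "fst c \<in> I" "snd c \<in> I" "fst c \<noteq> snd c" "curve D (fst c) = curve D (snd c)"
proof -
  have "c \<in> double_points I D" using assms by (auto simp: generic_diagram_def)
  then show "fst c \<in> I" "snd c \<in> I" "fst c \<noteq> snd c" "curve D (fst c) = curve D (snd c)"
    by (auto simp: double_points_def)
qed

lemma chord_ends_over_subset: "generic_diagram I D \<Longrightarrow> chord_ends (over D) \<subseteq> I"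
  using over_double_points by (auto simp: chord_ends_def)

lemma isotopy_step:
  assumes D: "generic_diagram I D" "generic_diagram I D'" and iso: "isotopic_via I \<phi> D D'"
    and perfect: "\<And>t. t \<in> I \<Longrightarrow> at t within I \<noteq> bot"
    and \<kappa>: "\<And>\<rho> t. increasing_reparam I \<rho> \<Longrightarrow> bij_betw \<rho> I I \<Longrightarrow> t \<in> I \<Longrightarrow> \<kappa> (\<rho> t) = \<kappa> t"
  shows "gauss_step \<kappa> (gauss I D') (gauss I D)"
proof -
  obtain \<rho> where \<phi>: "oriented_diffeo \<phi>" and \<rho>: "increasing_reparam I \<rho>" "bij_betw \<rho> I I"
    and curve: "\<And>t. t \<in> I \<Longrightarrow> curve D' t = \<phi> (curve D (\<rho> t))"
    and over: "over D' = {(s, t). s \<in> I \<and> t \<in> I \<and> (\<rho> s, \<rho> t) \<in> over D}"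
    using iso unfolding isotopic_via_def by blast
  have ends: "chord_ends (over D') \<subseteq> I" by (rule chord_ends_over_subset[OF D(2)])
  have "over D \<subseteq> map_prod \<rho> \<rho> ` over D'"
  proof
    fix c assume c: "c \<in> over D"
    obtain s t where "s \<in> I" "\<rho> s = fst c" "t \<in> I" "\<rho> t = snd c"
      using over_double_points(1,2)[OF D(1) c] \<rho>(2) unfolding bij_betw_def by (metis imageE)
    then have "(s, t) \<in> over D'" "c = map_prod \<rho> \<rho> (s, t)" using c by (auto simp: over)
    then show "c \<in> map_prod \<rho> \<rho> ` over D'" by blast
  qed
  then have over_D: "over D = map_prod \<rho> \<rho> ` over D'" by (auto simp: over)
  show ?thesis unfolding gauss_def over_D
  proof (rule order_iso_step)
    show "strict_mono_on (chord_ends (over D')) \<rho>"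
      using \<rho>(1) ends unfolding increasing_reparam_def by (meson monotone_on_subset)
    show "\<kappa> (\<rho> t) = \<kappa> t" if "t \<in> chord_ends (over D')" for t using \<kappa>[OF \<rho>] ends that by blast
    show "crossing_sign I D (map_prod \<rho> \<rho> c) = crossing_sign I D' c" if c: "c \<in> over D'" for c
    proof -
      obtain s t where st: "c = (s, t)" by (cases c)
      have "s \<in> I" "t \<in> I" "(\<rho> s, \<rho> t) \<in> over D" using c by (auto simp: over st)
      then have "crossing_sign I D' (s, t) = crossing_sign I D (\<rho> s, \<rho> t)"
        using over_double_points(4)[OF D(1), of "(\<rho> s, \<rho> t)"] \<rho>(2)
        by (intro crossing_sign_transport[OF D(2,1) perfect increasing_reparam_id _ \<rho>(1) _ \<phi> curve])
          (auto simp: bij_betw_def)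
      then show ?thesis by (simp add: st)
    qed
  qed
qed

section \<open>The strands inside the disk of a local change\<close>

lemma inj_interval_mono:
  fixes \<rho> :: "real \<Rightarrow> real"
  assumes bij: "bij_betw \<rho> {a..b} {-1..1}" and "a < b"
    and deriv: "\<And>t. t \<in> {a..b} \<Longrightarrow> \<exists>d. d \<noteq> 0 \<and> (\<rho> has_real_derivative d) (at t within {a..b})"
  shows "\<exists>s\<in>{-1, 1 :: real}. (\<forall>t\<in>{a..b}. \<forall>u\<in>{a..b}. t < u \<longleftrightarrow> s * \<rho> t < s * \<rho> u) \<and>
    (\<forall>t\<in>{a<..<b}. \<exists>d. (\<rho> has_real_derivative s * d) (at t within {a..b}) \<and> d > 0)"
proof -
  have cont: "continuous_on {a..b} \<rho>"
    using deriv unfolding continuous_on_eq_continuous_within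
    by (meson DERIV_continuous)
  have inj: "inj_on \<rho> {a..b}" using bij by (simp add: bij_betw_def)
  have mono: "strict_mono_on {a..b} (\<lambda>t. s * \<rho> t)"
    if s: "s = (if \<rho> a < \<rho> b then 1 else -1)" for s :: real
  proof (rule strict_mono_onI)
    have ab: "\<rho> a \<noteq> \<rho> b" using inj_onD[OF inj, of a b] \<open>a < b\<close> by auto
    \<comment> \<open>Continuity and injectivity compare an interior point with the two ends of an
      interval. Two interior points are compared by applying the same principle again on a shorter
      interval.\<close>
    have mid: "s * \<rho> a < s * \<rho> x \<and> s * \<rho> x < s * \<rho> b" if "a < x" "x < b" for x
      using continuous_inj_imp_mono[OF that cont inj] ab s by (auto split: if_splits)
    fix x y assume xy: "x \<in> {a..b}" "y \<in> {a..b}" "x < y"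
    show "s * \<rho> x < s * \<rho> y"
    proof (cases "x = a")
      case True
      then show ?thesis using mid[of y] xy ab s by (cases "y = b") auto
    next
      case False
      show ?thesis
      proof (cases "y = b")
        case True
        then show ?thesis using mid[of x] xy False by auto
      next
        case y: False
        have "a < y" "y < b" "a < x" "x < b" using xy False y by auto
        have sub: "{a..y} \<subseteq> {a..b}" using xy by auto
        have "(\<rho> a < \<rho> x \<and> \<rho> x < \<rho> y) \<or> (\<rho> y < \<rho> x \<and> \<rho> x < \<rho> a)"
          using continuous_inj_imp_mono[OF \<open>a < x\<close> xy(3) continuous_on_subset[OF cont sub] inj_on_subset[OF inj sub]] .
        then show ?thesis using mid[OF \<open>a < y\<close> \<open>y < b\<close>] mid[OF \<open>a < x\<close> \<open>x < b\<close>] s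
          by (auto split: if_splits)
      qed
    qed
  qed
  define s :: real where "s = (if \<rho> a < \<rho> b then 1 else -1)"
  have s: "s \<in> {-1, 1}" "s * s = 1" by (auto simp: s_def)
  note smono = mono[OF s_def]
  have "\<exists>d. (\<rho> has_real_derivative s * d) (at t within {a..b}) \<and> d > 0" if t: "t \<in> {a<..<b}" for t
  proof -
    obtain d where d: "d \<noteq> 0" "(\<rho> has_real_derivative d) (at t within {a..b})"
      using deriv[of t] t by auto
    have at: "at t within {a..b} = at t" using t by (intro at_within_Icc_at) auto
    have "((\<lambda>t. s * \<rho> t) has_real_derivative s * d) (at t)"
      using DERIV_cmult[OF d(2)] unfolding at .
    then have "s * d \<ge> 0"
      using t by (intro mono_on_imp_deriv_nonneg[OF strict_mono_on_imp_mono_on[OF smono]]) auto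
    moreover have "s * d \<noteq> 0" using d(1) s(1) by auto
    ultimately have "s * d > 0" by linarith
    moreover have eq: "s * (s * d) = d" using s(2) by (metis mult.assoc mult_1)
    have "(\<rho> has_real_derivative s * (s * d)) (at t within {a..b})" unfolding eq by (rule d(2))
    ultimately show ?thesis by blast
  qed
  moreover have "t < u \<longleftrightarrow> s * \<rho> t < s * \<rho> u" if "t \<in> {a..b}" "u \<in> {a..b}" for t u
    using strict_mono_on_less[OF smono that] by simp
  ultimately show ?thesis using s(1) by blast
qed

text \<open>One side of a local change; \<open>s k\<close> is the direction in which strand \<open>k\<close> is traversed.\<close>

locale strands =
  fixes I :: "real set" and n :: nat and m mv :: "nat \<Rightarrow> real \<Rightarrow> complex" and \<phi> :: "complex \<Rightarrow> complex"
    and a b :: "nat \<Rightarrow> real" and \<rho> :: "nat \<Rightarrow> real \<Rightarrow> real" and s :: "nat \<Rightarrow> real" and D :: diagram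
  assumes generic: "generic_diagram I D" and diffeo: "oriented_diffeo \<phi>"
    and ab: "k < n \<Longrightarrow> a k < b k" and sub: "k < n \<Longrightarrow> {a k..b k} \<subseteq> I"
    and bij: "k < n \<Longrightarrow> bij_betw (\<rho> k) {a k..b k} {-1..1}"
    and s: "k < n \<Longrightarrow> s k = 1 \<or> s k = - 1"
    and mono: "k < n \<Longrightarrow> t \<in> {a k..b k} \<Longrightarrow> u \<in> {a k..b k} \<Longrightarrow> t < u \<longleftrightarrow> s k * \<rho> k t < s k * \<rho> k u"
    and deriv: "k < n \<Longrightarrow> t \<in> {a k<..<b k} \<Longrightarrow> \<exists>d>0. (\<rho> k has_real_derivative s k * d) (at t within {a k..b k})"
    and curve: "k < n \<Longrightarrow> t \<in> {a k..b k} \<Longrightarrow> curve D t = \<phi> (m k (\<rho> k t))"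
    and disjoint: "k < n \<Longrightarrow> l < n \<Longrightarrow> k \<noteq> l \<Longrightarrow> {a k..b k} \<inter> {a l..b l} = {}"
    and outside: "t \<in> I - (\<Union>k<n. {a k..b k}) \<Longrightarrow> curve D t \<notin> \<phi> ` box2"
    and model: "k < n \<Longrightarrow> (m k has_vector_derivative mv k x) (at x)"
    and box: "k < n \<Longrightarrow> x \<in> {-1..1} \<Longrightarrow> m k x \<in> box2"
begin

abbreviation "U \<equiv> (\<Union>k<n. {a k..b k})"

text \<open>The moment at which strand \<open>k\<close> is at parameter \<open>x\<close> of the
  model. Both sides of a move share the same times.\<close>

definition time :: "nat \<Rightarrow> real \<Rightarrow> real" where
  "time k = the_inv_into {a k..b k} (\<rho> k)"

lemma time:
  assumes "k < n" "x \<in> {-1..1}"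
  shows "time k x \<in> {a k..b k}" "\<rho> k (time k x) = x"
  using assms bij[OF assms(1)] f_the_inv_into_f_bij_betw[OF bij[OF assms(1)]]
    the_inv_into_into[of "\<rho> k" "{a k..b k}" x "{a k..b k}"]
  by (auto simp: time_def bij_betw_def simp del: atLeastAtMost_iff)

lemma \<rho>_range: "k < n \<Longrightarrow> t \<in> {a k..b k} \<Longrightarrow> \<rho> k t \<in> {-1..1}"
  using bij by (meson bij_betw_apply)

lemma time_\<rho>: "k < n \<Longrightarrow> t \<in> {a k..b k} \<Longrightarrow> time k (\<rho> k t) = t"
  using bij by (simp add: time_def bij_betw_def the_inv_into_f_f)

lemma time_less:
  assumes "k < n" "x \<in> {-1..1}" "y \<in> {-1..1}"
  shows "time k x < time k y \<longleftrightarrow> s k * x < s k * y"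
  using mono[OF assms(1) time(1)[OF assms(1,2)] time(1)[OF assms(1,3)]] time(2) assms by simp

lemma time_eq: "k < n \<Longrightarrow> x \<in> {-1..1} \<Longrightarrow> y \<in> {-1..1} \<Longrightarrow> time k x = time k y \<longleftrightarrow> x = y"
  using time(2) by metis

lemma time_interior:
  assumes "k < n" "x \<in> {-1<..<1}"
  shows "time k x \<in> {a k<..<b k}"
proof -
  have x: "x \<in> {-1..1}" using assms(2) by auto
  have "\<exists>y\<in>{-1..1}. s k * y < s k * x" "\<exists>y\<in>{-1..1}. s k * x < s k * y"
    using s[OF assms(1)] assms(2) by (auto intro: bexI[of _ 1] bexI[of _ "-1"])
  then have "\<exists>t\<in>{a k..b k}. t < time k x" "\<exists>t\<in>{a k..b k}. time k x < t"
    using time_less[OF assms(1)] x time(1)[OF assms(1)] by metis+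
  then show ?thesis using time(1)[OF assms(1) x] by auto
qed

lemma strand_unique: "k < n \<Longrightarrow> l < n \<Longrightarrow> t \<in> {a k..b k} \<Longrightarrow> t \<in> {a l..b l} \<Longrightarrow> k = l"
  using disjoint by blast

lemma inside:
  assumes "t \<in> I" "curve D t = curve D u" "u \<in> U"
  shows "t \<in> U"
proof (rule ccontr)
  assume "t \<notin> U"
  obtain k where k: "k < n" "u \<in> {a k..b k}" using assms(3) by blast
  then have "curve D u \<in> \<phi> ` box2" using curve[OF k] box[OF k(1) \<rho>_range[OF k]] by simp
  then show False using outside[of t] assms(1,2) \<open>t \<notin> U\<close> by auto
qed

text \<open>Outside the times \<open>U\<close> the curve avoids the disk, and during
  \<open>U\<close> it stays in it, so no crossing has exactly one of its two times in
  \<open>U\<close>.\<close>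

lemma over_inside:
  assumes "c \<in> over D"
  shows "fst c \<in> U \<longleftrightarrow> snd c \<in> U"
  using over_double_points[OF generic assms] inside by metis

text \<open>As \<open>\<phi>\<close> is injective, crossings in the disk come from double points of
  the model picture, where they can be computed.\<close>

lemma over_strands:
  assumes c: "c \<in> over D" and "fst c \<in> U"
  obtains k l x y where "k < n" "l < n" "x \<in> {-1..1}" "y \<in> {-1..1}" "c = (time k x, time l y)" "m k x = m l y"
    "(k, x) \<noteq> (l, y)"
proof -
  note dp = over_double_points[OF generic c]
  have "snd c \<in> U" using over_inside[OF c] assms(2) by simp
  then obtain k l where kl: "k < n" "fst c \<in> {a k..b k}" "l < n" "snd c \<in> {a l..b l}"
    using assms(2) by blast
  have "inj \<phi>" using oriented_diffeoE[OF diffeo] by metis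
  then have "m k (\<rho> k (fst c)) = m l (\<rho> l (snd c))"
    using dp(4) curve[OF kl(1,2)] curve[OF kl(3,4)] by (auto dest: injD)
  moreover have "c = (time k (\<rho> k (fst c)), time l (\<rho> l (snd c)))"
    using time_\<rho>[OF kl(1,2)] time_\<rho>[OF kl(3,4)] by simp
  moreover have "(k, \<rho> k (fst c)) \<noteq> (l, \<rho> l (snd c))"
    using dp(3) time_\<rho>[OF kl(1,2)] time_\<rho>[OF kl(3,4)] by (metis prod.inject)
  ultimately show thesis using that kl \<rho>_range[OF kl(1,2)] \<rho>_range[OF kl(3,4)] by blast
qed

lemma model_double_points:
  assumes "k < n" "l < n" "x \<in> {-1..1}" "y \<in> {-1..1}" "m k x = m l y" "(k, x) \<noteq> (l, y)"
  shows "(time k x, time l y) \<in> double_points I D"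
proof -
  note tx = time[OF assms(1,3)] and ty = time[OF assms(2,4)]
  have "time k x \<noteq> time l y"
    using strand_unique[OF assms(1,2) tx(1)] tx ty assms(6) by metis
  then show ?thesis
    using sub[OF assms(1)] sub[OF assms(2)] tx ty curve[OF assms(1) tx(1)] curve[OF assms(2) ty(1)] assms(5)
    by (auto simp: double_points_def)
qed

lemma velocity_strand:
  assumes k: "k < n" and x: "x \<in> {-1<..<1}" and \<phi>': "\<And>z. (\<phi> has_derivative \<phi>' z) (at z)"
  shows "\<exists>d>0. velocity I D (time k x) = \<phi>' (m k x) ((s k * d) *\<^sub>R mv k x)"
proof -
  let ?t = "time k x" and ?J = "{a k..b k}"
  have t: "?t \<in> ?J" "?t \<in> {a k<..<b k}" "\<rho> k ?t = x"
    using time_interior[OF k x] time[OF k] x by auto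
  obtain d where d: "d > 0" "(\<rho> k has_real_derivative s k * d) (at ?t within ?J)"
    using deriv[OF k t(2)] by blast
  have "((m k \<circ> \<rho> k) has_vector_derivative (s k * d) *\<^sub>R mv k x) (at ?t within ?J)"
    using vector_diff_chain_within[of "\<rho> k" "s k * d" ?t ?J "m k" "mv k x"] d(2)
      has_vector_derivative_at_within[OF model[OF k, of x]]
    by (simp add: has_real_derivative_iff_has_vector_derivative t(3))
  then have "((\<phi> \<circ> (m k \<circ> \<rho> k)) has_vector_derivative \<phi>' (m k x) ((s k * d) *\<^sub>R mv k x)) (at ?t within ?J)"
    by (rule vector_derivative_diff_chain_within) (simp add: has_derivative_at_withinI \<phi>' t(3))
  then have "(curve D has_vector_derivative \<phi>' (m k x) ((s k * d) *\<^sub>R mv k x)) (at ?t within ?J)"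
    by (rule has_vector_derivative_transform[OF t(1), rotated]) (simp add: curve[OF k])
  moreover have "(curve D has_vector_derivative velocity I D ?t) (at ?t within ?J)"
    using velocity[OF generic, of ?t] sub[OF k] t(1) has_vector_derivative_within_subset by blast
  moreover have "at ?t within ?J \<noteq> bot" using ab[OF k] t(1) by (simp add: trivial_limit_within)
  ultimately have "velocity I D ?t = \<phi>' (m k x) ((s k * d) *\<^sub>R mv k x)"
    using vector_derivative_unique_within by blast
  then show ?thesis using d(1) by blast
qed

text \<open>The diffeomorphism preserves orientation; reversing one strand changes the sign, which
  is recorded by \<open>s k * s l\<close>.\<close>

lemma crossing_sign_strands:
  assumes kl: "k < n" "l < n" and x: "x \<in> {-1<..<1}" and y: "y \<in> {-1<..<1}" and eq: "m k x = m l y"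
  shows "crossing_sign I D (time k x, time l y) = (if s k * s l * det2 (mv k x) (mv l y) > 0 then 1 else - 1)"
proof -
  obtain \<phi>' where \<phi>': "\<And>z. (\<phi> has_derivative \<phi>' z) (at z)" "\<And>z u v. \<exists>d>0. det2 (\<phi>' z u) (\<phi>' z v) = d * det2 u v"
    using oriented_diffeoE[OF diffeo] by metis
  obtain d where d: "d > 0" "velocity I D (time k x) = \<phi>' (m k x) ((s k * d) *\<^sub>R mv k x)"
    using velocity_strand[OF kl(1) x \<phi>'(1)] by blast
  obtain e where e: "e > 0" "velocity I D (time l y) = \<phi>' (m k x) ((s l * e) *\<^sub>R mv l y)"
    using velocity_strand[OF kl(2) y \<phi>'(1)] unfolding eq by blast
  obtain f where f: "f > 0" "det2 (\<phi>' (m k x) ((s k * d) *\<^sub>R mv k x)) (\<phi>' (m k x) ((s l * e) *\<^sub>R mv l y)) =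
      f * det2 ((s k * d) *\<^sub>R mv k x) ((s l * e) *\<^sub>R mv l y)"
    using \<phi>'(2) by blast
  have "det2 (velocity I D (time k x)) (velocity I D (time l y)) = (f * d * e) * (s k * s l * det2 (mv k x) (mv l y))"
    unfolding d(2) e(2) f(2) det2_scaleR by simp
  moreover have "f * d * e > 0" using d e f by simp
  moreover have "0 < p * q \<longleftrightarrow> 0 < q" if "0 < p" for p q :: real using that by (simp add: zero_less_mult_iff)
  ultimately show ?thesis by (simp only: crossing_sign_def fst_conv snd_conv)
qed

lemma time_same_side:
  assumes "t \<notin> U" "k < n" "x \<in> {-1..1}" "y \<in> {-1..1}"
  shows "t < time k x \<longleftrightarrow> t < time k y"
proof -
  have "t < a k \<or> b k < t" using assms(1,2) by (auto simp: not_le)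
  then show ?thesis using time(1)[OF assms(2,3)] time(1)[OF assms(2,4)] by auto
qed

lemma strands_apart:
  assumes "k < n" "l < n" "k \<noteq> l" "t \<in> {a k..b k}" "u \<in> {a l..b l}"
  shows "t < u \<longleftrightarrow> a k < a l"
proof -
  \<comment> \<open>If the intervals overlapped, the larger of the left end points would be a common
    point.\<close>
  have "max (a k) (a l) \<notin> {a k..b k} \<inter> {a l..b l}" using disjoint[OF assms(1-3)] by simp
  then have "b k < a l \<or> b l < a k"
    using ab[OF assms(1)] ab[OF assms(2)] by (auto simp: max_def split: if_splits)
  then show ?thesis using assms(4,5) ab[OF assms(1)] ab[OF assms(2)] by auto
qed

lemma \<kappa>_strand:
  assumes \<kappa>: "\<And>a b. a \<le> b \<Longrightarrow> {a..b} \<subseteq> I \<Longrightarrow> \<kappa> a = \<kappa> b" and k: "k < n" "t \<in> {a k..b k}"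
  shows "\<kappa> t = \<kappa> (a k)"
proof -
  have "{a k..t} \<subseteq> I" using k sub[OF k(1)] by (meson atLeastAtMost_iff atLeastatMost_subset_iff order_refl order_trans)
  then show ?thesis using \<kappa>[of "a k" t] k by simp
qed

end

text \<open>Both sides are described with one choice of directions \<open>s\<close>, because the
  reparametrisations \<open>\<rho>\<close> are shared by the two pictures.\<close>

lemma local_change_strands:
  assumes lc: "local_change I M n m m' \<phi> a b \<rho> D D'" and D: "generic_diagram I D" "generic_diagram I D'"
    and model: "\<And>k x. k < n \<Longrightarrow> (m k has_vector_derivative mv k x) (at x)" "\<And>k x. k < n \<Longrightarrow> x \<in> {-1..1} \<Longrightarrow> m k x \<in> box2"
    and model': "\<And>k x. k < n \<Longrightarrow> (m' k has_vector_derivative mv' k x) (at x)" "\<And>k x. k < n \<Longrightarrow> x \<in> {-1..1} \<Longrightarrow> m' k x \<in> box2"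
  obtains s where "strands I n m mv \<phi> a b \<rho> s D" "strands I n m' mv' \<phi> a b \<rho> s D'"
proof -
  note lc = lc[unfolded local_change_def]
  have 1: "oriented_diffeo \<phi>" using lc by (elim conjE)
  have strand: "a k < b k" "{a k..b k} \<subseteq> I" "bij_betw (\<rho> k) {a k..b k} {-1..1}"
    "\<And>t. t \<in> {a k..b k} \<Longrightarrow> \<exists>d. d \<noteq> 0 \<and> (\<rho> k has_real_derivative d) (at t within {a k..b k})"
    "\<And>t. t \<in> {a k..b k} \<Longrightarrow> curve D t = \<phi> (m k (\<rho> k t)) \<and> curve D' t = \<phi> (m' k (\<rho> k t))" if "k < n" for k
    using lc that by blast+
  have disj: "\<And>k l. k < n \<Longrightarrow> l < n \<Longrightarrow> k \<noteq> l \<Longrightarrow> {a k..b k} \<inter> {a l..b l} = {}"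
    using lc by blast
  have out: "\<And>t. t \<in> I - (\<Union>k<n. {a k..b k}) \<Longrightarrow> curve D' t = curve D t \<and> curve D t \<notin> \<phi> ` box2"
    using lc by blast
  have "\<forall>k<n. \<exists>s\<in>{-1, 1 :: real}. (\<forall>t\<in>{a k..b k}. \<forall>u\<in>{a k..b k}. t < u \<longleftrightarrow> s * \<rho> k t < s * \<rho> k u) \<and>
    (\<forall>t\<in>{a k<..<b k}. \<exists>d. (\<rho> k has_real_derivative s * d) (at t within {a k..b k}) \<and> d > 0)"
    using inj_interval_mono strand(1,3,4) by blast
  then obtain s where s: "\<And>k. k < n \<Longrightarrow> s k \<in> {-1, 1 :: real} \<and>
      (\<forall>t\<in>{a k..b k}. \<forall>u\<in>{a k..b k}. t < u \<longleftrightarrow> s k * \<rho> k t < s k * \<rho> k u) \<and>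
      (\<forall>t\<in>{a k<..<b k}. \<exists>d. (\<rho> k has_real_derivative s k * d) (at t within {a k..b k}) \<and> d > 0)"
    by metis
  have s1: "s k = 1 \<or> s k = - 1" if "k < n" for k using s[OF that] by blast
  have s2: "t < u \<longleftrightarrow> s k * \<rho> k t < s k * \<rho> k u" if "k < n" "t \<in> {a k..b k}" "u \<in> {a k..b k}" for k t u
    using s[OF that(1)] that(2,3) by blast
  have s3: "\<exists>d>0. (\<rho> k has_real_derivative s k * d) (at t within {a k..b k})" if "k < n" "t \<in> {a k<..<b k}" for k t
    using s[OF that(1)] that(2) by blast
  have c: "curve D t = \<phi> (m k (\<rho> k t))" "curve D' t = \<phi> (m' k (\<rho> k t))" if "k < n" "t \<in> {a k..b k}" for k t
    using strand(5)[OF that] by simp_all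
  have o: "curve D t \<notin> \<phi> ` box2" "curve D' t \<notin> \<phi> ` box2" if "t \<in> I - (\<Union>k<n. {a k..b k})" for t
    using out[OF that] by simp_all
  show thesis
  proof (rule that)
    show "strands I n m mv \<phi> a b \<rho> s D"
      by unfold_locales (fact 1 D strand(1-3) s1 s2 s3 c o disj model)+
    show "strands I n m' mv' \<phi> a b \<rho> s D'"
      by unfold_locales (fact 1 D strand(1-3) s1 s2 s3 c o disj model')+
  qed
qed

text \<open>The changed times form a closed set, so around any other time the two curves agree and
  have the same velocity; hence the crossings away from the disk keep their signs.\<close>

lemma local_change_outside:
  assumes lc: "local_change I M n m m' \<phi> a b \<rho> D D'" and D: "generic_diagram I D" "generic_diagram I D'"
  defines "U \<equiv> (\<Union>k<n. {a k..b k})"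
  shows "{c \<in> over D'. fst c \<notin> U} = {c \<in> over D. fst c \<notin> U}"
    and "\<And>c. c \<in> over D \<Longrightarrow> fst c \<notin> U \<Longrightarrow> snd c \<notin> U \<Longrightarrow> crossing_sign I D' c = crossing_sign I D c"
proof -
  note lc = lc[unfolded local_change_def, folded U_def]
  have "(s, t) \<in> over D' \<longleftrightarrow> (s, t) \<in> over D" if "s \<notin> U" for s t
    using lc that by blast
  then show "{c \<in> over D'. fst c \<notin> U} = {c \<in> over D. fst c \<notin> U}" by auto
  have "closed U" by (auto simp: U_def)
  have "velocity I D' t = velocity I D t" if t: "t \<in> I" "t \<notin> U" for t
    unfolding velocity_def
  proof (rule vector_derivative_cong_eq)
    have "\<forall>\<^sub>F x in nhds t. x \<in> - U" using \<open>closed U\<close> t(2) by (intro eventually_nhds_in_open) auto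
    moreover have "\<forall>x\<in>I - U. curve D' x = curve D x" using lc by blast
    ultimately show "\<forall>\<^sub>F x in nhds t. x \<in> I \<longrightarrow> curve D' x = curve D x"
      by (auto elim: eventually_mono)
  qed (use t in auto)
  then show "\<And>c. c \<in> over D \<Longrightarrow> fst c \<notin> U \<Longrightarrow> snd c \<notin> U \<Longrightarrow> crossing_sign I D' c = crossing_sign I D c"
    using over_double_points(1,2)[OF D(1)] by (simp add: crossing_sign_def)
qed

lemma gauss_step_same:
  assumes "over D' = over D" "\<And>c. c \<in> over D \<Longrightarrow> crossing_sign I D' c = crossing_sign I D c"
  shows "gauss_step \<kappa> (gauss I D) (gauss I D')"
  using order_iso_step[of "over D" "\<lambda>t. t" "crossing_sign I D'" "crossing_sign I D" \<kappa>] assms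
  by (simp add: gauss_def map_prod.id[unfolded id_def] strict_mono_on_def)

section \<open>The Reidemeister moves\<close>

definition R1_kink' :: "nat \<Rightarrow> real \<Rightarrow> complex" where
  "R1_kink' k x = Complex (1 - 16 / 9 * ((1 - x\<^sup>2)\<^sup>2 - 4 * x\<^sup>2 * (1 - x\<^sup>2))) (- 2 * x * (1 - x\<^sup>2))"

definition R1_straight' :: "nat \<Rightarrow> real \<Rightarrow> complex" where
  "R1_straight' k x = Complex 1 0"

definition R2_before' :: "nat \<Rightarrow> real \<Rightarrow> complex" where
  "R2_before' k x = Complex 1 (if k = 0 then 0 else 32 / 9 * x * (1 - x\<^sup>2))"

definition R3_before' :: "nat \<Rightarrow> real \<Rightarrow> complex" where
  "R3_before' k x = Complex 1
     (if k = 0 then 1 / 2 else if k = 1 then - 1 / 2 else 16 / 9 * x * (1 - x\<^sup>2))"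

definition R3_after' :: "nat \<Rightarrow> real \<Rightarrow> complex" where
  "R3_after' k x = Complex 1
     (if k = 0 then 1 / 2 else if k = 1 then - 1 / 2 else - (16 / 9) * x * (1 - x\<^sup>2))"

lemma model_derivatives:
  "(R1_kink k has_vector_derivative R1_kink' k x) (at x)"
  "(R1_straight k has_vector_derivative R1_straight' k x) (at x)"
  "(R2_before k has_vector_derivative R2_before' k x) (at x)"
  "(R2_after k has_vector_derivative R1_straight' k x) (at x)"
  "(R3_before k has_vector_derivative R3_before' k x) (at x)"
  "(R3_after k has_vector_derivative R3_after' k x) (at x)"
  unfolding has_vector_derivative_complex_iff R1_kink_def R1_kink'_def R1_straight_def R1_straight'_def
    R2_before_def R2_before'_def R2_after_def R3_before_def R3_before'_def R3_after_def R3_after'_def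
  by (auto intro!: derivative_eq_intros simp: power2_eq_square field_simps)

lemma bump_bounds:
  assumes "x \<in> {-1..1 :: real}"
  shows "0 \<le> (1 - x\<^sup>2)\<^sup>2" "(1 - x\<^sup>2)\<^sup>2 \<le> 1"
proof -
  have "x\<^sup>2 \<le> 1" using assms by (simp add: abs_square_le_1 abs_le_iff)
  then show "(1 - x\<^sup>2)\<^sup>2 \<le> 1" by (intro power_le_one) auto
qed simp

lemma model_boxes:
  assumes "x \<in> {-1..1}"
  shows "R1_kink k x \<in> box2" "R1_straight k x \<in> box2" "R2_before k x \<in> box2" "R2_after k x \<in> box2"
    "R3_before k x \<in> box2" "R3_after k x \<in> box2"
proof -
  note b = bump_bounds[OF assms]
  have x: "\<bar>x\<bar> \<le> 1" using assms by auto
  have "x - 16 / 9 * x * (1 - x\<^sup>2)\<^sup>2 = x * (1 - 16 / 9 * (1 - x\<^sup>2)\<^sup>2)" by (simp add: algebra_simps)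
  moreover have "\<bar>1 - 16 / 9 * (1 - x\<^sup>2)\<^sup>2\<bar> \<le> 1" using b by (simp add: abs_le_iff)
  ultimately have "\<bar>x - 16 / 9 * x * (1 - x\<^sup>2)\<^sup>2\<bar> \<le> 1"
    using mult_mono[OF x, of "\<bar>1 - 16 / 9 * (1 - x\<^sup>2)\<^sup>2\<bar>" 1] by (simp add: abs_mult)
  then show "R1_kink k x \<in> box2" using b by (simp add: R1_kink_def box2_def)
  show "R1_straight k x \<in> box2" "R2_before k x \<in> box2" "R2_after k x \<in> box2"
    "R3_before k x \<in> box2" "R3_after k x \<in> box2"
  proof -
    obtain q where q: "(1 - x\<^sup>2)\<^sup>2 = q" by blast
    have "0 \<le> q" "q \<le> 1" using b unfolding q by auto
    then show "R1_straight k x \<in> box2" "R2_before k x \<in> box2" "R2_after k x \<in> box2"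
      "R3_before k x \<in> box2" "R3_after k x \<in> box2"
      using x unfolding R1_straight_def R2_before_def R2_after_def R3_before_def R3_after_def box2_def q
      by (auto simp: abs_le_iff)
  qed
qed

text \<open>On \<open>[-1, 1]\<close> the second coordinate determines the square of
  \<open>x\<close>, and the first is odd. So a double point has parameters \<open>x\<close> and
  \<open>- x\<close> at which the first coordinate vanishes, and 16/9 is the reciprocal of the
  square of 3/4 = 1 - 1/4.\<close>

lemma R1_kink_double:
  assumes x: "x \<in> {-1..1}" and y: "y \<in> {-1..1}" and "x \<noteq> y" and eq: "R1_kink k x = R1_kink l y"
  shows "x = 1/2 \<and> y = - 1/2 \<or> x = - 1/2 \<and> y = 1/2"
proof -
  have re: "x - 16 / 9 * x * (1 - x\<^sup>2)\<^sup>2 = y - 16 / 9 * y * (1 - y\<^sup>2)\<^sup>2"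
    using eq unfolding R1_kink_def complex.inject by blast
  have im: "(1 - x\<^sup>2)\<^sup>2 = (1 - y\<^sup>2)\<^sup>2"
    using eq by (simp add: R1_kink_def)
  have le: "x\<^sup>2 \<le> 1" "y\<^sup>2 \<le> 1" using x y by (simp_all add: abs_square_le_1 abs_le_iff)
  then have "1 - x\<^sup>2 = 1 - y\<^sup>2" by (intro power2_eq_imp_eq[OF im]) simp_all
  then have "x\<^sup>2 = y\<^sup>2" by simp
  then have yx: "y = - x" using \<open>x \<noteq> y\<close> by (auto simp: power2_eq_iff)
  have "x * (1 - 16 / 9 * (1 - x\<^sup>2)\<^sup>2) = 0" using re unfolding yx by (simp add: algebra_simps)
  moreover have "x \<noteq> 0" using yx \<open>x \<noteq> y\<close> by auto
  ultimately have "(1 - x\<^sup>2)\<^sup>2 = (3/4)\<^sup>2" by (simp add: power2_eq_square)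
  then have "1 - x\<^sup>2 = 3 / 4" using le by (auto simp: power2_eq_iff)
  then have "x\<^sup>2 = (1 / 2)\<^sup>2" by (simp add: power2_eq_square)
  then have "x = 1/2 \<or> x = - (1/2)" by (simp only: power2_eq_iff)
  then show ?thesis using yx by auto
qed

lemma R2_before_cross:
  assumes x: "x \<in> {-1..1}" and kl: "k < 2" "l < 2" and ne: "(k, x) \<noteq> (l, y)"
    and eq: "R2_before k x = R2_before l y"
  shows "y = x \<and> (x = 1/2 \<or> x = - 1/2) \<and> k \<noteq> l"
proof -
  have xy: "y = x" using eq by (simp add: R2_before_def)
  then have "k \<noteq> l" using ne by auto
  then have "k = 0 \<and> l = 1 \<or> k = 1 \<and> l = 0" using kl by auto
  then have "(1 - x\<^sup>2)\<^sup>2 = (3/4)\<^sup>2" using eq xy by (auto simp: R2_before_def power2_eq_square)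
  moreover have "x\<^sup>2 \<le> 1" using x by (simp add: abs_square_le_1 abs_le_iff)
  ultimately have "1 - x\<^sup>2 = 3 / 4" by (auto simp: power2_eq_iff)
  then have "x\<^sup>2 = (1 / 2)\<^sup>2" by (simp add: power2_eq_square)
  then have "x = 1/2 \<or> x = - (1/2)" by (simp only: power2_eq_iff)
  then show ?thesis using xy \<open>k \<noteq> l\<close> by auto
qed

text \<open>A solution is nonnegative; there the bump decreases while the line increases, so they
  meet at most once, at 1/2, where 8/9 times 9/16 is 1/2.\<close>

lemma bump_meets_line:
  assumes "x \<in> {-1..1 :: real}"
  shows "x = 8 / 9 * (1 - x\<^sup>2)\<^sup>2 \<longleftrightarrow> x = 1/2"
proof
  assume eq: "x = 8 / 9 * (1 - x\<^sup>2)\<^sup>2"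
  then have x0: "0 \<le> x" by (metis divide_nonneg_nonneg mult_nonneg_nonneg zero_le_numeral zero_le_power2)
  have x1: "x\<^sup>2 \<le> 1" using assms by (simp add: abs_square_le_1 abs_le_iff)
  show "x = 1/2"
  proof (cases "x < 1/2")
    case True
    then have "x\<^sup>2 < (1/2)\<^sup>2" using x0 by (intro power_strict_mono) auto
    then have "3/4 < 1 - x\<^sup>2" by (simp add: power2_eq_square)
    then have "(3/4)\<^sup>2 < (1 - x\<^sup>2)\<^sup>2" by (intro power_strict_mono) auto
    then show ?thesis using eq True by (simp add: power2_eq_square)
  next
    case ge: False
    show ?thesis
    proof (rule ccontr)
      assume "x \<noteq> 1/2"
      then have "(1/2)\<^sup>2 < x\<^sup>2" using ge by (intro power_strict_mono) auto
      then have "1 - x\<^sup>2 < 3/4" by (simp add: power2_eq_square)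
      then have "(1 - x\<^sup>2)\<^sup>2 < (3/4)\<^sup>2" using x1 by (intro power_strict_mono) auto
      then show False using eq ge by (simp add: power2_eq_square)
    qed
  qed
next
  assume x: "x = 1/2"
  show "x = 8 / 9 * (1 - x\<^sup>2)\<^sup>2" unfolding x by (simp add: power2_eq_square)
qed

text \<open>
  The common parameter at which strands \<open>k\<close> and \<open>l\<close> meet before a third move.  After the move it is
  the negative of this.
\<close>

definition R3_param :: "nat \<Rightarrow> nat \<Rightarrow> real" where
  "R3_param k l = (if {k, l} = {0, 1} then 0 else if {k, l} = {0, 2} then - 1/2 else 1/2)"

lemma R3_param_commute: "R3_param k l = R3_param l k"
  by (simp add: R3_param_def insert_commute)

lemma R3_param_simps:
  "R3_param 0 1 = 0" "R3_param 1 0 = 0" "R3_param 0 2 = - 1/2" "R3_param 2 0 = - 1/2"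
  "R3_param 1 2 = 1/2" "R3_param 2 1 = 1/2"
  by (auto simp: R3_param_def doubleton_eq_iff)

lemma R3_param_range: "R3_param k l \<in> {-1<..<1}" "- R3_param k l \<in> {-1<..<1}"
  by (auto simp: R3_param_def)

lemma less3: "k < 3 \<longleftrightarrow> k = 0 \<or> k = 1 \<or> k = (2 :: nat)"
  by auto

lemma R3_cross:
  assumes kl: "k < 3" "l < 3" "k \<noteq> l" and x: "x \<in> {-1..1}"
  shows "R3_before k x = R3_before l x \<longleftrightarrow> x = R3_param k l"
    "R3_after k x = R3_after l x \<longleftrightarrow> x = - R3_param k l"
proof -
  have x': "- x \<in> {-1..1}" using x by auto
  have bump: "x / 2 = 4 / 9 * (1 - x\<^sup>2)\<^sup>2 \<longleftrightarrow> x = 1/2" "4 / 9 * (1 - x\<^sup>2)\<^sup>2 = x / 2 \<longleftrightarrow> x = 1/2"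
    "x / 2 = - (4 / 9) * (1 - x\<^sup>2)\<^sup>2 \<longleftrightarrow> x = - 1/2" "- (4 / 9) * (1 - x\<^sup>2)\<^sup>2 = x / 2 \<longleftrightarrow> x = - 1/2"
    "- x / 2 = - (4 / 9) * (1 - x\<^sup>2)\<^sup>2 \<longleftrightarrow> x = 1/2" "- (4 / 9) * (1 - x\<^sup>2)\<^sup>2 = - x / 2 \<longleftrightarrow> x = 1/2"
    "- x / 2 = 4 / 9 * (1 - x\<^sup>2)\<^sup>2 \<longleftrightarrow> x = - 1/2" "4 / 9 * (1 - x\<^sup>2)\<^sup>2 = - x / 2 \<longleftrightarrow> x = - 1/2"
    using bump_meets_line[OF x] bump_meets_line[OF x'] by auto
  show "R3_before k x = R3_before l x \<longleftrightarrow> x = R3_param k l"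
    using kl unfolding less3 R3_before_def complex.inject
    by (elim disjE) (simp_all only: simp_thms refl if_True if_False zero_neq_one one_neq_zero zero_neq_numeral
        numeral_neq_zero one_eq_numeral_iff numeral_eq_one_iff num.distinct R3_param_simps bump, auto)
  show "R3_after k x = R3_after l x \<longleftrightarrow> x = - R3_param k l"
    using kl unfolding less3 R3_after_def complex.inject
    by (elim disjE) (simp_all only: simp_thms refl if_True if_False zero_neq_one one_neq_zero zero_neq_numeral
        numeral_neq_zero one_eq_numeral_iff numeral_eq_one_iff num.distinct R3_param_simps bump, auto)
qed

section \<open>The three moves as steps of chord diagrams\<close>

lemma R1_step:
  assumes R1: "R1_move I M D D'" and D: "generic_diagram I D" "generic_diagram I D'"
    and \<kappa>: "\<And>a b. a \<le> b \<Longrightarrow> {a..b} \<subseteq> I \<Longrightarrow> \<kappa> a = \<kappa> b"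
  shows "gauss_step \<kappa> (gauss I D) (gauss I D')"
proof -
  obtain \<phi> a b \<rho> where lc: "local_change I M 1 R1_kink R1_straight \<phi> a b \<rho> D D'"
    using R1 unfolding R1_move_def by blast
  obtain s where "strands I 1 R1_kink R1_kink' \<phi> a b \<rho> s D" and after: "strands I 1 R1_straight R1_straight' \<phi> a b \<rho> s D'"
    using local_change_strands[OF lc D model_derivatives(1) model_boxes(1) model_derivatives(2) model_boxes(2)] by blast
  then interpret strands I 1 R1_kink R1_kink' \<phi> a b \<rho> s D by simp
  interpret after: strands I 1 R1_straight R1_straight' \<phi> a b \<rho> s D' by fact
  note outside = local_change_outside[OF lc D]
  \<comment> \<open>The straight strand has no double point, so after the move no crossing is left
    in the disk.\<close>
  have "fst c \<notin> U" if c: "c \<in> over D'" for c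
    by (rule notI, erule after.over_strands[OF c]) (auto simp: R1_straight_def)
  then have over': "over D' = {c \<in> over D. fst c \<notin> U}" using outside(1) by blast
  have sign: "crossing_sign I D' c = crossing_sign I D c" if "c \<in> over D'" for c
    using outside(2) that over_inside unfolding over' by blast
  have half: "1/2 \<in> {-1..1 :: real}" "- 1/2 \<in> {-1..1 :: real}" by auto
  define u w where "u = time 0 (1/2)" and "w = time 0 (- 1/2)"
  have uw: "u \<in> {a 0..b 0}" "w \<in> {a 0..b 0}" "u \<noteq> w"
    using time(1)[of 0] time_eq[of 0 "1/2" "- 1/2"] half by (auto simp: u_def w_def)
  have kink: "c = (u, w) \<or> c = (w, u)" if c: "c \<in> over D" "fst c \<in> U" for c
    using c(2)
  proof (rule over_strands[OF c(1)])
    fix k l x y assume "k < (1 :: nat)" "l < (1 :: nat)" "x \<in> {-1..1}" "y \<in> {-1..1}"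
      "c = (time k x, time l y)" "R1_kink k x = R1_kink l y" "(k, x) \<noteq> (l, y)"
    moreover from this have "k = 0" "l = 0" "x \<noteq> y" by auto
    ultimately show ?thesis using R1_kink_double[of x y k l] unfolding u_def w_def by metis
  qed
  show ?thesis
  \<comment> \<open>A virtual kink is invisible in the chord diagram; a real one is a single chord,
    whichever path is on top.\<close>
  proof (cases "\<exists>c\<in>over D. fst c \<in> U")
    case False
    then have "over D' = over D" by (auto simp: over')
    then show ?thesis using sign by (intro gauss_step_same) auto
  next
    case True
    then obtain c where c: "c \<in> over D" "fst c \<in> U" by blast
    have unique: "d = c" if d: "d \<in> over D" "fst d \<in> U" for d
    proof (rule ccontr)
      assume "d \<noteq> c"
      then have "(u, w) \<in> over D" "(w, u) \<in> over D" using kink[OF c] kink[OF d] c(1) d(1) by auto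
      then show False using chord_diagram_disjoint(2)[OF generic_chord_diagram[OF D(1)], of "(u, w)" "(w, u)"] uw(3)
        by simp
    qed
    have over: "over D = insert c (over D')" "c \<notin> over D'"
    proof -
      have "d \<in> insert c (over D')" if "d \<in> over D" for d
        using unique[OF that] that unfolding over' by (cases "fst d \<in> U") simp_all
      then show "over D = insert c (over D')" using c(1) unfolding over' by blast
      show "c \<notin> over D'" using c(2) unfolding over' by simp
    qed
    have c_strand: "fst c \<in> {a 0..b 0}" "snd c \<in> {a 0..b 0}" using kink[OF c] uw by (metis fst_conv snd_conv)+
    show ?thesis unfolding gauss_def over(1)
    proof (rule kink_step)
      show "chord_diagram (insert c (over D'))" using generic_chord_diagram[OF D(1)] over(1) by simp
      show "\<kappa> (fst c) = \<kappa> (snd c)" using \<kappa>_strand[where \<kappa> = \<kappa> and k = 0, OF \<kappa> _ c_strand(1)] \<kappa>_strand[where \<kappa> = \<kappa> and k = 0, OF \<kappa> _ c_strand(2)] by simp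
      show "t < fst c \<longleftrightarrow> t < snd c" if t: "t \<in> chord_ends (over D')" for t
      proof -
        have "t \<notin> U" using t over_inside by (auto simp: chord_ends_def over')
        then have "t < a 0 \<or> b 0 < t" by (auto simp: not_le)
        then show ?thesis using c_strand by auto
      qed
    qed (use over(2) sign in auto)
  qed
qed

lemma R2_step:
  assumes R2: "R2_move I M D D'" and D: "generic_diagram I D" "generic_diagram I D'"
    and \<kappa>: "\<And>a b. a \<le> b \<Longrightarrow> {a..b} \<subseteq> I \<Longrightarrow> \<kappa> a = \<kappa> b"
  shows "gauss_step \<kappa> (gauss I D) (gauss I D')"
proof -
  obtain \<phi> a b \<rho> where lc: "local_change I M 2 R2_before R2_after \<phi> a b \<rho> D D'"
    and crossings: "let X = double_points I D \<inter> {a 0..b 0} \<times> {a 1..b 1} in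
        X \<inter> over D = {} \<and> X \<inter> (over D)\<inverse> = {} \<or> X \<subseteq> over D \<or> X \<subseteq> (over D)\<inverse>"
    using R2 unfolding R2_move_def by blast
  obtain s where "strands I 2 R2_before R2_before' \<phi> a b \<rho> s D" and after: "strands I 2 R2_after R1_straight' \<phi> a b \<rho> s D'"
    using local_change_strands[OF lc D model_derivatives(3) model_boxes(3) model_derivatives(4) model_boxes(4)] by blast
  then interpret strands I 2 R2_before R2_before' \<phi> a b \<rho> s D by simp
  interpret after: strands I 2 R2_after R1_straight' \<phi> a b \<rho> s D' by fact
  note outside = local_change_outside[OF lc D]
  have "fst c \<notin> U" if c: "c \<in> over D'" for c
    by (rule notI, erule after.over_strands[OF c]) (auto simp: R2_after_def split: if_splits)
  then have over': "over D' = {c \<in> over D. fst c \<notin> U}" using outside(1) by blast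
  have sign: "crossing_sign I D' c = crossing_sign I D c" if "c \<in> over D'" for c
    using outside(2) that over_inside unfolding over' by blast
  define u where "u x = (time 0 x, time 1 x)" for x
  have half: "1/2 \<in> {-1<..<1 :: real}" "- 1/2 \<in> {-1<..<1 :: real}" by auto
  have half': "1/2 \<in> {-1..1 :: real}" "- 1/2 \<in> {-1..1 :: real}" by auto
  have eq: "R2_before 0 x = R2_before 1 x" if "x = 1/2 \<or> x = - 1/2" for x
  proof -
    have "R2_before 0 (1/2) = R2_before 1 (1/2)" "R2_before 0 (- 1/2) = R2_before 1 (- 1/2)"
      by (simp_all add: R2_before_def power2_eq_square)
    then show ?thesis using that by metis
  qed
  let ?X = "double_points I D \<inter> {a 0..b 0} \<times> {a 1..b 1}"
  have u_X: "u x \<in> ?X" if "x = 1/2 \<or> x = - 1/2" for x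
    using model_double_points[of 0 1 x x] eq[OF that] time(1)[of 0 x] time(1)[of 1 x] that half'
    by (auto simp: u_def)
  have bigon: "c \<in> {u (1/2), u (- 1/2)} \<or> prod.swap c \<in> {u (1/2), u (- 1/2)}" if c: "c \<in> over D" "fst c \<in> U" for c
    using c(2)
  proof (rule over_strands[OF c(1)])
    fix k l x y assume *: "k < (2 :: nat)" "l < (2 :: nat)" "x \<in> {-1..1}" "y \<in> {-1..1}"
      "c = (time k x, time l y)" "R2_before k x = R2_before l y" "(k, x) \<noteq> (l, y)"
    from R2_before_cross[OF *(3,1,2,7,6)] have xy: "y = x" "x = 1/2 \<or> x = - 1/2" "k \<noteq> l" by auto
    then have "k = 0 \<and> l = 1 \<or> k = 1 \<and> l = 0" using * by auto
    then have "c = u x \<or> prod.swap c = u x" unfolding u_def *(5) xy(1) by auto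
    then show ?thesis using xy(2) by (metis insert_iff)
  qed
  have swap_over: "prod.swap c \<in> over D \<longleftrightarrow> c \<in> (over D)\<inverse>" for c by (cases c) simp
  \<comment> \<open>Merges the two real cases: \<open>e\<close> lists both crossings with the
    over-strand first, be it strand 0 or strand 1.\<close>
  have "?X \<inter> over D = {} \<and> ?X \<inter> (over D)\<inverse> = {} \<or>
    (\<exists>e. (e = (\<lambda>x. u x) \<or> e = (\<lambda>x. prod.swap (u x))) \<and> e (1/2) \<in> over D \<and> e (- 1/2) \<in> over D)"
  proof -
    from crossings consider "?X \<inter> over D = {} \<and> ?X \<inter> (over D)\<inverse> = {}" | "?X \<subseteq> over D" | "?X \<subseteq> (over D)\<inverse>"
      unfolding Let_def by blast
    then show ?thesis
    proof cases
      case 2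
      then have "u (1/2) \<in> over D \<and> u (- 1/2) \<in> over D" using u_X by blast
      then show ?thesis by blast
    next
      case 3
      then have "prod.swap (u (1/2)) \<in> over D \<and> prod.swap (u (- 1/2)) \<in> over D"
        using u_X unfolding swap_over by blast
      then show ?thesis by blast
    qed blast
  qed
  then show ?thesis
  proof
    assume virtual: "?X \<inter> over D = {} \<and> ?X \<inter> (over D)\<inverse> = {}"
    have "fst c \<notin> U" if c: "c \<in> over D" for c
    proof
      assume "fst c \<in> U"
      from bigon[OF c this] have "c \<in> ?X \<or> prod.swap c \<in> ?X" using u_X by (metis empty_iff insert_iff)
      moreover have "prod.swap c \<in> (over D)\<inverse>" using c by (cases c) simp
      ultimately show False using virtual c by (metis IntI empty_iff)
    qed
    then have "over D' = over D" by (auto simp: over')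
    then show ?thesis using sign by (intro gauss_step_same) auto
  next
    assume "\<exists>e. (e = (\<lambda>x. u x) \<or> e = (\<lambda>x. prod.swap (u x))) \<and> e (1/2) \<in> over D \<and> e (- 1/2) \<in> over D"
    then obtain e where real: "e = (\<lambda>x. u x) \<or> e = (\<lambda>x. prod.swap (u x))" "e (1/2) \<in> over D" "e (- 1/2) \<in> over D"
      by (elim exE conjE)
    let ?k = "e (1/2)" and ?l = "e (- 1/2)"
    have u_ne: "u (1/2) \<noteq> u (- 1/2)" using time_eq[of 0 "1/2" "- 1/2"] half' by (auto simp: u_def)
    then have ne: "?k \<noteq> ?l" using real(1) by (auto simp: prod_eq_iff)
    have e_strand: "e x = (time 0 x, time 1 x) \<or> e x = (time 1 x, time 0 x)" for x
      using real(1) by (auto simp: u_def)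
    have t01: "time 0 (1/2) \<in> {a 0..b 0}" "time 1 (1/2) \<in> {a 1..b 1}"
      "time 0 (- 1/2) \<in> {a 0..b 0}" "time 1 (- 1/2) \<in> {a 1..b 1}"
      using time(1)[of 0] time(1)[of 1] half' by auto
    then have in_U: "time 0 (1/2) \<in> U" "time 1 (1/2) \<in> U" "time 0 (- 1/2) \<in> U" "time 1 (- 1/2) \<in> U"
      by (metis UN_I lessThan_iff one_less_numeral_iff semiring_norm(76) zero_less_numeral)+
    have unique: "c = ?k \<or> c = ?l" if c: "c \<in> over D" "fst c \<in> U" for c
    proof (rule ccontr)
      assume not: "\<not> (c = ?k \<or> c = ?l)"
      note disj = chord_diagram_disjoint[OF generic_chord_diagram[OF D(1)] c(1)]
      have k: "fst c \<notin> {fst ?k, snd ?k}" "fst c \<notin> {fst ?l, snd ?l}"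
        using disj[OF real(2)] disj[OF real(3)] not by auto
      have "fst c \<in> {time 0 (1/2), time 1 (1/2), time 0 (- 1/2), time 1 (- 1/2)}"
        using bigon[OF c] by (cases c) (auto simp: u_def)
      then show False using k e_strand[of "1/2"] e_strand[of "- 1/2"] by auto
    qed
    have k_in: "fst ?k \<in> U" and l_in: "fst ?l \<in> U"
      using e_strand[of "1/2"] e_strand[of "- 1/2"] in_U by (metis fst_conv)+
    have over: "over D = insert ?k (insert ?l (over D'))" "?k \<notin> over D'" "?l \<notin> over D'"
    proof -
      have "d \<in> insert ?k (insert ?l (over D'))" if "d \<in> over D" for d
        using unique[OF that] that unfolding over' by blast
      then show "over D = insert ?k (insert ?l (over D'))" using real(2,3) unfolding over' by blast
      show "?k \<notin> over D'" "?l \<notin> over D'" using k_in l_in unfolding over' by simp_all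
    qed
    have s01: "s 0 = 1 \<or> s 0 = - 1" "s 1 = 1 \<or> s 1 = - 1" using s[of 0] s[of 1] by auto
    have det: "det2 (R2_before' 0 (1/2)) (R2_before' 1 (1/2)) = 4/3" "det2 (R2_before' 0 (- 1/2)) (R2_before' 1 (- 1/2)) = - 4/3"
      "det2 (R2_before' 1 (1/2)) (R2_before' 0 (1/2)) = - 4/3" "det2 (R2_before' 1 (- 1/2)) (R2_before' 0 (- 1/2)) = 4/3"
      by (simp_all add: R2_before'_def det2_def power2_eq_square)
    \<comment> \<open>The determinants at the two meeting points are 4/3 and -4/3, while the
      directions of the strands enter both signs in the same way.\<close>
    have opposite: "crossing_sign I D ?l = - crossing_sign I D ?k"
      using real(1)
    proof
      assume e: "e = (\<lambda>x. u x)"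
      show ?thesis
        using crossing_sign_strands[of 0 1 "1/2" "1/2"] crossing_sign_strands[of 0 1 "- 1/2" "- 1/2"] s01
        unfolding e u_def det by (auto simp: eq half)
    next
      assume e: "e = (\<lambda>x. prod.swap (u x))"
      show ?thesis
        using crossing_sign_strands[of 1 0 "1/2" "1/2"] crossing_sign_strands[of 1 0 "- 1/2" "- 1/2"] s01
        unfolding e u_def det swap_simp by (auto simp: eq half)
    qed
    have \<kappa>01: "\<kappa> (time 0 (1/2)) = \<kappa> (time 0 (- 1/2))" "\<kappa> (time 1 (1/2)) = \<kappa> (time 1 (- 1/2))"
      using \<kappa>_strand[where \<kappa> = \<kappa>, OF \<kappa> _ t01(1)] \<kappa>_strand[where \<kappa> = \<kappa>, OF \<kappa> _ t01(2)]
        \<kappa>_strand[where \<kappa> = \<kappa>, OF \<kappa> _ t01(3)] \<kappa>_strand[where \<kappa> = \<kappa>, OF \<kappa> _ t01(4)] by simp_all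
    have side: "t < time 0 (1/2) \<longleftrightarrow> t < time 0 (- 1/2)" "t < time 1 (1/2) \<longleftrightarrow> t < time 1 (- 1/2)"
      if t: "t \<in> chord_ends (over D')" for t
    proof -
      have "t \<notin> U" using t over_inside by (auto simp: chord_ends_def over')
      then show "t < time 0 (1/2) \<longleftrightarrow> t < time 0 (- 1/2)" "t < time 1 (1/2) \<longleftrightarrow> t < time 1 (- 1/2)"
        using time_same_side[of t 0 "1/2" "- 1/2"] time_same_side[of t 1 "1/2" "- 1/2"] half' by auto
    qed
    have apart: "t < v \<longleftrightarrow> a 0 < a 1" "v < t \<longleftrightarrow> a 1 < a 0" if "t \<in> {a 0..b 0}" "v \<in> {a 1..b 1}" for t v
      using strands_apart[of 0 1 t v] strands_apart[of 1 0 v t] that by auto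
    have "a 0 \<noteq> a 1" using strand_unique[of 0 1 "a 0"] ab[of 0] ab[of 1] by auto
    then have a01: "a 0 < a 1 \<or> a 1 < a 0" by linarith
    show ?thesis unfolding gauss_def over(1)
    proof (rule bigon_step)
      show "chord_diagram (insert ?k (insert ?l (over D')))" using generic_chord_diagram[OF D(1)] over(1) by simp
      show "\<kappa> (fst ?k) = \<kappa> (fst ?l)" "\<kappa> (snd ?k) = \<kappa> (snd ?l)"
        using real(1) \<kappa>01 by (auto simp: u_def)
      show "t < fst ?k \<longleftrightarrow> t < fst ?l" "t < snd ?k \<longleftrightarrow> t < snd ?l" if "t \<in> chord_ends (over D')" for t
        using real(1) side[OF that] by (auto simp: u_def)
      show "fst ?k < snd ?k \<and> fst ?k < snd ?l \<and> fst ?l < snd ?k \<and> fst ?l < snd ?l \<or>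
          snd ?k < fst ?k \<and> snd ?k < fst ?l \<and> snd ?l < fst ?k \<and> snd ?l < fst ?l"
        using real(1) a01 apart[OF t01(1,2)] apart[OF t01(1,4)] apart[OF t01(3,2)] apart[OF t01(3,4)]
        by (auto simp: u_def)
    qed (use over(2,3) sign ne opposite in auto)
  qed
qed

text \<open>Crossings after the move sit at the negated parameters with the same velocities, so
  their signs are those before the move.\<close>

lemma R3_after'_minus: "R3_after' k (- x) = R3_before' k x"
  by (simp add: R3_after'_def R3_before'_def)

lemma R3_det:
  "det2 (R3_before' 0 0) (R3_before' 1 0) = - 1"
  "det2 (R3_before' 1 (1/2)) (R3_before' 2 (1/2)) = 7/6"
  "det2 (R3_before' 2 (- 1/2)) (R3_before' 0 (- 1/2)) = 7/6"
  by (simp_all add: R3_before'_def det2_def power2_eq_square)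

lemma R3_simps:
  "R3_param 0 (Suc 0) = 0" "R3_param (Suc 0) 0 = 0" "R3_param 0 2 = - (1/2)" "R3_param 2 0 = - (1/2)"
  "R3_param (Suc 0) 2 = 1/2" "R3_param 2 (Suc 0) = 1/2"
  "det2 (R3_before' 0 0) (R3_before' (Suc 0) 0) = - 1"
  "det2 (R3_before' (Suc 0) (1/2)) (R3_before' 2 (1/2)) = 7/6"
  "det2 (R3_before' 2 (- (1/2))) (R3_before' 0 (- (1/2))) = 7/6"
  using R3_param_simps R3_det by simp_all

lemma det2_swap: "det2 u v = - det2 v u"
  by (simp add: det2_def)

text \<open>The map \<open>\<pi>\<close> reflects the parameter of each strand and fixes all other
  times. If one strand is virtual, each of the others carries at most one chord end in the disk and
  \<open>\<pi>\<close> preserves the order of ends; otherwise the three chords form a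
  triangle.\<close>

lemma R3_step:
  assumes R3: "R3_move I M D D'" and D: "generic_diagram I D" "generic_diagram I D'"
    and \<kappa>: "\<And>a b. a \<le> b \<Longrightarrow> {a..b} \<subseteq> I \<Longrightarrow> \<kappa> a = \<kappa> b"
  shows "gauss_step \<kappa> (gauss I D) (gauss I D')"
proof -
  obtain \<phi> a b \<rho> where lc: "local_change I M 3 R3_before R3_after \<phi> a b \<rho> D D'"
    and same: "\<forall>k<3. \<forall>l<3. k \<noteq> l \<longrightarrow> (strand_over a b D k l \<longleftrightarrow> strand_over a b D' k l)"
    and types: "(\<exists>k<3. \<forall>l<3. \<not> strand_over a b D k l \<and> \<not> strand_over a b D l k) \<or>
      (\<exists>k l m. {k, l, m} = {0, 1, 2} \<and>
         strand_over a b D k l \<and> strand_over a b D k m \<and> strand_over a b D l m)"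
    using R3 unfolding R3_move_def by (elim exE conjE) (rule that)
  obtain s where "strands I 3 R3_before R3_before' \<phi> a b \<rho> s D" and after: "strands I 3 R3_after R3_after' \<phi> a b \<rho> s D'"
    using local_change_strands[OF lc D model_derivatives(5) model_boxes(5) model_derivatives(6) model_boxes(6)] by blast
  then interpret strands I 3 R3_before R3_before' \<phi> a b \<rho> s D by simp
  interpret after: strands I 3 R3_after R3_after' \<phi> a b \<rho> s D' by fact
  note outside = local_change_outside[OF lc D]
  have p_range: "R3_param k l \<in> {-1..1}" "- R3_param k l \<in> {-1..1}" for k l
    using R3_param_range[of k l] by auto
  define T T' where "T k l = time k (R3_param k l)" and "T' k l = time k (- R3_param k l)" for k l
  have T_strand: "T k l \<in> {a k..b k}" "T' k l \<in> {a k..b k}" if "k < 3" for k l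
    using time(1)[OF that] p_range by (simp_all only: T_def T'_def)
  have T_U: "T k l \<in> U" "T' k l \<in> U" if "k < 3" for k l
    using T_strand[OF that] that by blast+
  have inside: "\<exists>k l. k < 3 \<and> l < 3 \<and> k \<noteq> l \<and> c = (T k l, T l k)" if c: "c \<in> over D" "fst c \<in> U" for c
    using c(2)
  proof (rule over_strands[OF c(1)])
    fix k l x y assume *: "k < (3 :: nat)" "l < (3 :: nat)" "x \<in> {-1..1}" "y \<in> {-1..1}"
      "c = (time k x, time l y)" "R3_before k x = R3_before l y" "(k, x) \<noteq> (l, y)"
    then have y: "y = x" by (simp add: R3_before_def)
    then have "k \<noteq> l" using * by auto
    then have "x = R3_param k l" using R3_cross(1)[OF *(1,2) _ *(3)] *(6) y by simp
    then show ?thesis using * y \<open>k \<noteq> l\<close> R3_param_commute[of k l] unfolding T_def by metis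
  qed
  have inside': "\<exists>k l. k < 3 \<and> l < 3 \<and> k \<noteq> l \<and> c = (T' k l, T' l k)" if c: "c \<in> over D'" "fst c \<in> U" for c
    using c(2)
  proof (rule after.over_strands[OF c(1)])
    fix k l x y assume *: "k < (3 :: nat)" "l < (3 :: nat)" "x \<in> {-1..1}" "y \<in> {-1..1}"
      "c = (time k x, time l y)" "R3_after k x = R3_after l y" "(k, x) \<noteq> (l, y)"
    then have y: "y = x" by (simp add: R3_after_def)
    then have "k \<noteq> l" using * by auto
    then have "x = - R3_param k l" using R3_cross(2)[OF *(1,2) _ *(3)] *(6) y by simp
    then show ?thesis using * y \<open>k \<noteq> l\<close> R3_param_commute[of k l] unfolding T'_def by metis
  qed
  have strand_over: "strand_over a b D k l \<longleftrightarrow> (T k l, T l k) \<in> over D" if kl: "k < 3" "l < 3" "k \<noteq> l" for k l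
  proof
    assume "strand_over a b D k l"
    then obtain u v where uv: "u \<in> {a k..b k}" "v \<in> {a l..b l}" "(u, v) \<in> over D"
      unfolding strand_over_def by blast
    then have "fst (u, v) \<in> U" using kl(1) by auto
    from inside[OF uv(3) this] obtain k' l' where *: "k' < 3" "l' < 3" "u = T k' l'" "v = T l' k'" by auto
    then have "k' = k" "l' = l"
      using strand_unique[OF *(1) kl(1)] strand_unique[OF *(2) kl(2)] T_strand uv(1,2) by metis+
    then show "(T k l, T l k) \<in> over D" using uv(3) * by simp
  next
    assume "(T k l, T l k) \<in> over D"
    then show "strand_over a b D k l" unfolding strand_over_def using T_strand kl by blast
  qed
  have strand_over': "strand_over a b D' k l \<longleftrightarrow> (T' k l, T' l k) \<in> over D'" if kl: "k < 3" "l < 3" "k \<noteq> l" for k l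
  proof
    assume "strand_over a b D' k l"
    then obtain u v where uv: "u \<in> {a k..b k}" "v \<in> {a l..b l}" "(u, v) \<in> over D'"
      unfolding strand_over_def by blast
    then have "fst (u, v) \<in> U" using kl(1) by auto
    from inside'[OF uv(3) this] obtain k' l' where *: "k' < 3" "l' < 3" "u = T' k' l'" "v = T' l' k'" by auto
    then have "k' = k" "l' = l"
      using strand_unique[OF *(1) kl(1)] strand_unique[OF *(2) kl(2)] T_strand uv(1,2) by metis+
    then show "(T' k l, T' l k) \<in> over D'" using uv(3) * by simp
  next
    assume "(T' k l, T' l k) \<in> over D'"
    then show "strand_over a b D' k l" unfolding strand_over_def using T_strand kl by blast
  qed
  have corresp: "(T k l, T l k) \<in> over D \<longleftrightarrow> (T' k l, T' l k) \<in> over D'" if kl: "k < 3" "l < 3" "k \<noteq> l" for k l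
    using strand_over[OF kl] strand_over'[OF kl] same kl by blast

  \<comment> \<open>The choice operator picks the unique strand running at time \<open>t\<close>.
    Reflecting all times of a strand, and not only the crossing times, makes \<open>\<pi>\<close> an
    involution, hence injective.\<close>
  define \<pi> where "\<pi> t = (if t \<in> U then let k = (SOME k. k < 3 \<and> t \<in> {a k..b k}) in time k (- \<rho> k t) else t)" for t
  have \<pi>_time: "\<pi> (time k x) = time k (- x)" if k: "k < 3" and x: "x \<in> {-1..1}" for k x
  proof -
    have t: "k < 3 \<and> time k x \<in> {a k..b k}" using time(1)[OF k x] k by simp
    then have "(SOME k'. k' < 3 \<and> time k x \<in> {a k'..b k'}) = k"
      by (rule some_equality) (use strand_unique t in blast)
    moreover have "time k x \<in> U" using t by blast
    ultimately show ?thesis using time(2)[OF k x] by (simp only: \<pi>_def if_True Let_def)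
  qed
  have \<pi>_T: "\<pi> (T k l) = T' k l" if "k < 3" for k l
    using \<pi>_time[OF that p_range(1)] by (simp add: T_def T'_def)
  have \<pi>_out: "\<pi> t = t" if "t \<notin> U" for t using that by (simp only: \<pi>_def if_False)
  have U_time: "\<exists>k<3. \<exists>x\<in>{-1..1}. t = time k x" if "t \<in> U" for t
  proof -
    from that obtain k where "k \<in> {..<3}" and t: "t \<in> {a k..b k}" by (elim UN_E)
    then have k: "k < 3" by simp
    show ?thesis using k time_\<rho>[OF k t] \<rho>_range[OF k t] by metis
  qed
  have \<pi>_invol: "\<pi> (\<pi> t) = t" for t
  proof (cases "t \<in> U")
    case True
    then obtain k x where kx: "k < 3" "x \<in> {-1..1}" "t = time k x" using U_time by blast
    then have "- x \<in> {-1..1}" by auto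
    then show ?thesis using kx \<pi>_time by simp
  qed (simp add: \<pi>_out)
  have inj_\<pi>: "inj_on \<pi> A" for A by (rule inj_on_inverseI[where g = \<pi>]) (rule \<pi>_invol)
  have \<kappa>_\<pi>: "\<kappa> (\<pi> t) = \<kappa> t" for t
  proof (cases "t \<in> U")
    case True
    then obtain k x where kx: "k < 3" "x \<in> {-1..1}" "t = time k x" using U_time by blast
    then have "- x \<in> {-1..1}" by auto
    then have "\<pi> t \<in> {a k..b k}" "t \<in> {a k..b k}" using kx \<pi>_time time(1) by simp_all
    then show ?thesis
      using \<kappa>_strand[where \<kappa> = \<kappa>, OF \<kappa> kx(1), of "\<pi> t"] \<kappa>_strand[where \<kappa> = \<kappa>, OF \<kappa> kx(1), of t] by simp
  qed (simp add: \<pi>_out)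

  have over': "over D' = map_prod \<pi> \<pi> ` over D"
  proof (intro equalityI subsetI)
    fix c assume c: "c \<in> over D'"
    show "c \<in> map_prod \<pi> \<pi> ` over D"
    proof (cases "fst c \<in> U")
      case True
      then obtain k l where kl: "k < 3" "l < 3" "k \<noteq> l" "c = (T' k l, T' l k)" using inside'[OF c] by blast
      then have "(T k l, T l k) \<in> over D" "map_prod \<pi> \<pi> (T k l, T l k) = c"
        using corresp c \<pi>_T by auto
      then show ?thesis by (metis image_eqI)
    next
      case False
      then have "c \<in> over D" "snd c \<notin> U" using outside(1) c after.over_inside[OF c] by blast+
      moreover from this have "map_prod \<pi> \<pi> c = c" using False \<pi>_out by (cases c) simp
      ultimately show ?thesis by (metis image_eqI)
    qed
  next
    fix c assume "c \<in> map_prod \<pi> \<pi> ` over D"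
    then obtain d where d: "d \<in> over D" "c = map_prod \<pi> \<pi> d" by (elim imageE)
    show "c \<in> over D'"
    proof (cases "fst d \<in> U")
      case True
      then obtain k l where kl: "k < 3" "l < 3" "k \<noteq> l" "d = (T k l, T l k)" using inside[OF d(1)] by blast
      then show ?thesis using corresp[OF kl(1-3)] d \<pi>_T by simp
    next
      case False
      then have "d \<in> over D'" "snd d \<notin> U" using outside(1) d over_inside[OF d(1)] by blast+
      moreover from this have "map_prod \<pi> \<pi> d = d" using False \<pi>_out by (cases d) simp
      ultimately show ?thesis using d(2) by simp
    qed
  qed
  have cross: "R3_before k (R3_param k l) = R3_before l (R3_param l k)"
    "R3_after k (- R3_param k l) = R3_after l (- R3_param l k)" if kl: "k < 3" "l < 3" "k \<noteq> l" for k l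
    using R3_cross[OF kl p_range(1)] R3_cross[OF kl p_range(2)] R3_param_commute[of l k] by auto
  define w :: "nat \<Rightarrow> nat \<Rightarrow> int" where
    "w k l = (if s k * s l * det2 (R3_before' k (R3_param k l)) (R3_before' l (R3_param l k)) > 0 then 1 else - 1)" for k l
  have sign_T: "crossing_sign I D (T k l, T l k) = w k l" "crossing_sign I D' (T' k l, T' l k) = w k l"
    if kl: "k < 3" "l < 3" "k \<noteq> l" for k l
    using crossing_sign_strands[OF kl(1,2) R3_param_range(1) R3_param_range(1) cross(1)[OF kl]]
      after.crossing_sign_strands[OF kl(1,2) R3_param_range(2) R3_param_range(2) cross(2)[OF kl]]
    unfolding T_def T'_def w_def R3_after'_minus by simp_all
  have sign: "crossing_sign I D' (map_prod \<pi> \<pi> c) = crossing_sign I D c" if c: "c \<in> over D" for c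
  proof (cases "fst c \<in> U")
    case True
    then obtain k l where kl: "k < 3" "l < 3" "k \<noteq> l" "c = (T k l, T l k)" using inside[OF c] by blast
    then show ?thesis using sign_T[OF kl(1-3)] by (simp add: \<pi>_T)
  next
    case False
    then have "snd c \<notin> U" using over_inside[OF c] by blast
    moreover from this have "map_prod \<pi> \<pi> c = c" using False \<pi>_out by (cases c) simp
    ultimately show ?thesis using outside(2)[OF c False] by simp
  qed
  have ends: "t \<notin> U \<or> (\<exists>k l. k < 3 \<and> l < 3 \<and> k \<noteq> l \<and> t = T k l \<and> (strand_over a b D k l \<or> strand_over a b D l k))"
    if t: "t \<in> chord_ends (over D)" for t
  proof -
    obtain c where c: "c \<in> over D" "t = fst c \<or> t = snd c" using t by (auto simp: chord_ends_def)
    show ?thesis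
    proof (cases "fst c \<in> U")
      case True
      then obtain k l where kl: "k < 3" "l < 3" "k \<noteq> l" "c = (T k l, T l k)" using inside[OF c(1)] by blast
      then have "strand_over a b D k l" using strand_over c(1) by simp
      then show ?thesis using kl c(2) by (metis fst_conv snd_conv)
    next
      case False
      then show ?thesis using over_inside[OF c(1)] c(2) by metis
    qed
  qed
  show ?thesis
    using types
  proof
    assume "\<exists>k<3. \<forall>l<3. \<not> strand_over a b D k l \<and> \<not> strand_over a b D l k"
    then obtain k where k: "k < 3" "\<And>l. l < 3 \<Longrightarrow> \<not> strand_over a b D k l \<and> \<not> strand_over a b D l k" by blast
    have "strict_mono_on (chord_ends (over D)) \<pi>"
    proof (rule strict_mono_onI)
      fix u v assume uv: "u \<in> chord_ends (over D)" "v \<in> chord_ends (over D)" "u < v"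
      show "\<pi> u < \<pi> v"
      proof (cases "u \<in> U")
        case False
        note u = this
        show ?thesis
        proof (cases "v \<in> U")
          case True
          then obtain i x where "i < 3" "x \<in> {-1..1}" "v = time i x" using U_time by blast
          then show ?thesis using time_same_side[OF u, of i x "- x"] uv(3) u by (auto simp: \<pi>_out \<pi>_time)
        qed (use u uv(3) in \<open>simp add: \<pi>_out\<close>)
      next
        case True
        show ?thesis
        proof (cases "v \<in> U")
          case False
          obtain i x where ix: "i < 3" "x \<in> {-1..1}" "u = time i x" using U_time True by blast
          then have x': "- x \<in> {-1..1}" by auto
          have "\<not> v < time i x" using uv(3) ix(3) by simp
          then have "\<not> v < time i (- x)" using time_same_side[OF False ix(1,2) x'] by simp
          moreover have "v \<noteq> time i (- x)" using False time(1)[OF ix(1) x'] ix(1) by blast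
          ultimately show ?thesis using ix False by (simp add: \<pi>_out \<pi>_time)
        next
          case v: True
          obtain i j where ij: "i < 3" "j < 3" "i \<noteq> j" "u = T i j" "strand_over a b D i j \<or> strand_over a b D j i"
            using ends[OF uv(1)] True by blast
          obtain i' j' where ij': "i' < 3" "j' < 3" "i' \<noteq> j'" "v = T i' j'" "strand_over a b D i' j' \<or> strand_over a b D j' i'"
            using ends[OF uv(2)] v by blast
          \<comment> \<open>Two ends on one strand would belong to real crossings with both other
            strands. These three strands exhaust all strands, so one of them is the virtual
            one.\<close>
          have "i \<noteq> i'"
          proof
            assume i: "i = i'"
            then have "j \<noteq> j'" using ij ij' uv(3) by auto
            then have "k = i \<or> k = j \<or> k = j'" using ij(1-3) ij'(1-3) k(1) i by arith
            then show False using k(2) ij ij' i by blast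
          qed
          then show ?thesis
            using strands_apart[OF ij(1) ij'(1), of u v] strands_apart[OF ij(1) ij'(1), of "\<pi> u" "\<pi> v"] uv(3)
              T_strand[OF ij(1)] T_strand[OF ij'(1)]
            by (simp add: ij(4) ij'(4) \<pi>_T ij(1) ij'(1) del: atLeastAtMost_iff)
        qed
      qed
    qed
    then show ?thesis unfolding gauss_def over'
      by (rule order_iso_step) (use sign \<kappa>_\<pi> in auto)
  next
    assume "\<exists>k l m. {k, l, m} = {0, 1, 2} \<and>
         strand_over a b D k l \<and> strand_over a b D k m \<and> strand_over a b D l m"
    then obtain i j k where ijk: "{i, j, k} = {0, 1, 2 :: nat}" "strand_over a b D i j" "strand_over a b D i k" "strand_over a b D j k"
      by blast
    have all: "strand_over a b D p q \<or> strand_over a b D q p" if "p < 3" "q < 3" "p \<noteq> q" for p q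
    proof -
      have "p \<in> {i, j, k}" "q \<in> {i, j, k}" unfolding ijk(1) using that by auto
      then show ?thesis using ijk(2-4) \<open>p \<noteq> q\<close> by (elim insertE emptyE) simp_all
    qed
    define C0 where "C0 = {c \<in> over D. fst c \<notin> U}"
    \<comment> \<open>The chord between strand \<open>k\<close> and its cyclic successor, oriented
      by which of the two is on top.\<close>
    define e where "e k = (let l = (k + 1) mod 3 in if (T k l, T l k) \<in> over D then (T k l, T l k) else (T l k, T k l))" for k
    have e: "e k = (if (T k l, T l k) \<in> over D then (T k l, T l k) else (T l k, T k l))" if "(k, l, m) \<in> cyclic3" for k l m
    proof -
      have "(k + 1) mod 3 = l" using that by (auto simp: cyclic3_def)
      then show ?thesis by (simp add: e_def)
    qed
    have less: "k < 3 \<and> l < 3 \<and> m < 3 \<and> k \<noteq> l \<and> l \<noteq> m \<and> m \<noteq> k" if "(k, l, m) \<in> cyclic3" for k l m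
      using that by (auto simp: cyclic3_def)
    have e_over: "e k \<in> over D" "fst (e k) \<in> U" if klm: "(k, l, m) \<in> cyclic3" for k l m
      using e[OF klm] all[of k l] strand_over[of k l] strand_over[of l k] less[OF klm] T_U[of k] T_U[of l]
      by (auto simp del: UN_iff)
    have asym: "(v, u) \<notin> over D" if "(u, v) \<in> over D" for u v
      using chord_diagram_disjoint(2)[OF generic_chord_diagram[OF D(1)] that, of "(v, u)"]
        chord_diagram_distinct_ends[OF generic_chord_diagram[OF D(1)] that] by auto
    have cyc: "(0, 1, 2) \<in> cyclic3" "(1, 2, 0) \<in> cyclic3" "(2, 0, 1) \<in> cyclic3"
      by (auto simp: cyclic3_def)
    have C: "over D = insert (e 0) (insert (e 1) (insert (e 2) C0))"
    proof (intro equalityI subsetI)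
      fix c assume c: "c \<in> over D"
      show "c \<in> insert (e 0) (insert (e 1) (insert (e 2) C0))"
      proof (cases "fst c \<in> U")
        case True
        then obtain p q where pq: "p < 3" "q < 3" "p \<noteq> q" "c = (T p q, T q p)" using inside[OF c] by blast
        have "\<exists>(k, l, m)\<in>cyclic3. c = e k"
          using cyclic3_cases2[OF pq(1-3)]
        proof (elim disjE exE)
          fix m assume m: "(p, q, m) \<in> cyclic3"
          then have "c = e p" using e[OF m] c pq(4) by simp
          then show ?thesis using m by blast
        next
          fix m assume m: "(q, p, m) \<in> cyclic3"
          then have "c = e q" using e[OF m] c asym[of "T p q" "T q p"] pq(4) by simp
          then show ?thesis using m by blast
        qed
        then show ?thesis by (auto simp: cyclic3_def)
      qed (use c in \<open>simp add: C0_def\<close>)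
    next
      fix c assume "c \<in> insert (e 0) (insert (e 1) (insert (e 2) C0))"
      then show "c \<in> over D" using e_over(1)[OF cyc(1)] e_over(1)[OF cyc(2)] e_over(1)[OF cyc(3)] by (auto simp: C0_def)
    qed
    have e_C0: "e 0 \<notin> C0" "e 1 \<notin> C0" "e 2 \<notin> C0"
      using e_over(2)[OF cyc(1)] e_over(2)[OF cyc(2)] e_over(2)[OF cyc(3)] by (simp_all add: C0_def del: UN_iff)
    have ends_C0: "t \<notin> U" if t: "t \<in> chord_ends C0" for t
    proof -
      obtain c where c: "c \<in> over D" "fst c \<notin> U" "t = fst c \<or> t = snd c" using t by (auto simp: chord_ends_def C0_def)
      then show ?thesis using over_inside[OF c(1)] by metis
    qed
    have s1: "s k = 1 \<or> s k = - 1" if "k < 3" for k using s[OF that] .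
    have T_less: "T k l < T k m \<longleftrightarrow> s k * R3_param k l < s k * R3_param k m"
      "T' k l < T' k m \<longleftrightarrow> s k * R3_param k m < s k * R3_param k l"
      "T k l = T k m \<longleftrightarrow> R3_param k l = R3_param k m" "T' k l = T' k m \<longleftrightarrow> R3_param k l = R3_param k m"
      if "k < 3" for k l m
      using time_less[OF that p_range(1) p_range(1)] time_less[OF that p_range(2) p_range(2)]
        time_eq[OF that p_range(1) p_range(1)] time_eq[OF that p_range(2) p_range(2)]
      by (simp_all add: T_def T'_def)
    have params: "R3_param k l \<noteq> R3_param k m" if "(k, l, m) \<in> cyclic3" for k l m
      using that by (auto simp: cyclic3_def R3_simps)
    have w_skew: "w l k = - w k l" if "(k, l, m) \<in> cyclic3" for k l m
      using that s1[of k] s1[of l] unfolding w_def det2_swap[of "R3_before' l (R3_param l k)"]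
      by (auto simp: cyclic3_def R3_simps)
    \<comment> \<open>The left ends of the time intervals rank the strands. The condition on signs
      compares the signs of the three model determinants -1, 7/6 and 7/6 with the order of the
      parameters 0 and \<plusminus>1/2 on the strands.\<close>
    have tri: "triangle T T' w a"
    proof
      fix k l m assume klm: "(k, l, m) \<in> cyclic3"
      note k = less[OF klm, THEN conjunct1]
      show "T k l \<noteq> T k m \<and> T' k l \<noteq> T' k m \<and> (T k l < T k m \<longleftrightarrow> T' k m < T' k l)"
        using params[OF klm] by (simp add: T_less k)
      show "w k l = order_sign (T k l) (T k m) * order_sign (T l k) (T l m)"
        unfolding w_def order_sign_def using klm s1[of 0] s1[of 1] s1[of 2]
        by (auto simp: T_less cyclic3_def R3_simps)
    next
      fix k l :: nat assume kl: "k < 3" "l < 3"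
      have "a k = a l \<Longrightarrow> k = l" using strand_unique[OF kl, of "a k"] ab[OF kl(1)] ab[OF kl(2)] by simp
      then show "a k = a l \<longleftrightarrow> k = l" by blast
    next
      fix k l i j :: nat assume kl: "k < 3" "l < 3" "k \<noteq> l"
      show "(T k i < T l j \<longleftrightarrow> a k < a l) \<and> (T' k i < T' l j \<longleftrightarrow> a k < a l)"
        using strands_apart[OF kl T_strand(1)[OF kl(1)] T_strand(1)[OF kl(2)]]
          strands_apart[OF kl T_strand(2)[OF kl(1)] T_strand(2)[OF kl(2)]] by blast
    qed
    show ?thesis unfolding gauss_def over'
    proof (rule triangle_step[OF tri generic_chord_diagram[OF D(1)] C e_C0])
      show "e k = (T k l, T l k) \<and> crossing_sign I D (e k) = w k l \<or>
          e k = (T l k, T k l) \<and> crossing_sign I D (e k) = - w k l" if klm: "(k, l, m) \<in> cyclic3" for k l m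
      proof -
        have kl: "k < 3" "l < 3" "k \<noteq> l" "l \<noteq> k" using less[OF klm] by auto
        then show ?thesis using e[OF klm] sign_T(1)[OF kl(1,2,3)] sign_T(1)[OF kl(2,1,4)] w_skew[OF klm] by auto
      qed
      show "(t < T k i \<longleftrightarrow> t < T k j) \<and> (t < T k i \<longleftrightarrow> t < T' k j)" if "t \<in> chord_ends C0" "k < 3" for t k i j
        using time_same_side[OF ends_C0[OF that(1)] that(2) p_range(1) p_range(1)]
          time_same_side[OF ends_C0[OF that(1)] that(2) p_range(1) p_range(2)]
        unfolding T_def T'_def by blast
      show "\<pi> t = t" if "t \<in> chord_ends C0" for t using \<pi>_out ends_C0[OF that] .
    qed (use \<pi>_T inj_\<pi> sign \<kappa>_\<pi> in auto)
  qed
qed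

section \<open>The polynomials of diagrams, knots and tangles\<close>

lemma reidemeister_step:
  assumes move: "reidemeister_move I M D D'" and D: "generic_diagram I D" "generic_diagram I D'"
    and \<kappa>: "\<And>a b. a \<le> b \<Longrightarrow> {a..b} \<subseteq> I \<Longrightarrow> \<kappa> a = \<kappa> b"
  shows "gauss_step \<kappa> (gauss I D) (gauss I D')"
  using move unfolding reidemeister_move_def
  by (elim disjE) (rule R1_step R2_step R3_step, assumption, rule D, rule D, erule (1) \<kappa>)+

section \<open>Equivalent diagrams have equivalent labelled chord diagrams\<close>

abbreviation one_strand :: "real \<Rightarrow> bool" where "one_strand \<equiv> \<lambda>_. False"
abbreviation on_B :: "real \<Rightarrow> bool" where "on_B \<equiv> \<lambda>t. 2 \<le> t"

lemma long_equiv_gauss: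
  assumes "(D, D') \<in> long_equiv" "long_diagram D"
  shows "long_diagram D' \<and> gauss_equiv one_strand (gauss UNIV D) (gauss UNIV D')"
  using assms(1) unfolding long_equiv_def
proof (induction rule: rtrancl_induct)
  case base
  then show ?case using assms(2) by simp
next
  case (step X Y)
  have *: "long_diagram A \<and> long_diagram B \<and> gauss_equiv one_strand (gauss UNIV A) (gauss UNIV B)"
    if "(A, B) \<in> long_step" for A B
  proof -
    have long: "long_diagram A" "long_diagram B"
      and or: "(\<exists>\<phi>. isotopic_via UNIV \<phi> A B) \<or> reidemeister_move UNIV UNIV A B"
      using that by (auto simp: long_step_def)
    have gen: "generic_diagram UNIV A" "generic_diagram UNIV B" using long by (auto simp: long_diagram_def)
    from or have "gauss_equiv one_strand (gauss UNIV A) (gauss UNIV B)"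
    proof
      assume "\<exists>\<phi>. isotopic_via UNIV \<phi> A B"
      then have "gauss_step one_strand (gauss UNIV B) (gauss UNIV A)"
        using isotopy_step[OF gen, where \<kappa> = one_strand] by auto
      then show ?thesis by (blast intro: equivclp_sym r_into_equivclp)
    next
      assume "reidemeister_move UNIV UNIV A B"
      then show ?thesis using reidemeister_step[OF _ gen, where \<kappa> = one_strand] by blast
    qed
    then show ?thesis using long by simp
  qed
  from step.hyps(2) have "long_diagram Y \<and> gauss_equiv one_strand (gauss UNIV X) (gauss UNIV Y)"
    using *[of X Y] *[of Y X] by (auto intro: equivclp_sym)
  then show ?case using step.IH by (blast intro: equivclp_trans)
qed

lemma on_B_interval:
  assumes "a \<le> b" "{a..b} \<subseteq> str_AB"
  shows "on_B a \<longleftrightarrow> on_B b"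
proof (rule ccontr)
  assume "\<not> ?thesis"
  then have "a < 2" "2 \<le> b" using assms(1) by auto
  moreover have "a \<in> str_AB" using assms by auto
  \<comment> \<open>The witness 3/2 lies in the gap between the two parameter intervals.\<close>
  ultimately have "3/2 \<in> {a..b}" by auto
  then have "3/2 \<in> str_AB" using assms(2) by (rule subsetD[rotated])
  then show False by simp
qed

text \<open>An increasing bijection of the two intervals fixes 0 and 3. If it carried a point of one
  string to the other, continuity would force a value 3/2 in the gap.\<close>

lemma on_B_reparam:
  assumes \<rho>: "increasing_reparam str_AB \<rho>" "bij_betw \<rho> str_AB str_AB" and t: "t \<in> str_AB"
  shows "on_B (\<rho> t) \<longleftrightarrow> on_B t"
proof -
  have cont: "continuous_on str_AB \<rho>"
    using \<rho>(1) unfolding increasing_reparam_def continuous_on_eq_continuous_within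
    by (meson DERIV_continuous)
  have mono: "u \<in> str_AB \<Longrightarrow> v \<in> str_AB \<Longrightarrow> u < v \<Longrightarrow> \<rho> u < \<rho> v" for u v
    using \<rho>(1) unfolding increasing_reparam_def by (meson strict_mono_onD)
  have range: "\<rho> u \<in> str_AB" if "u \<in> str_AB" for u using \<rho>(2) that by (rule bij_betw_apply)
  have surj: "\<exists>u\<in>str_AB. \<rho> u = v" if "v \<in> str_AB" for v
    using \<rho>(2) that unfolding bij_betw_def by (metis imageE)
  have "\<rho> 0 = 0"
  proof -
    have "0 \<in> str_AB" by simp
    from surj[OF this] obtain u where u: "u \<in> str_AB" "\<rho> u = 0" by (elim bexE)
    then have "\<not> 0 < u" using mono[of 0 u] range[of 0] by auto
    then show ?thesis using u by auto
  qed
  have "\<rho> 3 = 3"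
  proof -
    have "3 \<in> str_AB" by simp
    from surj[OF this] obtain u where u: "u \<in> str_AB" "\<rho> u = 3" by (elim bexE)
    then have "\<not> u < 3" using mono[of u 3] range[of 3] by auto
    then show ?thesis using u by auto
  qed
  have no_mid: "\<rho> x \<noteq> 3/2" if "x \<in> str_AB" for x using range[OF that] by auto
  show ?thesis
  proof (cases "on_B t")
    case True
    then have sub: "{t..3} \<subseteq> str_AB" using t by auto
    have "\<not> \<rho> t \<le> 3/2"
      using IVT'[of \<rho> t "3/2" 3] continuous_on_subset[OF cont sub] no_mid sub t True \<open>\<rho> 3 = 3\<close> by auto
    then show ?thesis using range[OF t] True by auto
  next
    case False
    then have sub: "{0..t} \<subseteq> str_AB" using t by auto
    have "\<not> 3/2 \<le> \<rho> t"
      using IVT'[of \<rho> 0 "3/2" t] continuous_on_subset[OF cont sub] no_mid sub t False \<open>\<rho> 0 = 0\<close> by auto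
    then show ?thesis using range[OF t] False by auto
  qed
qed

lemma str_AB_perfect:
  assumes "t \<in> str_AB"
  shows "at t within str_AB \<noteq> bot"
proof -
  have "t islimpt {0..1 :: real} \<or> t islimpt {2..3 :: real}" using assms by auto
  then have "t islimpt str_AB" using islimpt_subset[of t _ str_AB] by blast
  then show ?thesis using trivial_limit_within by blast
qed

lemma tangle_equiv_gauss:
  assumes "(E, E') \<in> tangle_equiv" "tangle_diagram E"
  shows "tangle_diagram E' \<and> gauss_equiv on_B (gauss str_AB E) (gauss str_AB E')"
  using assms(1) unfolding tangle_equiv_def
proof (induction rule: rtrancl_induct)
  case base
  then show ?case using assms(2) by simp
next
  case (step X Y)
  have *: "tangle_diagram A \<and> tangle_diagram B \<and> gauss_equiv on_B (gauss str_AB A) (gauss str_AB B)"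
    if "(A, B) \<in> tangle_step" for A B
  proof -
    have tangle: "tangle_diagram A" "tangle_diagram B"
      and or: "(\<exists>\<phi>. isotopic_via str_AB \<phi> A B) \<or> reidemeister_move str_AB (interior tangle_disk) A B"
      using that unfolding tangle_step_def by blast+
    have gen: "generic_diagram str_AB A" "generic_diagram str_AB B" using tangle by (auto simp: tangle_diagram_def)
    from or have "gauss_equiv on_B (gauss str_AB A) (gauss str_AB B)"
    proof
      assume "\<exists>\<phi>. isotopic_via str_AB \<phi> A B"
      then obtain \<phi> where "isotopic_via str_AB \<phi> A B" by blast
      then have "gauss_step on_B (gauss str_AB B) (gauss str_AB A)"
        by (rule isotopy_step[OF gen]) (use str_AB_perfect on_B_reparam in blast)+
      then show ?thesis by (blast intro: equivclp_sym r_into_equivclp)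
    next
      assume "reidemeister_move str_AB (interior tangle_disk) A B"
      then have "gauss_step on_B (gauss str_AB A) (gauss str_AB B)"
        by (rule reidemeister_step[OF _ gen]) (rule on_B_interval)
      then show ?thesis by blast
    qed
    then show ?thesis using tangle by simp
  qed
  from step.hyps(2) have "tangle_diagram Y \<and> gauss_equiv on_B (gauss str_AB X) (gauss str_AB Y)"
    using *[of X Y] *[of Y X] by (auto intro: equivclp_sym)
  then show ?case using step.IH by (blast intro: equivclp_trans)
qed

lemma knot_members:
  assumes "K \<in> long_virtual_knots" "D \<in> K" "D' \<in> K"
  shows "long_diagram D" "gauss_equiv one_strand (gauss UNIV D) (gauss UNIV D')"
proof -
  obtain D0 where D0: "long_diagram D0" "K = long_equiv `` {D0}"
    using assms(1) unfolding long_virtual_knots_def by (auto elim: quotientE)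
  have "(D0, D) \<in> long_equiv" "(D0, D') \<in> long_equiv" using assms(2,3) D0(2) by auto
  from this[THEN long_equiv_gauss[OF _ D0(1)]]
  show "long_diagram D" "gauss_equiv one_strand (gauss UNIV D) (gauss UNIV D')"
    by (auto intro: equivclp_trans equivclp_sym)
qed

lemma tangle_members:
  assumes "T \<in> virtual_tangles" "E \<in> T" "E' \<in> T"
  shows "tangle_diagram E" "gauss_equiv on_B (gauss str_AB E) (gauss str_AB E')"
proof -
  obtain E0 where E0: "tangle_diagram E0" "T = tangle_equiv `` {E0}"
    using assms(1) unfolding virtual_tangles_def by (auto elim: quotientE)
  have "(E0, E) \<in> tangle_equiv" "(E0, E') \<in> tangle_equiv" using assms(2,3) E0(2) by auto
  from this[THEN tangle_equiv_gauss[OF _ E0(1)]]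
  show "tangle_diagram E" "gauss_equiv on_B (gauss str_AB E) (gauss str_AB E')"
    by (auto intro: equivclp_trans equivclp_sym)
qed

text \<open>A value exists because every diagram has a surface realization. It is unique because it
  is computed from the chord diagram alone, up to equivalence.\<close>

lemma knot_value_eq:
  assumes K: "K \<in> long_virtual_knots" "D \<in> K"
    and \<Phi>: "\<And>D S f. generic_diagram UNIV D \<Longrightarrow> surface_realization D S f \<Longrightarrow> \<Phi> D S f = \<Psi> (gauss UNIV D)"
    and inv: "\<And>G G'. gauss_equiv one_strand G G' \<Longrightarrow> \<Psi> G = \<Psi> G'"
  shows "knot_value \<Phi> K = \<Psi> (gauss UNIV D)"
  unfolding knot_value_def
proof (rule the_equality)
  have gen: "generic_diagram UNIV D'" if "D' \<in> K" for D'
    using knot_members(1)[OF K(1) that K(2)] by (simp add: long_diagram_def)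
  obtain S f where "surface_realization D S f" using surface_realization_exists[OF gen[OF K(2)]] .
  then show "\<exists>D'\<in>K. \<exists>S f. surface_realization D' S f \<and> \<Psi> (gauss UNIV D) = \<Phi> D' S f"
    using \<Phi>[OF gen[OF K(2)]] K(2) by metis
  fix p assume "\<exists>D'\<in>K. \<exists>S f. surface_realization D' S f \<and> p = \<Phi> D' S f"
  then obtain D' S f where "D' \<in> K" "surface_realization D' S f" "p = \<Phi> D' S f" by blast
  then show "p = \<Psi> (gauss UNIV D)"
    using \<Phi>[OF gen] inv[OF knot_members(2)[OF K(1), of D' D]] K(2) by simp
qed

section \<open>The polynomials of a diagram as sums over chords\<close>

definition type_label :: "nat \<Rightarrow> (bool \<times> bool \<times> bool) set" where
  "type_label a = typed {a = 0}"

definition self_label :: "nat \<Rightarrow> (bool \<times> bool \<times> bool) set" where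
  "self_label a = {l. fst l = (a = 0) \<and> fst (snd l) = snd (snd l)}"

definition mixed_label :: "nat \<Rightarrow> (bool \<times> bool \<times> bool) set" where
  "mixed_label a = {l. fst l = (a = 0) \<and> fst (snd l) \<noteq> snd (snd l)}"

lemma crossing_type_label: "a \<in> {0, 1} \<Longrightarrow> crossing_type c = a \<longleftrightarrow> label \<kappa> c \<in> type_label a"
  by (auto simp: crossing_type_def type_label_def typed_def label_def)

text \<open>
  The arguments \<open>m\<close>, \<open>n\<close>, \<open>i\<close> stand for \<open>\<alpha>\<^sub>c \<bullet> \<gamma>\<close>, \<open>\<alpha>\<^sub>d \<bullet> \<gamma>\<close> and the undivided pairing
  \<open>4 (\<alpha>\<^sub>c \<bullet> \<alpha>\<^sub>d)\<close>.
\<close>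

definition \<Phi>_F :: "int \<Rightarrow> int \<Rightarrow> int \<Rightarrow> laurent" where
  "\<Phi>_F m n i = tpow (i div 4) - 1"

definition \<Phi>_G :: "int \<Rightarrow> int \<Rightarrow> int \<Rightarrow> laurent" where
  "\<Phi>_G m n i = tpow ((4 * m - i) div 4) - tpow m"

text \<open>Both correction terms are themselves double sums over the same pairs of chords, with
  terms \<open>tpow n - 1\<close> and \<open>tpow (- m) - 1\<close>. Collecting the three constants
  leaves \<open>+ 1\<close>.\<close>

definition \<Phi>_H :: "int \<Rightarrow> int \<Rightarrow> int \<Rightarrow> laurent" where
  "\<Phi>_H m n i = tpow ((4 * n - 4 * m + i) div 4) - tpow n - tpow (- m) + 1"

lemma tpow_0: "tpow 0 = 1"
  by (simp add: tpow_def)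

lemma tpow_add: "tpow (m + n) = tpow m * tpow n"
  by (simp add: tpow_def mult_single)

text \<open>The condition for losing kinks. For \<open>G\<close> and \<open>H\<close> it is the
  correction terms that make it true.\<close>

lemma \<Phi>_zero:
  "\<Phi>_F 0 n 0 = 0" "\<Phi>_F n 0 0 = 0" "\<Phi>_G 0 n 0 = 0" "\<Phi>_G n 0 0 = 0" "\<Phi>_H 0 n 0 = 0" "\<Phi>_H n 0 0 = 0"
proof -
  have "- (4 * n) div 4 = - n" by presburger
  then show "\<Phi>_F 0 n 0 = 0" "\<Phi>_F n 0 0 = 0" "\<Phi>_G 0 n 0 = 0" "\<Phi>_G n 0 0 = 0" "\<Phi>_H 0 n 0 = 0" "\<Phi>_H n 0 0 = 0"
    by (simp_all add: \<Phi>_F_def \<Phi>_G_def \<Phi>_H_def tpow_0)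
qed

lemma tinv_add: "tinv (p + q) = tinv p + tinv q"
  unfolding tinv_def by (rule map_key_plus) simp

lemma tinv_0: "tinv 0 = 0"
  by (simp add: tinv_def)

lemma tinv_minus: "tinv (- p) = - tinv p"
  using tinv_add[of p "- p"] tinv_0 by (simp add: eq_neg_iff_add_eq_0 add.commute)

lemma tinv_tpow: "tinv (tpow n) = tpow (- n)"
  unfolding tinv_def tpow_def using map_key_single[of "uminus :: int \<Rightarrow> int" "- n"] by simp

lemma tinv_of_nat: "tinv (of_nat k * p) = of_nat k * tinv p"
  by (induction k) (simp_all add: tinv_0 tinv_add algebra_simps)

lemma tinv_of_int: "tinv (of_int k * p) = of_int k * tinv p"
  by (cases k rule: int_cases2) (simp_all add: tinv_of_nat tinv_minus)

lemma tinv_sum: "tinv (sum h A) = (\<Sum>x\<in>A. tinv (h x))"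
  by (induction A rule: infinite_finite_induct) (simp_all add: tinv_0 tinv_add)

lemma tinv_tpow_minus_1: "tinv (tpow n - 1) = tpow (- n) - 1"
proof -
  have "tinv (tpow n - 1) = tinv (tpow n + - tpow 0)" by (simp add: tpow_0)
  also have "\<dots> = tpow (- n) - 1" unfolding tinv_add tinv_minus tinv_tpow by (simp add: tpow_0)
  finally show ?thesis .
qed

lemma tinv_chord_sum: "tinv (chord_sum \<kappa> L \<Psi> G) = chord_sum \<kappa> L (\<lambda>m. tinv (\<Psi> m)) G"
  unfolding chord_sum_def tinv_sum by (rule sum.cong) (simp_all add: tinv_of_int tinv_0)

context realization begin

lemma finite_over: "finite (over D)"
  using chord by (rule chord_diagram_finite)

lemma W_diag_chord_sum:
  assumes "a \<in> {0, 1}"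
  shows "W_diag a D S f = chord_sum \<kappa> (type_label a) (\<lambda>m. tpow m - 1) (gauss UNIV D)"
  unfolding W_diag_def chord_sum_def crossings_of_type_def gauss_def Let_def fst_conv snd_conv
    sum.inter_filter[OF finite_over] crossing_type_label[OF assms, of _ \<kappa>]
  by (rule sum.cong) (simp_all add: intersections)

lemma writhe_chord_sum:
  assumes "a \<in> {0, 1}"
  shows "of_int (writhe_of_type a D) = chord_sum \<kappa> (type_label a) (\<lambda>m. 1) (gauss UNIV D)"
  unfolding writhe_of_type_def chord_sum_def crossings_of_type_def gauss_def fst_conv snd_conv of_int_sum
    sum.inter_filter[OF finite_over] crossing_type_label[OF assms, of _ \<kappa>] by (rule sum.cong) simp_all

lemma double_sum:
  fixes h :: "real \<times> real \<Rightarrow> real \<times> real \<Rightarrow> laurent"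
  assumes "a \<in> {0, 1}" "b \<in> {0, 1}"
  shows "(\<Sum>c\<in>crossings_of_type a D. \<Sum>d\<in>crossings_of_type b D. h c d) =
    (\<Sum>c\<in>over D. \<Sum>d\<in>over D. if label \<kappa> c \<in> type_label a \<and> label \<kappa> d \<in> type_label b then h c d else 0)"
  unfolding crossings_of_type_def sum.inter_filter[OF finite_over]
    crossing_type_label[OF assms(1), of _ \<kappa>] crossing_type_label[OF assms(2), of _ \<kappa>]
  by (rule sum.cong[OF refl]) (auto intro!: sum.cong sum.neutral)

lemma chord_sum_product:
  "chord_sum \<kappa> L A (gauss UNIV D) * chord_sum \<kappa> M B (gauss UNIV D) =
    chord_sum2 \<kappa> L M (\<lambda>m n i. A m * B n) (gauss UNIV D)"
  unfolding chord_sum_def chord_sum2_def sum_product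
  by (intro sum.cong refl) (simp add: algebra_simps)

lemma chord_sum2_diff:
  "chord_sum2 \<kappa> L M \<Phi> G - chord_sum2 \<kappa> L M \<Phi>' G = chord_sum2 \<kappa> L M (\<lambda>m n i. \<Phi> m n i - \<Phi>' m n i) G"
  unfolding chord_sum2_def sum_subtractf[symmetric]
  by (intro sum.cong refl) (simp add: algebra_simps)

lemma F_diag_chord_sum:
  assumes "a \<in> {0, 1}" "b \<in> {0, 1}"
  shows "F_diag a b D S f = chord_sum2 \<kappa> (type_label a) (type_label b) \<Phi>_F (gauss UNIV D)"
  unfolding F_diag_def Let_def double_sum[OF assms, of _ \<kappa>] chord_sum2_def gauss_def fst_conv snd_conv
  by (intro sum.cong refl) (simp add: intersections \<Phi>_F_def)

text \<open>A writhe is a chord sum with constant term 1, so its product with \<open>W\<close> is a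
  double sum and can be merged with the main sum of \<open>G\<close> or \<open>H\<close>.\<close>

lemma writhe_W_product:
  assumes "a \<in> {0, 1}" "b \<in> {0, 1}"
  shows "of_int (writhe_of_type b D) * W_diag a D S f =
      chord_sum2 \<kappa> (type_label a) (type_label b) (\<lambda>m n i. (tpow m - 1) * 1) (gauss UNIV D)"
    "of_int (writhe_of_type a D) * W_diag b D S f =
      chord_sum2 \<kappa> (type_label a) (type_label b) (\<lambda>m n i. 1 * (tpow n - 1)) (gauss UNIV D)"
    "of_int (writhe_of_type b D) * tinv (W_diag a D S f) =
      chord_sum2 \<kappa> (type_label a) (type_label b) (\<lambda>m n i. (tpow (- m) - 1) * 1) (gauss UNIV D)"
  unfolding chord_sum_product[symmetric] writhe_chord_sum[OF assms(1), of \<kappa>] writhe_chord_sum[OF assms(2), of \<kappa>]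
    W_diag_chord_sum[OF assms(1), of \<kappa>] W_diag_chord_sum[OF assms(2), of \<kappa>] tinv_chord_sum tinv_tpow_minus_1
  by (rule mult.commute refl)+

lemma G_diag_chord_sum:
  assumes "a \<in> {0, 1}" "b \<in> {0, 1}"
  shows "G_diag a b D S f = chord_sum2 \<kappa> (type_label a) (type_label b) \<Phi>_G (gauss UNIV D)"
proof -
  have "G_diag a b D S f = chord_sum2 \<kappa> (type_label a) (type_label b) (\<lambda>m n i. tpow ((4 * m - i) div 4) - 1) (gauss UNIV D)
    - of_int (writhe_of_type b D) * W_diag a D S f"
    unfolding G_diag_def Let_def double_sum[OF assms, of _ \<kappa>]
    by (simp only: chord_sum2_def gauss_def fst_conv snd_conv)
      (intro arg_cong2[of _ _ _ _ minus] sum.cong refl, simp add: intersections)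
  also have "\<dots> = chord_sum2 \<kappa> (type_label a) (type_label b) \<Phi>_G (gauss UNIV D)"
    unfolding writhe_W_product[OF assms, of \<kappa>] chord_sum2_diff
    by (rule arg_cong[where f = "\<lambda>\<Phi>. chord_sum2 \<kappa> _ _ \<Phi> _"]) (intro ext, simp add: \<Phi>_G_def)
  finally show ?thesis .
qed

lemma H_diag_chord_sum:
  assumes "a \<in> {0, 1}" "b \<in> {0, 1}"
  shows "H_diag a b D S f = chord_sum2 \<kappa> (type_label a) (type_label b) \<Phi>_H (gauss UNIV D)"
proof -
  have "H_diag a b D S f = chord_sum2 \<kappa> (type_label a) (type_label b) (\<lambda>m n i. tpow ((4 * n - 4 * m + i) div 4) - 1) (gauss UNIV D)
    - of_int (writhe_of_type a D) * W_diag b D S f - of_int (writhe_of_type b D) * tinv (W_diag a D S f)"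
    unfolding H_diag_def Let_def double_sum[OF assms, of _ \<kappa>]
    by (simp only: chord_sum2_def gauss_def fst_conv snd_conv)
      (intro arg_cong2[of _ _ _ _ minus] sum.cong refl, simp add: intersections)
  also have "\<dots> = chord_sum2 \<kappa> (type_label a) (type_label b) \<Phi>_H (gauss UNIV D)"
    unfolding writhe_W_product[OF assms, of \<kappa>] chord_sum2_diff
    by (rule arg_cong[where f = "\<lambda>\<Phi>. chord_sum2 \<kappa> _ _ \<Phi> _"]) (intro ext, simp add: \<Phi>_H_def)
  finally show ?thesis .
qed

end

text \<open>Lets one pass from the two strings of a tangle to the single strand of its
  closure.\<close>

lemma chord_sum_typed: "chord_sum \<kappa> (type_label a) \<Psi> G = chord_sum \<kappa>' (type_label a) \<Psi> G"
  by (simp add: chord_sum_def type_label_def typed_def label_def)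

lemma chord_sum2_typed:
  "chord_sum2 \<kappa> (type_label a) (type_label b) \<Phi> G = chord_sum2 \<kappa>' (type_label a) (type_label b) \<Phi> G"
  by (simp add: chord_sum2_def type_label_def typed_def label_def)

section \<open>The sum of a tangle and a knot\<close>

context chord_insertion begin

lemma label_cases:
  "label \<kappa> c \<in> mixed_label a \<longleftrightarrow> label \<kappa> c \<in> type_label a \<and> separating c"
  "label \<kappa> c \<in> self_label a \<longleftrightarrow> label \<kappa> c \<in> type_label a \<and> \<not> separating c"
  by (auto simp: mixed_label_def self_label_def type_label_def typed_def label_def separating_def)

lemma chord_sum_X:
  "chord_sum \<kappa>' (type_label a) \<Psi> (X, \<epsilon>) =
    chord_sum \<kappa> (type_label a) \<Psi> (E, \<epsilon>E) + chord_sum \<kappa>'' (type_label a) \<Psi> (D, \<epsilon>D)"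
  unfolding chord_sum_def fst_conv snd_conv sum_X type_label_def
  by (intro arg_cong2[of _ _ _ _ plus] sum.cong refl)
    (simp_all add: index_X signs label_typed(1)[of _ \<kappa>' _ \<kappa>] label_typed(2)[of _ \<kappa>' _ \<kappa>''])

text \<open>With \<open>i\<close> the index of the tangle chord and \<open>j\<close> that of the
  knot chord, the pairing in a mixed term is \<plusminus>\<open>4 * j\<close> or 0 according to
  whether the tangle chord joins the strings. So each mixed block factors once \<open>\<Phi>\<close>
  does at these values; the four assumptions are the four blocks.\<close>

lemma chord_sum2_X:
  assumes \<Phi>: "\<And>i j. \<Phi> i j (- (4 * j)) = A1 i * B1 j" "\<And>i j. \<Phi> i j 0 = A2 i * B2 j"
    "\<And>i j. \<Phi> j i (4 * j) = B3 j * A3 i" "\<And>i j. \<Phi> j i 0 = B4 j * A4 i"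
  shows "chord_sum2 \<kappa>' (type_label a) (type_label b) \<Phi> (X, \<epsilon>) =
    chord_sum2 \<kappa> (type_label a) (type_label b) \<Phi> (E, \<epsilon>E) + chord_sum2 \<kappa>'' (type_label a) (type_label b) \<Phi> (D, \<epsilon>D)
    + chord_sum \<kappa> (mixed_label a) A1 (E, \<epsilon>E) * chord_sum \<kappa>'' (type_label b) B1 (D, \<epsilon>D)
    + chord_sum \<kappa> (self_label a) A2 (E, \<epsilon>E) * chord_sum \<kappa>'' (type_label b) B2 (D, \<epsilon>D)
    + chord_sum \<kappa>'' (type_label a) B3 (D, \<epsilon>D) * chord_sum \<kappa> (mixed_label b) A3 (E, \<epsilon>E)
    + chord_sum \<kappa>'' (type_label a) B4 (D, \<epsilon>D) * chord_sum \<kappa> (self_label b) A4 (E, \<epsilon>E)"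
proof -
  define h where "h c d = (if label \<kappa>' c \<in> type_label a \<and> label \<kappa>' d \<in> type_label b
     then of_int (\<epsilon> c * \<epsilon> d) * \<Phi> (index X \<epsilon> c) (index X \<epsilon> d) (pairing X \<epsilon> (chord_arc c) (chord_arc d)) else 0)" for c d
  let ?\<sigma> = "map_prod \<sigma> \<sigma>" and ?\<tau> = "map_prod \<tau> \<tau>"
  have lab: "label \<kappa>' (?\<sigma> c) \<in> type_label e \<longleftrightarrow> label \<kappa> c \<in> type_label e" if "c \<in> E" for c e
    using label_typed(1)[OF that] unfolding type_label_def by blast
  have lab': "label \<kappa>' (?\<tau> d) \<in> type_label e \<longleftrightarrow> label \<kappa>'' d \<in> type_label e" if "d \<in> D" for d e
    using label_typed(2)[OF that] unfolding type_label_def by blast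
  have "chord_sum2 \<kappa>' (type_label a) (type_label b) \<Phi> (X, \<epsilon>) = (\<Sum>c\<in>X. \<Sum>d\<in>X. h c d)"
    by (simp only: chord_sum2_def fst_conv snd_conv h_def)
  also have "\<dots> = (\<Sum>c\<in>E. \<Sum>d\<in>E. h (?\<sigma> c) (?\<sigma> d)) + (\<Sum>c\<in>E. \<Sum>d\<in>D. h (?\<sigma> c) (?\<tau> d))
      + ((\<Sum>c\<in>D. \<Sum>d\<in>E. h (?\<tau> c) (?\<sigma> d)) + (\<Sum>c\<in>D. \<Sum>d\<in>D. h (?\<tau> c) (?\<tau> d)))"
    by (simp only: sum_X sum.distrib add_ac)
  also have "(\<Sum>c\<in>E. \<Sum>d\<in>E. h (?\<sigma> c) (?\<sigma> d)) = chord_sum2 \<kappa> (type_label a) (type_label b) \<Phi> (E, \<epsilon>E)"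
    unfolding chord_sum2_def fst_conv snd_conv h_def
    by (intro sum.cong refl) (simp add: lab index_X signs pairing_EE)
  also have "(\<Sum>c\<in>D. \<Sum>d\<in>D. h (?\<tau> c) (?\<tau> d)) = chord_sum2 \<kappa>'' (type_label a) (type_label b) \<Phi> (D, \<epsilon>D)"
    unfolding chord_sum2_def fst_conv snd_conv h_def
    by (intro sum.cong refl) (simp add: lab' index_X signs pairing_DD)
  also have "(\<Sum>c\<in>E. \<Sum>d\<in>D. h (?\<sigma> c) (?\<tau> d)) =
      chord_sum \<kappa> (mixed_label a) A1 (E, \<epsilon>E) * chord_sum \<kappa>'' (type_label b) B1 (D, \<epsilon>D)
      + chord_sum \<kappa> (self_label a) A2 (E, \<epsilon>E) * chord_sum \<kappa>'' (type_label b) B2 (D, \<epsilon>D)"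
    unfolding chord_sum_def fst_conv snd_conv h_def sum_product sum.distrib[symmetric]
    by (intro sum.cong refl) (simp add: lab lab' index_X signs pairing_ED label_cases \<Phi>)
  also have "(\<Sum>c\<in>D. \<Sum>d\<in>E. h (?\<tau> c) (?\<sigma> d)) =
      chord_sum \<kappa>'' (type_label a) B3 (D, \<epsilon>D) * chord_sum \<kappa> (mixed_label b) A3 (E, \<epsilon>E)
      + chord_sum \<kappa>'' (type_label a) B4 (D, \<epsilon>D) * chord_sum \<kappa> (self_label b) A4 (E, \<epsilon>E)"
    unfolding chord_sum_def fst_conv snd_conv h_def sum_product sum.distrib[symmetric]
    by (intro sum.cong refl) (simp add: lab lab' index_X signs pairing_DE label_cases \<Phi>(3,4))
  finally show ?thesis by (simp only: ac_simps)
qed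

end

lemma chord_sum_zero [simp]: "chord_sum \<kappa> L (\<lambda>_. 0) G = 0"
  by (auto simp: chord_sum_def intro!: sum.neutral)

lemma chord_sum_minus: "chord_sum \<kappa> L (\<lambda>m. - \<Psi> m) G = - chord_sum \<kappa> L \<Psi> G"
  unfolding chord_sum_def sum_negf[symmetric] by (rule sum.cong) simp_all

text \<open>These factors are the origin of all terms in the result. A factor \<plusminus>1 sums to
  a linking number, \<open>tpow i\<close> to \<open>V\<close>, and \<open>tpow (- i) - 1\<close> to
  \<open>U\<close> at the inverse of \<open>t\<close>; the factors in \<open>j\<close> sum to
  \<open>W\<close> or its inverse substitution. The zeros say that self-crossings of the strings do
  not interact with the knot in \<open>F\<close> and \<open>G\<close>.\<close>

lemma \<Phi>_values:
  "\<Phi>_F i j (- (4 * j)) = 1 * (tpow (- j) - 1)" "\<Phi>_F i j 0 = 0 * 0" "\<Phi>_F j i (4 * j) = (tpow j - 1) * 1"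
  "\<Phi>_G i j (- (4 * j)) = tpow i * (tpow j - 1)" "\<Phi>_G i j 0 = 0 * 0" "\<Phi>_G j i (4 * j) = - (tpow j - 1) * 1"
  "\<Phi>_H i j (- (4 * j)) = - 1 * (tpow j - 1)" "\<Phi>_H i j 0 = (tpow (- i) - 1) * (tpow j - 1)"
  "\<Phi>_H j i (4 * j) = - (tpow (- j) - 1) * 1"
proof -
  have div: "- (4 * j) div 4 = - j" "(4 * i - - (4 * j)) div 4 = i + j" "(4 * j - 4 * i + - (4 * j)) div 4 = - i"
    "(4 * j - 4 * i) div 4 = - i + j" "(4 * i - 4 * j + 4 * j) div 4 = i"
    by presburger+
  have diff: "tpow (j - i) = tpow j * tpow (- i)" using tpow_add[of j "- i"] by simp
  show "\<Phi>_F i j (- (4 * j)) = 1 * (tpow (- j) - 1)" "\<Phi>_F i j 0 = 0 * 0" "\<Phi>_F j i (4 * j) = (tpow j - 1) * 1"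
    "\<Phi>_G i j (- (4 * j)) = tpow i * (tpow j - 1)" "\<Phi>_G i j 0 = 0 * 0" "\<Phi>_G j i (4 * j) = - (tpow j - 1) * 1"
    "\<Phi>_H i j (- (4 * j)) = - 1 * (tpow j - 1)" "\<Phi>_H i j 0 = (tpow (- i) - 1) * (tpow j - 1)"
    "\<Phi>_H j i (4 * j) = - (tpow (- j) - 1) * 1"
    unfolding \<Phi>_F_def \<Phi>_G_def \<Phi>_H_def div by (simp_all add: div diff tpow_0 tpow_add algebra_simps)
qed

section \<open>Closures, tangle invariants and sums\<close>

lemma closure_sign:
  assumes cl: "right_closure_diagram E X \<sigma>" and c: "c \<in> over E"
  shows "crossing_sign UNIV X (map_prod \<sigma> \<sigma> c) = crossing_sign str_AB E c"
proof -
  obtain h where E: "tangle_diagram E" and X: "long_diagram X" and \<sigma>: "increasing_reparam str_AB \<sigma>"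
    and h: "oriented_diffeo h" "\<And>t. t \<in> str_AB \<Longrightarrow> curve X (\<sigma> t) = h (curve E t)"
    using cl unfolding right_closure_diagram_def by blast
  have gen: "generic_diagram UNIV X" "generic_diagram str_AB E"
    using E X by (auto simp: tangle_diagram_def long_diagram_def)
  note dp = over_double_points[OF gen(2) c]
  have "crossing_sign UNIV X (\<sigma> (fst c), \<sigma> (snd c)) = crossing_sign str_AB E (fst c, snd c)"
    using dp by (intro crossing_sign_transport[OF gen str_AB_perfect \<sigma> _ increasing_reparam_id _ h]) auto
  then show ?thesis by (cases c) simp
qed

lemma closure_over:
  assumes "right_closure_diagram E X \<sigma>"
  shows "generic_diagram str_AB E" "generic_diagram UNIV X" "over X = map_prod \<sigma> \<sigma> ` over E"
    "strict_mono_on (chord_ends (over E)) \<sigma>"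
proof -
  show gen: "generic_diagram str_AB E" "generic_diagram UNIV X" and "over X = map_prod \<sigma> \<sigma> ` over E"
    using assms by (simp_all add: right_closure_diagram_def tangle_diagram_def long_diagram_def)
  have "strict_mono_on str_AB \<sigma>"
    using assms by (simp add: right_closure_diagram_def increasing_reparam_def)
  then show "strict_mono_on (chord_ends (over E)) \<sigma>"
    using chord_ends_over_subset[OF gen(1)] by (meson monotone_on_subset)
qed

lemma closure_step:
  assumes cl: "right_closure_diagram E X \<sigma>"
  shows "gauss_step one_strand (gauss str_AB E) (gauss UNIV X)"
  unfolding gauss_def closure_over(3)[OF cl]
  by (rule order_iso_step[OF closure_over(4)[OF cl]]) (simp_all add: closure_sign[OF cl])

text \<open>The exponent is read off the chords of \<open>E\<close> itself, so it depends neither on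
  the closure nor on its surface.\<close>

lemma tangle_index_closure:
  assumes cl: "right_closure_diagram E X \<sigma>" and real: "surface_realization X S f" and c: "c \<in> over E"
  shows "tangle_index S (f \<circ> \<sigma>) c = index (over E) (crossing_sign str_AB E) c"
proof -
  interpret realization X S f
    using real generic_chord_diagram[OF closure_over(2)[OF cl]] by unfold_locales
  have "map_prod (f \<circ> \<sigma>) (f \<circ> \<sigma>) c = map_prod f f (map_prod \<sigma> \<sigma> c)" by (cases c) simp
  then have "tangle_index S (f \<circ> \<sigma>) c = index (over X) (crossing_sign UNIV X) (map_prod \<sigma> \<sigma> c)"
    using intersections(4)[of "map_prod \<sigma> \<sigma> c" "map_prod \<sigma> \<sigma> c"] c by (simp add: tangle_index_def closure_over(3)[OF cl])
  also have "\<dots> = index (over E) (crossing_sign str_AB E) c"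
    unfolding index_def closure_over(3)[OF cl]
    by (rule arg_cong[where f = "\<lambda>x. x div 4"], rule pairing_chord_arc_image(2)[OF closure_over(4)[OF cl] order_refl])
      (use c closure_sign[OF cl] in auto)
  finally show ?thesis .
qed

lemma J_labels:
  assumes E: "generic_diagram str_AB E" and a: "a \<in> {0, 1}"
  shows "J_self a E = {c \<in> over E. label on_B c \<in> self_label a}"
    "J_mixed a E = {c \<in> over E. label on_B c \<in> mixed_label a}"
proof -
  have "c \<in> str_A \<times> str_A \<union> str_B \<times> str_B \<longleftrightarrow> on_B (fst c) = on_B (snd c)"
    "c \<in> str_A \<times> str_B \<union> str_B \<times> str_A \<longleftrightarrow> on_B (fst c) \<noteq> on_B (snd c)" if "c \<in> over E" for c
    using over_double_points(1,2)[OF E that] by (cases c; auto)+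
  then show "J_self a E = {c \<in> over E. label on_B c \<in> self_label a}"
    "J_mixed a E = {c \<in> over E. label on_B c \<in> mixed_label a}"
    using a by (auto simp: J_self_def J_mixed_def self_label_def mixed_label_def label_def crossing_type_def)
qed

lemma UV_diag_chord_sum:
  assumes cl: "right_closure_diagram E X \<sigma>" and real: "surface_realization X S f" and a: "a \<in> {0, 1}"
  shows "U_diag a E S (f \<circ> \<sigma>) = chord_sum on_B (self_label a) (\<lambda>m. tpow m - 1) (gauss str_AB E)"
    "V_diag a E S (f \<circ> \<sigma>) = chord_sum on_B (mixed_label a) tpow (gauss str_AB E)"
proof -
  have fin: "finite (over E)" using chord_diagram_finite[OF generic_chord_diagram[OF closure_over(1)[OF cl]]] .
  note J = J_labels[OF closure_over(1)[OF cl] a]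
  show "U_diag a E S (f \<circ> \<sigma>) = chord_sum on_B (self_label a) (\<lambda>m. tpow m - 1) (gauss str_AB E)"
    "V_diag a E S (f \<circ> \<sigma>) = chord_sum on_B (mixed_label a) tpow (gauss str_AB E)"
    unfolding U_diag_def V_diag_def chord_sum_def gauss_def fst_conv snd_conv J sum.inter_filter[OF fin]
    by (auto intro!: sum.cong simp: tangle_index_closure[OF cl real])
qed

text \<open>One closure, of some \<open>E1\<close> in the class, provides a value; invariance
  carries it to any other member \<open>E\<close>, in particular to the diagram used in a
  sum.\<close>

lemma tangle_value_eq:
  assumes T: "T \<in> virtual_tangles" "E \<in> T" and closure: "E1 \<in> T" "right_closure_diagram E1 X1 \<sigma>1"
    and \<Phi>: "\<And>E X \<sigma> S f. right_closure_diagram E X \<sigma> \<Longrightarrow> surface_realization X S f \<Longrightarrow> \<Phi> E S (f \<circ> \<sigma>) = \<Psi> (gauss str_AB E)"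
    and inv: "\<And>G G'. gauss_equiv on_B G G' \<Longrightarrow> \<Psi> G = \<Psi> G'"
  shows "tangle_value \<Phi> T = \<Psi> (gauss str_AB E)"
  unfolding tangle_value_def
proof (rule the_equality)
  have same: "\<Psi> (gauss str_AB E') = \<Psi> (gauss str_AB E)" if "E' \<in> T" for E'
    using inv[OF tangle_members(2)[OF T(1) that T(2)]] .
  obtain S f where "surface_realization X1 S f" using surface_realization_exists[OF closure_over(2)[OF closure(2)]] .
  then have "surface_realization X1 S f \<and> \<Psi> (gauss str_AB E) = \<Phi> E1 S (f \<circ> \<sigma>1)"
    using \<Phi>[OF closure(2)] same[OF closure(1)] by simp
  then show "\<exists>E'\<in>T. \<exists>X \<sigma> S f. right_closure_diagram E' X \<sigma> \<and> surface_realization X S f \<and>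
      \<Psi> (gauss str_AB E) = \<Phi> E' S (f \<circ> \<sigma>)"
    using closure by blast
  fix p assume "\<exists>E'\<in>T. \<exists>X \<sigma> S f. right_closure_diagram E' X \<sigma> \<and> surface_realization X S f \<and> p = \<Phi> E' S (f \<circ> \<sigma>)"
  then obtain E' X \<sigma> S f where *: "E' \<in> T" "right_closure_diagram E' X \<sigma>" "surface_realization X S f" "p = \<Phi> E' S (f \<circ> \<sigma>)"
    by (elim bexE exE conjE)
  show "p = \<Psi> (gauss str_AB E)" using \<Phi>[OF *(2,3)] same[OF *(1)] *(4) by simp
qed

text \<open>The constant function 1 does not vanish at 0, but mixed labels have ends on different
  strings and so exclude kinks.\<close>

lemma linking_eq:
  assumes T: "T \<in> virtual_tangles" "E \<in> T" and a: "a \<in> {0, 1}"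
  shows "of_int (linking a T) = (chord_sum on_B (mixed_label a) (\<lambda>_. 1) (gauss str_AB E) :: laurent)"
proof -
  have sum: "(\<Sum>c\<in>J_mixed a E'. tsign E' c) = chord_sum on_B (mixed_label a) (\<lambda>_. 1) (gauss str_AB E')" if "E' \<in> T" for E'
  proof -
    have gen: "generic_diagram str_AB E'" using tangle_members(1)[OF T(1) that T(2)] by (simp add: tangle_diagram_def)
    show ?thesis
      unfolding J_labels(2)[OF gen a] chord_sum_def gauss_def fst_conv snd_conv
        sum.inter_filter[OF chord_diagram_finite[OF generic_chord_diagram[OF gen]]]
      by (rule sum.cong) simp_all
  qed
  have mixed: "\<forall>x y. (x, y, y) \<notin> mixed_label a" by (simp add: mixed_label_def)
  have "linking a T = chord_sum on_B (mixed_label a) (\<lambda>_. 1) (gauss str_AB E)"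
    unfolding linking_def
  proof (rule the_equality)
    show "\<exists>E'\<in>T. chord_sum on_B (mixed_label a) (\<lambda>_. 1) (gauss str_AB E) = (\<Sum>c\<in>J_mixed a E'. tsign E' c)"
      using sum[OF T(2)] T(2) by metis
    fix n assume "\<exists>E'\<in>T. n = (\<Sum>c\<in>J_mixed a E'. tsign E' c)"
    then obtain E' where E': "E' \<in> T" "n = (\<Sum>c\<in>J_mixed a E'. tsign E' c)" by blast
    show "n = chord_sum on_B (mixed_label a) (\<lambda>_. 1) (gauss str_AB E)"
      unfolding E'(2) sum[OF E'(1)]
      by (rule chord_sum_equiv[OF tangle_members(2)[OF T(1) E'(1) T(2)]]) (use mixed in blast)
  qed
  then show ?thesis by (simp add: chord_sum_def of_int_sum if_distrib cong: if_cong)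
qed

text \<open>The crossings of \<open>D\<close> all occur during \<open>{-r..r}\<close>, and these
  times run between the end of the first string and the start of the second: this is the order
  required by \<open>chord_insertion\<close>.\<close>

lemma sum_insertion:
  assumes "sum_diagram E D X"
  obtains \<sigma> \<tau> where "chord_insertion (over E) (over D) (crossing_sign str_AB E) (crossing_sign UNIV D)
      (crossing_sign UNIV X) \<sigma> \<tau> on_B" "over X = map_prod \<sigma> \<sigma> ` over E \<union> map_prod \<tau> \<tau> ` over D"
proof -
  obtain r \<sigma> \<tau> h k where diag: "tangle_diagram E" "long_diagram D" "long_diagram X" and r: "r > 0"
    and D_out: "\<forall>t. (r \<le> \<bar>t\<bar> \<longrightarrow> curve D t = of_real t) \<and> (\<bar>t\<bar> < r \<longrightarrow> norm (curve D t) < r)"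
    and \<sigma>: "increasing_reparam str_AB \<sigma>" and \<tau>: "increasing_reparam {-r..r} \<tau>"
    and order: "\<sigma> 1 < \<tau> (- r)" "\<tau> r < \<sigma> 2" and hk: "oriented_diffeo h" "oriented_diffeo k"
    and curve: "\<forall>t\<in>str_AB. curve X (\<sigma> t) = h (curve E t)" "\<forall>t\<in>{-r..r}. curve X (\<tau> t) = k (curve D t)"
    and over: "over X = map_prod \<sigma> \<sigma> ` over E \<union> map_prod \<tau> \<tau> ` over D"
    using assms unfolding sum_diagram_def by (elim exE conjE) (rule that)
  have gen: "generic_diagram str_AB E" "generic_diagram UNIV D" "generic_diagram UNIV X"
    using diag by (auto simp: tangle_diagram_def long_diagram_def)
  have \<sigma>_mono: "strict_mono_on str_AB \<sigma>" and \<tau>_mono: "strict_mono_on {-r..r} \<tau>"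
    using \<sigma> \<tau> by (auto simp: increasing_reparam_def)
  \<comment> \<open>Outside the radius \<open>r\<close> the curve is the real axis, injective there
    and disjoint from the open disk that contains the rest.\<close>
  have inner: "u \<in> {-r..r}" if "curve D u = curve D v" "u \<noteq> v" for u v
  proof (rule ccontr)
    assume "u \<notin> {-r..r}"
    then have u: "r \<le> \<bar>u\<bar>" by auto
    then have cu: "curve D u = of_real u" using D_out by blast
    have "\<not> r \<le> \<bar>v\<bar>"
    proof
      assume "r \<le> \<bar>v\<bar>"
      then have "curve D v = of_real v" using D_out by blast
      then show False using cu that by simp
    qed
    then have "norm (curve D v) < r" using D_out by force
    then show False using cu that(1) u by simp
  qed
  have ends_D: "chord_ends (over D) \<subseteq> {-r..r}"
  proof
    fix t assume "t \<in> chord_ends (over D)"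
    then obtain c where c: "c \<in> over D" "t = fst c \<or> t = snd c" by (auto simp: chord_ends_def)
    note dp = over_double_points[OF gen(2) c(1)]
    have "fst c \<in> {-r..r}" "snd c \<in> {-r..r}"
      using inner[OF dp(4,3)] inner[OF dp(4)[symmetric] dp(3)[symmetric]] .
    then show "t \<in> {-r..r}" using c(2) by blast
  qed
  note ends_E = chord_ends_over_subset[OF gen(1)]
  have "chord_insertion (over E) (over D) (crossing_sign str_AB E) (crossing_sign UNIV D)
      (crossing_sign UNIV X) \<sigma> \<tau> on_B"
  proof
    show "chord_diagram (over E)" "chord_diagram (over D)"
      using generic_chord_diagram gen by blast+
    show "strict_mono_on (chord_ends (over E)) \<sigma>" "strict_mono_on (chord_ends (over D)) \<tau>"
      using \<sigma>_mono \<tau>_mono ends_E ends_D by (meson monotone_on_subset)+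
    show "(\<sigma> u < \<tau> t \<longleftrightarrow> \<not> on_B u) \<and> (\<tau> t < \<sigma> u \<longleftrightarrow> on_B u)"
      if "u \<in> chord_ends (over E)" "t \<in> chord_ends (over D)" for u t
    proof -
      have u: "u \<in> str_AB" and t: "t \<in> {-r..r}" using that ends_E ends_D by blast+
      have le: "\<tau> (- r) \<le> \<tau> t" "\<tau> t \<le> \<tau> r"
        using strict_mono_on_leD[OF \<tau>_mono] t r by auto
      show ?thesis
      proof (cases "on_B u")
        case True
        then have "\<sigma> 2 \<le> \<sigma> u" using strict_mono_on_leD[OF \<sigma>_mono, of 2 u] u by auto
        then show ?thesis using True le order by auto
      next
        case False
        then have "\<sigma> u \<le> \<sigma> 1" using strict_mono_on_leD[OF \<sigma>_mono, of u 1] u by auto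
        then show ?thesis using False le order by auto
      qed
    qed
    show "crossing_sign UNIV X (map_prod \<sigma> \<sigma> c) = crossing_sign str_AB E c" if c: "c \<in> over E" for c
    proof -
      have "crossing_sign UNIV X (\<sigma> (fst c), \<sigma> (snd c)) = crossing_sign str_AB E (fst c, snd c)"
        using over_double_points[OF gen(1) c] curve(1)
        by (intro crossing_sign_transport[OF gen(3,1) str_AB_perfect \<sigma> _ increasing_reparam_id _ hk(1)]) auto
      then show ?thesis by (cases c) simp
    qed
    show "crossing_sign UNIV X (map_prod \<tau> \<tau> c) = crossing_sign UNIV D c" if c: "c \<in> over D" for c
    proof -
      have "at t within {-r..r} \<noteq> bot" if "t \<in> {-r..r}" for t
        using that r by (simp add: trivial_limit_within)
      moreover have "fst c \<in> {-r..r}" "snd c \<in> {-r..r}"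
        using ends_D chord_ends_fst[OF c] chord_ends_snd[OF c] by blast+
      ultimately have "crossing_sign UNIV X (\<tau> (fst c), \<tau> (snd c)) = crossing_sign UNIV D (fst c, snd c)"
        using over_double_points(4)[OF gen(2) c] curve(2)
        by (intro crossing_sign_transport[OF gen(3,2) _ \<tau> _ increasing_reparam_id _ hk(2)]) auto
      then show ?thesis by (cases c) simp
    qed
  qed
  then show thesis using that over by blast
qed

lemma knot_polynomials:
  assumes K: "K \<in> long_virtual_knots" "D \<in> K" and ab: "a \<in> {0, 1}" "b \<in> {0, 1}"
  shows "W_poly a K = chord_sum \<kappa> (type_label a) (\<lambda>m. tpow m - 1) (gauss UNIV D)"
    "F_poly a b K = chord_sum2 \<kappa> (type_label a) (type_label b) \<Phi>_F (gauss UNIV D)"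
    "G_poly a b K = chord_sum2 \<kappa> (type_label a) (type_label b) \<Phi>_G (gauss UNIV D)"
    "H_poly a b K = chord_sum2 \<kappa> (type_label a) (type_label b) \<Phi>_H (gauss UNIV D)"
proof -
  have real: "realization D S f" if "generic_diagram UNIV D" "surface_realization D S f" for D S f
    using generic_chord_diagram[OF that(1)] that(2) by unfold_locales
  have "knot_value (W_diag a) K = chord_sum one_strand (type_label a) (\<lambda>m. tpow m - 1) (gauss UNIV D)"
    by (rule knot_value_eq[OF K])
      (rule realization.W_diag_chord_sum[OF real ab(1)], assumption+, rule chord_sum_equiv, assumption, simp add: tpow_0)
  then show "W_poly a K = chord_sum \<kappa> (type_label a) (\<lambda>m. tpow m - 1) (gauss UNIV D)"
    unfolding W_poly_def by (simp add: chord_sum_typed[of one_strand _ _ _ \<kappa>])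
  have "knot_value (F_diag a b) K = chord_sum2 one_strand (type_label a) (type_label b) \<Phi>_F (gauss UNIV D)"
    by (rule knot_value_eq[OF K])
      (rule realization.F_diag_chord_sum[OF real ab], assumption+, rule chord_sum2_equiv, assumption, simp_all add: \<Phi>_zero)
  then show "F_poly a b K = chord_sum2 \<kappa> (type_label a) (type_label b) \<Phi>_F (gauss UNIV D)"
    unfolding F_poly_def by (simp add: chord_sum2_typed[of one_strand _ _ _ _ \<kappa>])
  have "knot_value (G_diag a b) K = chord_sum2 one_strand (type_label a) (type_label b) \<Phi>_G (gauss UNIV D)"
    by (rule knot_value_eq[OF K])
      (rule realization.G_diag_chord_sum[OF real ab], assumption+, rule chord_sum2_equiv, assumption, simp_all add: \<Phi>_zero)
  then show "G_poly a b K = chord_sum2 \<kappa> (type_label a) (type_label b) \<Phi>_G (gauss UNIV D)"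
    unfolding G_poly_def by (simp add: chord_sum2_typed[of one_strand _ _ _ _ \<kappa>])
  have "knot_value (H_diag a b) K = chord_sum2 one_strand (type_label a) (type_label b) \<Phi>_H (gauss UNIV D)"
    by (rule knot_value_eq[OF K])
      (rule realization.H_diag_chord_sum[OF real ab], assumption+, rule chord_sum2_equiv, assumption, simp_all add: \<Phi>_zero)
  then show "H_poly a b K = chord_sum2 \<kappa> (type_label a) (type_label b) \<Phi>_H (gauss UNIV D)"
    unfolding H_poly_def by (simp add: chord_sum2_typed[of one_strand _ _ _ _ \<kappa>])
qed

theorem theorem4p3:
  fixes T K R S :: "diagram set" and a b :: nat
  assumes "T \<in> virtual_tangles"
    and "K \<in> long_virtual_knots"
    and "is_right_closure T R"
    and "is_tangle_sum T K S"
    and "a \<in> {0, 1}" and "b \<in> {0, 1}"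
  shows "W_poly a S = W_poly a R + W_poly a K
    \<and> F_poly a b S = F_poly a b R + F_poly a b K
        + of_int (linking b T) * W_poly a K + of_int (linking a T) * tinv (W_poly b K)
    \<and> G_poly a b S = G_poly a b R + G_poly a b K
        - of_int (linking b T) * W_poly a K + V_poly a T * W_poly b K
    \<and> H_poly a b S = H_poly a b R + H_poly a b K
        + (U_poly b T - of_int (linking b T)) * tinv (W_poly a K)
        + (tinv (U_poly a T) - of_int (linking a T)) * W_poly b K"
proof -
  note T = assms(1) and K = assms(2) and ab = assms(5,6)
  obtain E1 X1 \<sigma>1 where R: "R \<in> long_virtual_knots" "E1 \<in> T" "X1 \<in> R" "right_closure_diagram E1 X1 \<sigma>1"
    using assms(3) unfolding is_right_closure_def by blast
  obtain E D X where S: "S \<in> long_virtual_knots" "E \<in> T" "D \<in> K" "X \<in> S" "sum_diagram E D X"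
    using assms(4) unfolding is_tangle_sum_def by blast
  obtain \<sigma> \<tau> where ins: "chord_insertion (over E) (over D) (crossing_sign str_AB E) (crossing_sign UNIV D)
      (crossing_sign UNIV X) \<sigma> \<tau> on_B" and over: "over X = map_prod \<sigma> \<sigma> ` over E \<union> map_prod \<tau> \<tau> ` over D"
    using sum_insertion[OF S(5)] by blast
  interpret ins: chord_insertion "over E" "over D" "crossing_sign str_AB E" "crossing_sign UNIV D"
      "crossing_sign UNIV X" \<sigma> \<tau> on_B by fact
  let ?E = "gauss str_AB E" and ?D = "gauss UNIV D"
  have gX: "gauss UNIV X = (ins.X, crossing_sign UNIV X)" by (simp add: gauss_def over ins.X_def)
  have gE: "(over E, crossing_sign str_AB E) = ?E" and gD: "(over D, crossing_sign UNIV D) = ?D"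
    by (simp_all add: gauss_def)
  \<comment> \<open>\<open>E1\<close> is the diagram of T behind the closure and \<open>E\<close>
    the one inside the sum.\<close>
  have equiv_T: "gauss_equiv on_B (gauss str_AB E1) ?E" using tangle_members(2)[OF T R(2) S(2)] .
  have equiv_R: "gauss_equiv one_strand (gauss UNIV X1) (gauss str_AB E1)"
    using closure_step[OF R(4)] by (blast intro: equivclp_sym r_into_equivclp)
  \<comment> \<open>From the closure to \<open>E1\<close> as chords on one strand, then relabelled
    by string, then from \<open>E1\<close> to \<open>E\<close> as diagrams of the tangle.\<close>
  have sum_R: "chord_sum one_strand (type_label c) \<Psi> (gauss UNIV X1) = chord_sum on_B (type_label c) \<Psi> ?E"
    if "\<Psi> 0 = 0" for c and \<Psi> :: "int \<Rightarrow> laurent"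
    using chord_sum_equiv[OF equiv_R, of \<Psi>] chord_sum_equiv[OF equiv_T, of \<Psi>] that
      chord_sum_typed[of one_strand c \<Psi> "gauss str_AB E1" on_B] by simp
  have sum2_R: "chord_sum2 one_strand (type_label a) (type_label b) \<Phi> (gauss UNIV X1) =
      chord_sum2 on_B (type_label a) (type_label b) \<Phi> ?E"
    if "\<And>n. \<Phi> 0 n 0 = 0" "\<And>n. \<Phi> n 0 0 = 0" for \<Phi> :: "int \<Rightarrow> int \<Rightarrow> int \<Rightarrow> laurent"
    using chord_sum2_equiv[OF equiv_R, of \<Phi>] chord_sum2_equiv[OF equiv_T, of \<Phi>] that
      chord_sum2_typed[of one_strand a b \<Phi> "gauss str_AB E1" on_B] by simp
  note poly_R = knot_polynomials[OF R(1,3), where \<kappa> = one_strand]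
  note poly_K = knot_polynomials[OF K S(3), where \<kappa> = one_strand]
  note poly_S = knot_polynomials[OF S(1,4), where \<kappa> = one_strand]
  have U: "U_poly c T = chord_sum on_B (self_label c) (\<lambda>m. tpow m - 1) ?E" if "c \<in> {0, 1}" for c
    unfolding U_poly_def
    by (rule tangle_value_eq[OF T S(2) R(2,4)]) 
      (rule UV_diag_chord_sum(1)[OF _ _ that], assumption+, rule chord_sum_equiv, assumption, simp add: tpow_0)
  have V: "V_poly a T = chord_sum on_B (mixed_label a) tpow ?E"
    unfolding V_poly_def
    by (rule tangle_value_eq[OF T S(2) R(2,4)])
      (rule UV_diag_chord_sum(2)[OF _ _ ab(1)], assumption+, rule chord_sum_equiv, assumption, simp add: mixed_label_def)
  note L = linking_eq[OF T S(2)]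
  note tinv_W = tinv_chord_sum tinv_tpow_minus_1
  have W: "W_poly a S = W_poly a R + W_poly a K"
    unfolding poly_R(1)[OF ab] poly_K(1)[OF ab] poly_S(1)[OF ab] gX
    by (simp add: ins.chord_sum_X[of one_strand _ _ one_strand] gE gD sum_R tpow_0)
  \<comment> \<open>The last assumption on factorization is the second with the roles of the two
    indices exchanged, so the same value of \<open>\<Phi>_F\<close> is used twice; likewise for
    \<open>G\<close> and \<open>H\<close>.\<close>
  have F: "F_poly a b S = F_poly a b R + F_poly a b K
        + of_int (linking b T) * W_poly a K + of_int (linking a T) * tinv (W_poly b K)"
    unfolding poly_R(2)[OF ab] poly_K(2)[OF ab] poly_S(2)[OF ab] poly_K(1)[OF ab] poly_K(1)[OF ab(2,1)] gX
      ins.chord_sum2_X[where \<Phi> = \<Phi>_F and \<kappa>'' = one_strand, OF \<Phi>_values(1,2,3,2)] gE gD L[OF ab(1)] L[OF ab(2)] tinv_W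
    by (simp add: sum2_R \<Phi>_zero algebra_simps)
  have G: "G_poly a b S = G_poly a b R + G_poly a b K
        - of_int (linking b T) * W_poly a K + V_poly a T * W_poly b K"
    unfolding poly_R(3)[OF ab] poly_K(3)[OF ab] poly_S(3)[OF ab] poly_K(1)[OF ab] poly_K(1)[OF ab(2,1)] gX
      ins.chord_sum2_X[where \<Phi> = \<Phi>_G and \<kappa>'' = one_strand, OF \<Phi>_values(4,5,6,5)] gE gD L[OF ab(2)] V chord_sum_minus
    by (simp add: sum2_R \<Phi>_zero algebra_simps)
  have H: "H_poly a b S = H_poly a b R + H_poly a b K
        + (U_poly b T - of_int (linking b T)) * tinv (W_poly a K)
        + (tinv (U_poly a T) - of_int (linking a T)) * W_poly b K"
    unfolding poly_R(4)[OF ab] poly_K(4)[OF ab] poly_S(4)[OF ab] poly_K(1)[OF ab] poly_K(1)[OF ab(2,1)] gX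
      ins.chord_sum2_X[where \<Phi> = \<Phi>_H and \<kappa>'' = one_strand, OF \<Phi>_values(7,8,9,8)] gE gD
      L[OF ab(1)] L[OF ab(2)] U[OF ab(1)] U[OF ab(2)] chord_sum_minus tinv_W
    by (simp add: sum2_R \<Phi>_zero algebra_simps)
  show ?thesis using W F G H by blast
qed

end
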